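(* Let $l\in\mathbb{N}$, let $\{P_i\}_{i=0}^l$ be probability measures on $\mathbb{R}$ with finite means $\mu_i$, and let $r_1,\dots,r_l\in\mathbb{R}$, satisfying Assumptions A, B and C stated in the context. Let $I_i$ be the Legendre–Fenchel transform associated with $P_i$. Define $$\Lambda_0=I_0(r_1);$$ $$\Lambda_i=I_i(r_{i+1})+\sum_{k=1}^i\big(I_k(r_k)-I_k(r_{k+1})\big),\quad 1\le i\le l-1;$$ $$\Lambda_l=I_l(r_l)+\sum_{k=1}^{l-1}\big(I_k(r_k)-I_k(r_{k+1})\big).$$ If $\max_{0\le i\le l}\Lambda_i$ is attained at a unique index $i=i_0$, then the speed $s^D(N,r_1,\dots,r_l)$ of the delayed process $\{X_n^{N;D}\}_{n=0}^\infty$ satisfies $$\lim_{N\to\infty}s^D(N,r_1,\dots,r_l)=\mu_{i_0}.$$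
   Context: Setting. $l\in\mathbb{N}$; $P_0,\dots,P_l$ (the increment distributions) are probability measures on $\mathbb{R}$ with finite means $\mu_i=\int x\,P_i(dx)$; $r_1,\dots,r_l$ are real numbers (thresholds). Set $r_0=-\infty$, $r_{l+1}=+\infty$. $N\in\mathbb{N}$ with $N\ge l$ is the history window. Assumption A: $\mu_0<\mu_1<\dots<\mu_l$; $r_i<\mu_i<r_{i+1}$ for $i=1,\dots,l-1$; $\mu_0<r_1$; and $r_l<\mu_l$. Assumption B: $P_i((-\infty,r_i))>0$ and $P_i([r_{i+1},\infty))>0$ for $i=1,\dots,l-1$; $P_0([r_1,\infty))>0$; $P_l((-\infty,r_l))>0$. Assumption C: there is $t_0>0$ such that $M_i(\pm t_0)<\infty$ for all $i=0,\dots,l$, where $M_i(t)=\int e^{tx}P_i(dx)$. Legendre–Fenchel transform: $I_i(r)=\sup_{\lambda\in\mathbb{R}}\big(\lambda r-\log M_i(\lambda)\big)$, $r\in\mathbb{R}$. Delayed process $\{X^{N;D}_n\}_{n\ge0}$: $X^{N;D}_0=0$. At each time $n\ge0$ the process has a regime $J_n\in\{0,\dots,l\}$ and, conditionally on the past (positions and regimes up to time $n$), the increment $X^{N;D}_{n+1}-X^{N;D}_n$ has distribution $P_{J_n}$. For the first $N$ jumps, $J_0=\dots=J_{N-1}=i_*$ for some fixed starting regime $i_*\in\{0,\dots,l\}$. For $n\ge N$, let $i=J_{n-1}$. If $J_{n-N}\ne i$ then $J_n=i$. If $J_{n-N}=i$, let $A_n=\frac{X^{N;D}_n-X^{N;D}_{n-N}}{N}$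 and put $J_n=i$ if $A_n\in[r_i,r_{i+1})$, $J_n=i-1$ if $A_n<r_i$, and $J_n=i+1$ if $A_n\ge r_{i+1}$. (Thus each regime is used at least $N$ consecutive times once entered.) Speed: under Assumptions A and B, $s^D(N,r_1,\dots,r_l)$ denotes the limit $\lim_{n\to\infty}X^{N;D}_n/n$, which exists almost surely and is almost surely constant. *)

theory Defs
  imports "HOL-Probability.Probability"
begin

definition mean :: "real measure \<Rightarrow> real" where
  "mean Q = (\<integral>x. x \<partial>Q)"

definition mgf :: "real measure \<Rightarrow> real \<Rightarrow> ennreal" where
  "mgf Q t = (\<integral>\<^sup>+x. ennreal (exp (t * x)) \<partial>Q)"

definition extended_ln :: "ennreal \<Rightarrow> ereal" where
  "extended_ln m = (if m = 0 then -\<infinity> else if m = \<infinity> then \<infinity> else ereal (ln (enn2real m)))"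

text \<open>
  The moment generating function may be infinite at some points; there
  \<open>ereal (lam * a) - \<infinity> = -\<infinity>\<close>, so such points do not contribute to the supremum.
\<close>

definition legendre_fenchel :: "real measure \<Rightarrow> real \<Rightarrow> ereal" where
  "legendre_fenchel Q a = (SUP lam. ereal (lam * a) - extended_ln (mgf Q lam))"

text \<open>
  The thresholds are the values \<open>r 1, \<dots>, r l\<close> of a function on \<open>nat\<close>; its other values are never
  used.  The conventions \<open>r\<^sub>0 = -\<infinity>\<close> and \<open>r\<^sub>l\<^sub>+\<^sub>1 = \<infinity>\<close> are built into the following function.
\<close>

definition threshold :: "nat \<Rightarrow> (nat \<Rightarrow> real) \<Rightarrow> nat \<Rightarrow> ereal" where
  "threshold l r i = (if i = 0 then -\<infinity> else if i \<le> l then ereal (r i) else \<infinity>)"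

definition assumption_A :: "nat \<Rightarrow> (nat \<Rightarrow> real measure) \<Rightarrow> (nat \<Rightarrow> real) \<Rightarrow> bool" where
  "assumption_A l P r \<longleftrightarrow>
     (\<forall>i<l. mean (P i) < mean (P (i + 1))) \<and>
     (\<forall>i\<in>{1..l - 1}. r i < mean (P i) \<and> mean (P i) < r (i + 1)) \<and>
     mean (P 0) < r 1 \<and> r l < mean (P l)"

definition assumption_B :: "nat \<Rightarrow> (nat \<Rightarrow> real measure) \<Rightarrow> (nat \<Rightarrow> real) \<Rightarrow> bool" where
  "assumption_B l P r \<longleftrightarrow>
     (\<forall>i\<in>{1..l - 1}. measure (P i) {..<r i} > 0 \<and> measure (P i) {r (i + 1)..} > 0) \<and>
     measure (P 0) {r 1..} > 0 \<and> measure (P l) {..<r l} > 0"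

definition assumption_C :: "nat \<Rightarrow> (nat \<Rightarrow> real measure) \<Rightarrow> bool" where
  "assumption_C l P \<longleftrightarrow>
     (\<exists>t0>0. \<forall>i\<le>l. mgf (P i) t0 < \<infinity> \<and> mgf (P i) (- t0) < \<infinity>)"

text \<open>
  The differences below are taken in \<open>ereal\<close>.  Under assumptions A and B every value of the
  Legendre-Fenchel transform that occurs is finite, so no indeterminate difference arises.
\<close>

definition Lam :: "nat \<Rightarrow> (nat \<Rightarrow> real measure) \<Rightarrow> (nat \<Rightarrow> real) \<Rightarrow> nat \<Rightarrow> ereal" where
  "Lam l P r i =
     (if i = 0 then legendre_fenchel (P 0) (r 1)
      else if i < l then
        legendre_fenchel (P i) (r (i + 1)) +
        (\<Sum>k=1..i. legendre_fenchel (P k) (r k) - legendre_fenchel (P k) (r (k + 1)))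
      else
        legendre_fenchel (P l) (r l) +
        (\<Sum>k=1..l - 1. legendre_fenchel (P k) (r k) - legendre_fenchel (P k) (r (k + 1))))"

text \<open>
  \<open>past M X J n\<close> is the sigma-algebra generated by \<open>X 0, J 0, \<dots>, X n, J n\<close>.
\<close>

definition past :: "'a measure \<Rightarrow> (nat \<Rightarrow> 'a \<Rightarrow> real) \<Rightarrow> (nat \<Rightarrow> 'a \<Rightarrow> nat) \<Rightarrow> nat \<Rightarrow> 'a measure" where
  "past M X J n = vimage_algebra (space M) (\<lambda>\<omega>. \<lambda>k\<in>{..n}. (X k \<omega>, J k \<omega>))
     (\<Pi>\<^sub>M k\<in>{..n}. borel \<Otimes>\<^sub>M count_space UNIV)"

lemma subalgebra_past:
  assumes [measurable]: "\<And>k. X k \<in> borel_measurable M" "\<And>k. J k \<in> measurable M (count_space UNIV)"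
  shows "subalgebra M (past M X J n)"
proof -
  have "(\<lambda>\<omega>. \<lambda>k\<in>{..n}. (X k \<omega>, J k \<omega>)) \<in> measurable M (\<Pi>\<^sub>M k\<in>{..n}. borel \<Otimes>\<^sub>M count_space UNIV)"
    by measurable
  then show ?thesis
    unfolding past_def subalgebra_def
    by (simp add: sets_image_in_sets)
qed

definition next_regime :: "nat \<Rightarrow> (nat \<Rightarrow> real) \<Rightarrow> nat \<Rightarrow> real \<Rightarrow> nat" where
  "next_regime l r i a =
     (if ereal a < threshold l r i then i - 1
      else if ereal a \<ge> threshold l r (i + 1) then i + 1
      else i)"

text \<open>
  \<open>X\<close> is the position and \<open>J\<close> the regime of a delayed process with history window \<open>N\<close> and
  starting regime \<open>i_start\<close>, realised on an arbitrary probability space \<open>M\<close>.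
\<close>

definition delayed_process ::
  "nat \<Rightarrow> (nat \<Rightarrow> real measure) \<Rightarrow> (nat \<Rightarrow> real) \<Rightarrow> nat \<Rightarrow> nat \<Rightarrow>
   'a measure \<Rightarrow> (nat \<Rightarrow> 'a \<Rightarrow> real) \<Rightarrow> (nat \<Rightarrow> 'a \<Rightarrow> nat) \<Rightarrow> bool" where
  "delayed_process l P r N i_start M X J \<longleftrightarrow>
     prob_space M \<and>
     (\<forall>n. X n \<in> borel_measurable M) \<and>
     (\<forall>n. J n \<in> measurable M (count_space UNIV)) \<and>
     (\<forall>\<omega>\<in>space M. X 0 \<omega> = 0) \<and>
     (\<forall>\<omega>\<in>space M. \<forall>n<N. J n \<omega> = i_start) \<and>
     (\<forall>\<omega>\<in>space M. \<forall>n\<ge>N. J n \<omega> =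
        (if J (n - N) \<omega> = J (n - 1) \<omega>
         then next_regime l r (J (n - 1) \<omega>) ((X n \<omega> - X (n - N) \<omega>) / real N)
         else J (n - 1) \<omega>)) \<and>
     (\<forall>n. \<forall>A\<in>sets borel. AE \<omega> in M.
        real_cond_exp M (past M X J n) (\<lambda>\<omega>'. indicator A (X (n + 1) \<omega>' - X n \<omega>')) \<omega>
          = measure (P (J n \<omega>)) A)"

text \<open>
  The speed is the almost sure, almost surely constant limit of \<open>X n / n\<close>; it is unique if it
  exists, because \<open>M\<close> is a probability measure.
\<close>

definition speed :: "'a measure \<Rightarrow> (nat \<Rightarrow> 'a \<Rightarrow> real) \<Rightarrow> real" where
  "speed M X = (THE s. AE \<omega> in M. (\<lambda>n. X n \<omega> / real n) \<longlonglongrightarrow> s)"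

end

theory Submission
  imports Defs
begin

text \<open>
  While the process stays in regime \<open>i\<close> its increments are i.i.d. with law \<open>P i\<close>.  Let \<open>u i\<close> and \<open>d i\<close> be the
  probability of leaving regime \<open>i\<close> upwards (downwards) divided by the mean length of a stay.  The number of
  upward exits from \<open>i\<close>, minus \<open>u i\<close> times the time spent in \<open>i\<close>, is a martingale up to a bounded error, so it is
  \<open>o(n)\<close> almost surely; the same holds for downward exits.  Upward exits from \<open>i\<close> and downward exits from
  \<open>i + 1\<close> differ by at most 1, hence the occupation frequencies \<open>w i\<close> exist and satisfy
  \<open>w i * u i = w (i + 1) * d (i + 1)\<close>, and the speed is the \<open>w\<close>-average of the means.

  If \<open>a\<close> is the probability that the first window average lies beyond the upper threshold, then
  \<open>a \<le> 2 * N * u i\<close> by Harris' inequality and \<open>u i \<le> a\<close> by independence.  Cramer's theorem for half lines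
  thus gives the exponential decay of \<open>u i\<close> and \<open>d i\<close>, so the weight of regime \<open>i\<close> is of exponential
  order \<open>\<Lambda>\<^sub>i\<close> up to a common shift, and \<open>w\<close> concentrates on \<open>i0\<close>.
\<close>

section \<open>A strong law for orthogonal sequences\<close>

text \<open>The process is given only through conditional probabilities on an arbitrary space, and a
  stay ends at a time read off overlapping windows. Instead of extracting i.i.d. cycles for a
  renewal argument, Doob martingales of single stays are concatenated along the path. Their
  increments are bounded because the mean remaining length of a stay is bounded uniformly over all
  histories, and a strong law that asks only for orthogonality then suffices. The overlap of windows
  also hides the exact exit probability. Only its exponential order matters, so a polynomial loss is
  harmless: \<open>N\<close> comes from looking at survival once per block of \<open>N\<close>
  steps, the 2 from treating the first block apart. Cramer's theorem is needed in a form that copes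
  with a generating function that is infinite at some points, and with a threshold at the very end
  of the support, where the infimum of the generating function need not be attained. The first
  difficulty is met by truncation, the second by a separate case. The common shift of the exponents
  is the value of the transform of \<open>P 0\<close> at \<open>r 1\<close>.\<close>

lemma AE_tendsto_0_of_summable_integral:
  fixes f :: "nat \<Rightarrow> 'a \<Rightarrow> real"
  assumes int: "\<And>m. integrable M (f m)" and nn: "\<And>m \<omega>. f m \<omega> \<ge> 0"
    and le: "\<And>m. (\<integral>\<omega>. f m \<omega> \<partial>M) \<le> b m" and "summable b"
  shows "AE \<omega> in M. (\<lambda>m. f m \<omega>) \<longlonglongrightarrow> 0"
proof -
  have [measurable]: "f m \<in> borel_measurable M" for m using int by auto
  have b: "b m \<ge> 0" for m by (rule order.trans[OF _ le[of m]]) (simp add: nn)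
  have "(\<integral>\<^sup>+\<omega>. (\<Sum>m. ennreal (f m \<omega>)) \<partial>M) = (\<Sum>m. \<integral>\<^sup>+\<omega>. ennreal (f m \<omega>) \<partial>M)"
    by (rule nn_integral_suminf) simp
  also have "\<dots> \<le> (\<Sum>m. ennreal (b m))"
    using le by (intro suminf_le) (auto simp: nn_integral_eq_integral[OF int] nn intro!: ennreal_leI)
  also have "\<dots> = ennreal (suminf b)"
    using b \<open>summable b\<close> by (simp add: suminf_ennreal2)
  finally have "(\<integral>\<^sup>+\<omega>. (\<Sum>m. ennreal (f m \<omega>)) \<partial>M) \<noteq> \<infinity>"
    by (auto simp: top_unique)
  then have "AE \<omega> in M. (\<Sum>m. ennreal (f m \<omega>)) \<noteq> \<infinity>"
    by (intro nn_integral_PInf_AE) auto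
  then show ?thesis
  proof eventually_elim
    case (elim \<omega>)
    then have "summable (\<lambda>m. f m \<omega>)" by (intro summable_suminf_not_top) (auto simp: nn)
    then show ?case by (rule summable_LIMSEQ_zero)
  qed
qed

lemma integrable_mult_of_squares:
  fixes f g :: "'a \<Rightarrow> real"
  assumes [measurable]: "f \<in> borel_measurable M" "g \<in> borel_measurable M"
    and sq: "integrable M (\<lambda>\<omega>. (f \<omega>)\<^sup>2)" "integrable M (\<lambda>\<omega>. (g \<omega>)\<^sup>2)"
  shows "integrable M (\<lambda>\<omega>. f \<omega> * g \<omega>)"
proof (rule Bochner_Integration.integrable_bound)
  show "integrable M (\<lambda>\<omega>. (f \<omega>)\<^sup>2 + (g \<omega>)\<^sup>2)" using sq by simp
  show "AE \<omega> in M. norm (f \<omega> * g \<omega>) \<le> norm ((f \<omega>)\<^sup>2 + (g \<omega>)\<^sup>2)"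
  proof (rule AE_I2)
    fix \<omega>
    have "0 \<le> (\<bar>f \<omega>\<bar> - \<bar>g \<omega>\<bar>)\<^sup>2" by simp
    then have "2 * (\<bar>f \<omega>\<bar> * \<bar>g \<omega>\<bar>) \<le> (f \<omega>)\<^sup>2 + (g \<omega>)\<^sup>2" by (simp add: power2_diff)
    moreover have "0 \<le> \<bar>f \<omega>\<bar> * \<bar>g \<omega>\<bar>" by simp
    ultimately have "\<bar>f \<omega>\<bar> * \<bar>g \<omega>\<bar> \<le> (f \<omega>)\<^sup>2 + (g \<omega>)\<^sup>2" by linarith
    then show "norm (f \<omega> * g \<omega>) \<le> norm ((f \<omega>)\<^sup>2 + (g \<omega>)\<^sup>2)" by (simp add: abs_mult)
  qed
qed simp

text \<open>Orthogonality makes the second moment of the \<open>n\<close>-th partial sum at most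
  \<open>n * C\<close>, so along the squares the normalised sums have summable second moments.
  Between \<open>m^2\<close> and \<open>(m+1)^2\<close> the sum of absolute values has L2 norm of
  order \<open>m\<close> only, which is small against \<open>m^2\<close>.\<close>

lemma strong_law_orthogonal:
  fixes D :: "nat \<Rightarrow> 'a \<Rightarrow> real"
  assumes meas [measurable]: "\<And>k. D k \<in> borel_measurable M"
    and sq: "\<And>k. integrable M (\<lambda>\<omega>. (D k \<omega>)\<^sup>2)" and le: "\<And>k. (\<integral>\<omega>. (D k \<omega>)\<^sup>2 \<partial>M) \<le> C"
    and orth: "\<And>j k. j < k \<Longrightarrow> (\<integral>\<omega>. D j \<omega> * D k \<omega> \<partial>M) = 0"
  shows "AE \<omega> in M. (\<lambda>n. (\<Sum>k<n. D k \<omega>) / real n) \<longlonglongrightarrow> 0"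
proof -
  define S where "S n \<omega> = (\<Sum>k<n. D k \<omega>)" for n \<omega>
  define G where "G m \<omega> = (\<Sum>k\<in>{m\<^sup>2..<(Suc m)\<^sup>2}. \<bar>D k \<omega>\<bar>)" for m \<omega>
  have C0: "C \<ge> 0" by (rule order.trans[OF _ le[of 0]]) simp
  have prod: "integrable M (\<lambda>\<omega>. D j \<omega> * D k \<omega>)" for j k
    by (intro integrable_mult_of_squares sq meas)
  have S: "integrable M (\<lambda>\<omega>. (S n \<omega>)\<^sup>2) \<and> (\<integral>\<omega>. (S n \<omega>)\<^sup>2 \<partial>M) \<le> real n * C" for n
  proof (induction n)
    case 0
    show ?case by (simp add: S_def)
  next
    case (Suc n)
    have eq: "(S (Suc n) \<omega>)\<^sup>2 = (S n \<omega>)\<^sup>2 + (2 * (\<Sum>j<n. D j \<omega> * D n \<omega>) + (D n \<omega>)\<^sup>2)" for \<omega>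
      by (simp add: S_def power2_sum sum_distrib_right mult.assoc)
    have "(\<integral>\<omega>. (S (Suc n) \<omega>)\<^sup>2 \<partial>M) =
        (\<integral>\<omega>. (S n \<omega>)\<^sup>2 \<partial>M) + (2 * (\<Sum>j<n. \<integral>\<omega>. D j \<omega> * D n \<omega> \<partial>M) + (\<integral>\<omega>. (D n \<omega>)\<^sup>2 \<partial>M))"
      unfolding eq using Suc sq prod by simp
    also have "\<dots> \<le> real n * C + (2 * 0 + C)"
      using Suc le[of n] by (intro add_mono) (auto simp: orth)
    finally show ?case unfolding eq using Suc sq prod by (simp add: algebra_simps)
  qed
  have cs: "(G m \<omega>)\<^sup>2 \<le> (2 * real m + 1) * (\<Sum>k\<in>{m\<^sup>2..<(Suc m)\<^sup>2}. (D k \<omega>)\<^sup>2)" for m \<omega>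
  proof -
    have "(G m \<omega>)\<^sup>2 \<le> (\<Sum>k\<in>{m\<^sup>2..<(Suc m)\<^sup>2}. 1\<^sup>2) * (\<Sum>k\<in>{m\<^sup>2..<(Suc m)\<^sup>2}. \<bar>D k \<omega>\<bar>\<^sup>2)"
      unfolding G_def using Cauchy_Schwarz_ineq_sum[of "\<lambda>_. 1" "\<lambda>k. \<bar>D k \<omega>\<bar>" "{m\<^sup>2..<(Suc m)\<^sup>2}"] by simp
    moreover have "real ((Suc m)\<^sup>2 - m\<^sup>2) = 2 * real m + 1"
      by (simp add: power2_eq_square algebra_simps of_nat_diff)
    ultimately show ?thesis by simp
  qed
  have G_int: "integrable M (\<lambda>\<omega>. (G m \<omega>)\<^sup>2)" for m
  proof (rule Bochner_Integration.integrable_bound)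
    show "integrable M (\<lambda>\<omega>. (2 * real m + 1) * (\<Sum>k\<in>{m\<^sup>2..<(Suc m)\<^sup>2}. (D k \<omega>)\<^sup>2))"
      using sq by simp
    show "(\<lambda>\<omega>. (G m \<omega>)\<^sup>2) \<in> borel_measurable M" unfolding G_def by measurable
    show "AE \<omega> in M. norm ((G m \<omega>)\<^sup>2) \<le> norm ((2 * real m + 1) * (\<Sum>k\<in>{m\<^sup>2..<(Suc m)\<^sup>2}. (D k \<omega>)\<^sup>2))"
      using cs[of m] by (intro AE_I2) (auto intro: order.trans[OF _ abs_ge_self])
  qed
  have G_le: "(\<integral>\<omega>. (G m \<omega>)\<^sup>2 \<partial>M) \<le> (2 * real m + 1)\<^sup>2 * C" for m
  proof -
    have "(\<integral>\<omega>. (G m \<omega>)\<^sup>2 \<partial>M) \<le> (\<integral>\<omega>. (2 * real m + 1) * (\<Sum>k\<in>{m\<^sup>2..<(Suc m)\<^sup>2}. (D k \<omega>)\<^sup>2) \<partial>M)"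
      using sq G_int cs by (intro integral_mono) auto
    also have "\<dots> = (2 * real m + 1) * (\<Sum>k\<in>{m\<^sup>2..<(Suc m)\<^sup>2}. \<integral>\<omega>. (D k \<omega>)\<^sup>2 \<partial>M)"
      using sq by simp
    also have "\<dots> \<le> (2 * real m + 1) * (\<Sum>k\<in>{m\<^sup>2..<(Suc m)\<^sup>2}. C)"
      using le by (intro mult_left_mono sum_mono) auto
    also have "\<dots> = (2 * real m + 1)\<^sup>2 * C"
      by (simp add: power2_eq_square algebra_simps of_nat_diff)
    finally show ?thesis .
  qed
  \<comment> \<open>With \<open>m\<close> at least 1, the partial sum contributes \<open>m^2\<close>
    and the gap at most \<open>(3 * m)^2\<close>, whence the factor 10 = 1 + 9; the shift to
    \<open>Suc m\<close> avoids division by zero.\<close>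
  define b where "b m = 10 * C / (real (Suc m))\<^sup>2" for m
  have b: "summable b"
  proof -
    have "summable (\<lambda>m. 1 / (real (Suc m))\<^sup>2)"
      using inverse_squares_sums[THEN sums_summable] by (simp add: add.commute)
    from summable_mult[OF this, of "10 * C"] show ?thesis unfolding b_def by simp
  qed
  define f where "f m \<omega> = (S ((Suc m)\<^sup>2) \<omega> / (real (Suc m))\<^sup>2)\<^sup>2 + (G (Suc m) \<omega> / (real (Suc m))\<^sup>2)\<^sup>2" for m \<omega>
  have "AE \<omega> in M. (\<lambda>m. f m \<omega>) \<longlonglongrightarrow> 0"
  proof (rule AE_tendsto_0_of_summable_integral[OF _ _ _ b])
    fix m
    show "integrable M (f m)" unfolding f_def using S G_int by (simp add: power_divide)
    show "f m \<omega> \<ge> 0" for \<omega> by (simp add: f_def)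
    let ?m = "real (Suc m)"
    have "?m \<ge> 1" by simp
    have "(\<integral>\<omega>. f m \<omega> \<partial>M) = (\<integral>\<omega>. (S ((Suc m)\<^sup>2) \<omega>)\<^sup>2 \<partial>M) / ?m^4 + (\<integral>\<omega>. (G (Suc m) \<omega>)\<^sup>2 \<partial>M) / ?m^4"
      unfolding f_def using S G_int by (simp add: power_divide flip: power_mult)
    also have "\<dots> \<le> (?m\<^sup>2 * C) / ?m^4 + ((2 * ?m + 1)\<^sup>2 * C) / ?m^4"
      using S[of "(Suc m)\<^sup>2"] G_le[of "Suc m"] by (intro add_mono divide_right_mono) auto
    also have "\<dots> = (?m\<^sup>2 + (2 * ?m + 1)\<^sup>2) * C / ?m^4"
      by (simp add: add_divide_distrib algebra_simps)
    also have "\<dots> \<le> (10 * ?m\<^sup>2) * C / ?m^4"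
    proof (intro divide_right_mono mult_right_mono C0)
      have "(2 * x + 1)\<^sup>2 \<le> (3 * x)\<^sup>2" if "x \<ge> 1" for x :: real
        using that by (intro power_mono) auto
      from this[OF \<open>?m \<ge> 1\<close>] show "?m\<^sup>2 + (2 * ?m + 1)\<^sup>2 \<le> 10 * ?m\<^sup>2"
        by (simp only: power_mult_distrib) simp
    qed simp
    also have "\<dots> = b m"
    proof -
      have "(10 * x\<^sup>2) * C / x^4 = 10 * C / x\<^sup>2" if "x \<ge> 1" for x :: real
        using that by (simp add: field_simps power4_eq_xxxx power2_eq_square)
      from this[OF \<open>?m \<ge> 1\<close>] show ?thesis unfolding b_def .
    qed
    finally show "(\<integral>\<omega>. f m \<omega> \<partial>M) \<le> b m" .
  qed
  then show ?thesis
  proof eventually_elim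
    case (elim \<omega>)
    define h where "h m = (\<bar>S (m\<^sup>2) \<omega>\<bar> + G m \<omega>) / (real m)\<^sup>2" for m
    have G0: "G m \<omega> \<ge> 0" for m by (simp add: G_def sum_nonneg)
    have hS: "(\<lambda>m. h (Suc m)) \<longlonglongrightarrow> 0"
    proof (rule tendsto_sandwich[OF _ _ tendsto_const])
      show "(\<lambda>m. 2 * sqrt (f m \<omega>)) \<longlonglongrightarrow> 0"
        using tendsto_mult[OF tendsto_const[of 2] tendsto_real_sqrt[OF elim]] by simp
      have "h (Suc m) \<le> 2 * sqrt (f m \<omega>)" for m
      proof -
        have "\<bar>S ((Suc m)\<^sup>2) \<omega> / (real (Suc m))\<^sup>2\<bar> \<le> sqrt (f m \<omega>)"
          by (rule real_le_rsqrt) (simp add: f_def del: of_nat_Suc abs_divide)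
        moreover have "\<bar>G (Suc m) \<omega> / (real (Suc m))\<^sup>2\<bar> \<le> sqrt (f m \<omega>)"
          by (rule real_le_rsqrt) (simp add: f_def del: of_nat_Suc abs_divide)
        ultimately show ?thesis using G0[of "Suc m"]
          by (simp add: h_def add_divide_distrib abs_divide del: of_nat_Suc)
      qed
      then show "\<forall>\<^sub>F m in sequentially. h (Suc m) \<le> 2 * sqrt (f m \<omega>)" by simp
      show "\<forall>\<^sub>F m in sequentially. 0 \<le> h (Suc m)"
        using G0 by (simp add: h_def)
    qed
    then have h: "h \<longlonglongrightarrow> 0" by (simp only: filterlim_sequentially_Suc)
    \<comment> \<open>\<open>n\<close> lies between the squares of \<open>q n\<close> and of its
      successor, so \<open>h (q n)\<close> controls both the sum up to the lower square and the
      rest.\<close>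
    define q where "q n = nat \<lfloor>sqrt (real n)\<rfloor>" for n
    have "filterlim (\<lambda>n. nat \<lfloor>sqrt (real n)\<rfloor>) sequentially sequentially"
      by (intro filterlim_compose[OF filterlim_nat_sequentially] filterlim_compose[OF filterlim_floor_sequentially]
            filterlim_compose[OF sqrt_at_top] filterlim_real_sequentially)
    then have hq: "(\<lambda>n. h (q n)) \<longlonglongrightarrow> 0"
      unfolding q_def by (rule filterlim_compose[OF h])
    have "\<bar>S n \<omega> / real n\<bar> \<le> h (q n)" if "n \<ge> 1" for n
    proof -
      have q1: "(q n)\<^sup>2 \<le> n"
      proof -
        have "real (q n) \<le> sqrt (real n)" unfolding q_def by simp
        then have "(real (q n))\<^sup>2 \<le> (sqrt (real n))\<^sup>2" by (intro power_mono) auto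
        then show ?thesis by (simp flip: of_nat_power)
      qed
      have q2: "n < (Suc (q n))\<^sup>2"
      proof -
        have "sqrt (real n) < real (Suc (q n))" unfolding q_def by (simp add: of_nat_nat) linarith
        then have "(sqrt (real n))\<^sup>2 < (real (Suc (q n)))\<^sup>2" by (intro power_strict_mono) auto
        then show ?thesis by (simp flip: of_nat_power del: of_nat_Suc)
      qed
      have q0: "q n \<ge> 1"
      proof -
        have "1 \<le> sqrt (real n)" using that by simp
        then show ?thesis unfolding q_def by (simp add: le_nat_iff le_floor_iff)
      qed
      have "S n \<omega> = S ((q n)\<^sup>2) \<omega> + (\<Sum>k\<in>{(q n)\<^sup>2..<n}. D k \<omega>)"
        unfolding S_def using q1 by (simp add: sum.atLeastLessThan_concat lessThan_atLeast0)
      then have "\<bar>S n \<omega>\<bar> \<le> \<bar>S ((q n)\<^sup>2) \<omega>\<bar> + (\<Sum>k\<in>{(q n)\<^sup>2..<n}. \<bar>D k \<omega>\<bar>)"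
        using sum_abs[of "\<lambda>k. D k \<omega>" "{(q n)\<^sup>2..<n}"] by linarith
      also have "(\<Sum>k\<in>{(q n)\<^sup>2..<n}. \<bar>D k \<omega>\<bar>) \<le> G (q n) \<omega>"
        unfolding G_def using q2 by (intro sum_mono2) auto
      finally have "\<bar>S n \<omega>\<bar> / real n \<le> (\<bar>S ((q n)\<^sup>2) \<omega>\<bar> + G (q n) \<omega>) / real n"
        using that by (intro divide_right_mono) auto
      also have "\<dots> \<le> h (q n)"
        unfolding h_def using G0[of "q n"] q0 q1 that of_nat_mono[OF q1, where 'a=real]
        by (intro divide_left_mono) auto
      finally show ?thesis by (simp add: abs_divide)
    qed
    then have "\<forall>\<^sub>F n in sequentially. norm (S n \<omega> / real n) \<le> h (q n)"
      by (auto simp: eventually_sequentially)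
    from Lim_null_comparison[OF this hq] show ?case unfolding S_def .
  qed
qed

section \<open>I.i.d. sequences\<close>

text \<open>One sigma-algebra on real sequences for all increment laws, so that measurability does
  not mention \<open>Q\<close>.\<close>

abbreviation seqM :: "(nat \<Rightarrow> real) measure" where
  "seqM \<equiv> (\<Pi>\<^sub>M k\<in>UNIV. borel)"

lemma measurable_case_nat_seqM [measurable (raw)]:
  assumes [measurable]: "f \<in> borel_measurable M" and g: "g \<in> measurable M seqM"
  shows "(\<lambda>x. case_nat (f x) (g x)) \<in> measurable M seqM"
proof (rule measurable_PiM_single')
  have [measurable]: "(\<lambda>x. g x k) \<in> borel_measurable M" for k
    using g by measurable
  show "(\<lambda>x. case k of 0 \<Rightarrow> f x | Suc j \<Rightarrow> g x j) \<in> borel_measurable M" for k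
    by (cases k) auto
qed (simp add: space_PiM)

locale iid_sequence = real_distribution Q for Q :: "real measure"
begin

definition paths :: "(nat \<Rightarrow> real) measure" where
  "paths = (\<Pi>\<^sub>M k\<in>UNIV. Q)"

sublocale seq: sequence_space Q
  by unfold_locales

sublocale paths: prob_space paths
  unfolding paths_def by (rule seq.prob_space_axioms)

lemma sets_paths [measurable_cong, simp]: "sets paths = sets seqM"
  unfolding paths_def by (intro sets_PiM_cong) auto

lemma space_paths [simp]: "space paths = UNIV"
  by (simp add: paths_def space_PiM)

lemma sets_paths_Collect: "Measurable.pred seqM P \<Longrightarrow> {y. P y} \<in> sets paths"
  by (simp add: pred_def space_PiM)

lemma nn_integral_paths_Cons:
  assumes [measurable]: "f \<in> borel_measurable seqM"
  shows "(\<integral>\<^sup>+y. f y \<partial>paths) = (\<integral>\<^sup>+x. (\<integral>\<^sup>+y. f (case_nat x y) \<partial>paths) \<partial>Q)"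
proof -
  have "paths = distr (Q \<Otimes>\<^sub>M paths) paths (\<lambda>(x, y). case_nat x y)"
    using seq.PiM_iter unfolding paths_def by simp
  then have "(\<integral>\<^sup>+y. f y \<partial>paths) = (\<integral>\<^sup>+y. f y \<partial>distr (Q \<Otimes>\<^sub>M paths) paths (\<lambda>(x, y). case_nat x y))"
    by simp
  also have "\<dots> = (\<integral>\<^sup>+p. f (case_nat (fst p) (snd p)) \<partial>(Q \<Otimes>\<^sub>M paths))"
    by (subst nn_integral_distr) (auto simp: case_prod_beta)
  also have "\<dots> = (\<integral>\<^sup>+x. (\<integral>\<^sup>+y. f (case_nat x y) \<partial>paths) \<partial>Q)"
    by (subst paths.nn_integral_fst[symmetric]) auto
  finally show ?thesis .
qed

text \<open>\<open>comb_seq n x y\<close> follows \<open>x\<close> for \<open>n\<close> entries and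
  then runs through \<open>y\<close>. This is the independence of past and future at time
  \<open>n\<close>; every conditioning on the first increments goes through it.\<close>

lemma nn_integral_paths_comb_seq:
  assumes [measurable]: "f \<in> borel_measurable seqM"
  shows "(\<integral>\<^sup>+y. f y \<partial>paths) = (\<integral>\<^sup>+x. (\<integral>\<^sup>+y. f (comb_seq n x y) \<partial>paths) \<partial>paths)"
proof -
  have "paths = distr (paths \<Otimes>\<^sub>M paths) paths (\<lambda>(x, y). comb_seq n x y)"
    using seq.PiM_comb_seq unfolding paths_def by simp
  then have "(\<integral>\<^sup>+y. f y \<partial>paths) = (\<integral>\<^sup>+y. f y \<partial>distr (paths \<Otimes>\<^sub>M paths) paths (\<lambda>(x, y). comb_seq n x y))"
    by simp
  also have "\<dots> = (\<integral>\<^sup>+p. f (comb_seq n (fst p) (snd p)) \<partial>(paths \<Otimes>\<^sub>M paths))"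
    by (subst nn_integral_distr) (auto simp: case_prod_beta)
  also have "\<dots> = (\<integral>\<^sup>+x. (\<integral>\<^sup>+y. f (comb_seq n x y) \<partial>paths) \<partial>paths)"
    by (subst paths.nn_integral_fst[symmetric]) auto
  finally show ?thesis .
qed

lemma nn_integral_paths_prod:
  fixes w :: "real \<Rightarrow> ennreal"
  assumes [measurable]: "w \<in> borel_measurable borel"
  shows "(\<integral>\<^sup>+y. (\<Prod>k<n. w (y k)) \<partial>paths) = (\<integral>\<^sup>+x. w x \<partial>Q) ^ n"
proof (induction n)
  case 0
  show ?case by (simp add: paths.emeasure_space_1[simplified])
next
  case (Suc n)
  have "(\<integral>\<^sup>+y. (\<Prod>k<Suc n. w (y k)) \<partial>paths) = (\<integral>\<^sup>+x. (\<integral>\<^sup>+y. (\<Prod>k<Suc n. w (case_nat x y k)) \<partial>paths) \<partial>Q)"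
    by (rule nn_integral_paths_Cons) measurable
  also have "\<dots> = (\<integral>\<^sup>+x. (\<integral>\<^sup>+y. w x * (\<Prod>k<n. w (y k)) \<partial>paths) \<partial>Q)"
    by (simp only: prod.lessThan_Suc_shift) simp
  also have "\<dots> = (\<integral>\<^sup>+x. w x * (\<integral>\<^sup>+x. w x \<partial>Q) ^ n \<partial>Q)"
    by (simp add: nn_integral_cmult Suc.IH)
  also have "\<dots> = (\<integral>\<^sup>+x. w x \<partial>Q) ^ Suc n"
    by (simp add: nn_integral_multc)
  finally show ?case .
qed

end

section \<open>Large deviations on half lines\<close>

lemma exp_le_quadratic:
  fixes z :: real
  assumes "\<bar>z\<bar> \<le> 1"
  shows "exp z \<le> 1 + z + z\<^sup>2"
proof (cases "z \<ge> 0")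
  case True
  then show ?thesis using assms exp_bound[of z] by simp
next
  case False
  define t where "t = - z"
  have t: "0 \<le> t" "t \<le> 1" using False assms by (auto simp: t_def)
  \<comment> \<open>For negative arguments the bound follows from factoring \<open>1 + t^3\<close>,
    with \<open>1 + t\<close> then replaced by \<open>exp t\<close>.\<close>
  have "1 \<le> 1 + t ^ 3" using t by simp
  also have "\<dots> = (1 + t) * (1 - t + t\<^sup>2)" by (simp add: algebra_simps power2_eq_square power3_eq_cube)
  also have "\<dots> \<le> exp t * (1 - t + t\<^sup>2)"
    using t exp_ge_add_one_self[of t] by (intro mult_right_mono) auto
  finally have "exp (- t) \<le> 1 - t + t\<^sup>2" by (simp add: exp_minus field_simps)
  then show ?thesis by (simp add: t_def)
qed

text \<open>Squaring the weak inequality at \<open>z/2\<close> produces the extra term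
  \<open>z^2/4\<close>, which makes it strict.\<close>

lemma exp_gt_add_one:
  fixes z :: real
  assumes "z \<noteq> 0"
  shows "1 + z < exp z"
proof -
  have "1 + z/2 \<le> exp (z/2)" by (rule exp_ge_add_one_self)
  show ?thesis
  proof (cases "1 + z/2 \<ge> 0")
    case True
    have "0 < (z/2)\<^sup>2" using assms by simp
    then have "1 + z < (1 + z/2)\<^sup>2" by (simp add: power2_sum)
    also have "\<dots> \<le> (exp (z/2))\<^sup>2" using True by (intro power_mono) (simp_all add: exp_ge_add_one_self)
    also have "\<dots> = exp z" by (simp add: power2_eq_square flip: exp_add)
    finally show ?thesis .
  next
    case False
    then have "1 + z < 0" by simp
    also have "0 < exp z" by simp
    finally show ?thesis .
  qed
qed

text \<open>This stands in for a vanishing derivative: at a minimiser a quadratic upper bound alone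
  forces the linear coefficient to be zero.\<close>

lemma linear_coeff_zero_of_nonneg_near_0:
  fixes a c e :: real
  assumes "e > 0" and "\<And>t. \<bar>t\<bar> \<le> e \<Longrightarrow> 0 \<le> t * a + t\<^sup>2 * c"
  shows "a = 0"
proof (rule ccontr)
  assume "a \<noteq> 0"
  \<comment> \<open>The test point is \<open>- s * a\<close>: the first bound on \<open>s\<close>
    keeps it within distance \<open>e\<close>, the second makes the quadratic term weaker than the
    linear one.\<close>
  define s where "s = min (e / \<bar>a\<bar>) (1 / (2 * (\<bar>c\<bar> + 1)))"
  have s: "s > 0" using \<open>a \<noteq> 0\<close> \<open>e > 0\<close> by (auto simp: s_def)
  have "s * \<bar>a\<bar> \<le> e / \<bar>a\<bar> * \<bar>a\<bar>" by (intro mult_right_mono) (auto simp: s_def)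
  then have "\<bar>- s * a\<bar> \<le> e" using \<open>a \<noteq> 0\<close> s by (simp add: abs_mult)
  from assms(2)[OF this] have "0 \<le> (s * a\<^sup>2) * (s * c - 1)"
    by (simp add: algebra_simps power2_eq_square)
  moreover have "s * c < 1"
  proof -
    have "s * c \<le> s * \<bar>c\<bar>" using s by (intro mult_left_mono) auto
    also have "\<dots> \<le> 1 / (2 * (\<bar>c\<bar> + 1)) * \<bar>c\<bar>" by (intro mult_right_mono) (auto simp: s_def)
    also have "\<dots> < 1" by (simp add: field_simps)
    finally show ?thesis .
  qed
  moreover have "s * a\<^sup>2 > 0" using s \<open>a \<noteq> 0\<close> by simp
  ultimately show False by (simp add: zero_le_mult_iff)
qed

lemma exp_sum_eq_prod: "exp (t * (\<Sum>k<n::nat. f k)) = (\<Prod>k<n. exp (t * f k :: real))"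
  by (simp only: sum_distrib_left exp_sum[OF finite_lessThan])

section \<open>Tilting with truncated generating functions\<close>

context iid_sequence
begin

text \<open>Restriction to bounded values makes the generating function finite and continuous for
  every \<open>t\<close>, whatever the tails of \<open>Q\<close>. It is not renormalised, so it
  increases with \<open>K\<close> to the full one.\<close>

definition trunc_mgf :: "(real \<Rightarrow> real) \<Rightarrow> real \<Rightarrow> real \<Rightarrow> real" where
  "trunc_mgf \<phi> K t = (\<integral>x. indicator {x. \<bar>\<phi> x\<bar> \<le> K} x * exp (t * \<phi> x) \<partial>Q)"

context
  fixes \<phi> :: "real \<Rightarrow> real" and K :: real
  assumes phi [measurable]: "\<phi> \<in> borel_measurable borel" and K: "K > 0"
begin

lemma trunc_integrable:
  fixes B :: real
  assumes [measurable]: "g \<in> borel_measurable borel" and "\<And>x. \<bar>\<phi> x\<bar> \<le> K \<Longrightarrow> \<bar>g x\<bar> \<le> B"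
  shows "integrable Q (\<lambda>x. indicator {x. \<bar>\<phi> x\<bar> \<le> K} x * g x)"
proof (rule integrable_const_bound[of _ "\<bar>B\<bar>"])
  show "AE x in Q. norm (indicator {x. \<bar>\<phi> x\<bar> \<le> K} x * g x) \<le> \<bar>B\<bar>"
    using assms(2) by (intro AE_I2) (auto simp: indicator_def intro: order.trans[OF _ abs_ge_self])
qed measurable

lemma abs_le_trunc:
  fixes y t :: real
  assumes "\<bar>y\<bar> \<le> K"
  shows "t * y \<le> \<bar>t\<bar> * K"
proof -
  have "t * y \<le> \<bar>t\<bar> * \<bar>y\<bar>" using abs_ge_self[of "t * y"] by (simp only: abs_mult)
  also have "\<dots> \<le> \<bar>t\<bar> * K" using assms by (intro mult_left_mono) auto
  finally show ?thesis .
qed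

lemma trunc_mgf_integrable: "integrable Q (\<lambda>x. indicator {x. \<bar>\<phi> x\<bar> \<le> K} x * exp (t * \<phi> x))"
  by (rule trunc_integrable[of _ "exp (\<bar>t\<bar> * K)"]) (auto intro: abs_le_trunc)

lemma trunc_mgf_nonneg: "trunc_mgf \<phi> K t \<ge> 0"
  unfolding trunc_mgf_def by (intro integral_nonneg_AE) auto

lemma nn_integral_trunc_mgf:
  "(\<integral>\<^sup>+x. ennreal (indicator {x. \<bar>\<phi> x\<bar> \<le> K} x * exp (t * \<phi> x)) \<partial>Q) = ennreal (trunc_mgf \<phi> K t)"
  unfolding trunc_mgf_def using trunc_mgf_integrable by (intro nn_integral_eq_integral) auto

lemma continuous_on_trunc_mgf: "continuous_on UNIV (trunc_mgf \<phi> K)"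
proof -
  have "isCont (trunc_mgf \<phi> K) t" for t
  proof (unfold continuous_at_sequentially, intro allI impI)
    fix f :: "nat \<Rightarrow> real" assume f: "f \<longlonglongrightarrow> t"
    then obtain L where L: "\<And>n. norm (f n) \<le> L" by (metis Bseq_def convergentI convergent_imp_Bseq)
    show "(trunc_mgf \<phi> K \<circ> f) \<longlonglongrightarrow> trunc_mgf \<phi> K t"
      unfolding trunc_mgf_def comp_def
    proof (rule integral_dominated_convergence[where w="\<lambda>_. exp (L * K)"])
      show "AE x in Q. (\<lambda>i. indicator {x. \<bar>\<phi> x\<bar> \<le> K} x * exp (f i * \<phi> x)) \<longlonglongrightarrow> indicator {x. \<bar>\<phi> x\<bar> \<le> K} x * exp (t * \<phi> x)"
        using f by (intro AE_I2 tendsto_intros)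
      show "AE x in Q. norm (indicator {x. \<bar>\<phi> x\<bar> \<le> K} x * exp (f i * \<phi> x)) \<le> exp (L * K)" for i
      proof (rule AE_I2)
        fix x
        have "f i * \<phi> x \<le> L * K" if "\<bar>\<phi> x\<bar> \<le> K"
          using abs_le_trunc[OF that, of "f i"] L[of i] K by (auto intro: order.trans mult_right_mono)
        then show "norm (indicator {x. \<bar>\<phi> x\<bar> \<le> K} x * exp (f i * \<phi> x)) \<le> exp (L * K)"
          by (auto simp: indicator_def)
      qed
    qed auto
  qed
  then show ?thesis by (simp add: continuous_on_eq_continuous_at)
qed

text \<open>
  At a minimiser of the truncated generating function \<open>m\<close> the first-order term vanishes, so \<open>m\<close> grows only
  quadratically there; hence the tilted sums concentrate on \<open>[0, e n]\<close> already by Chernoff's bound.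
\<close>

lemma prob_sum_pos_ge_trunc_mgf:
  assumes min: "\<And>t. trunc_mgf \<phi> K t0 \<le> trunc_mgf \<phi> K t" and pos: "measure Q {x. 0 < \<bar>\<phi> x\<bar> \<and> \<bar>\<phi> x\<bar> \<le> K} > 0"
    and "\<delta> > 0"
  shows "\<forall>\<^sub>F n in sequentially. (trunc_mgf \<phi> K t0 * exp (- \<delta>)) ^ n \<le> measure paths {y. (\<Sum>k<n. \<phi> (y k)) > 0}"
proof -
  let ?B = "{x. \<bar>\<phi> x\<bar> \<le> K}"
  define m where "m = trunc_mgf \<phi> K"
  define m1 where "m1 = (\<integral>x. indicator ?B x * (\<phi> x * exp (t0 * \<phi> x)) \<partial>Q)"
  have m1_int: "integrable Q (\<lambda>x. indicator ?B x * (\<phi> x * exp (t0 * \<phi> x)))"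
  proof (rule trunc_integrable)
    show "\<bar>\<phi> x * exp (t0 * \<phi> x)\<bar> \<le> K * exp (\<bar>t0\<bar> * K)" if "\<bar>\<phi> x\<bar> \<le> K" for x
      unfolding abs_mult using K that abs_le_trunc[OF that, of t0] by (intro mult_mono) auto
  qed measurable
  have m_int: "integrable Q (\<lambda>x. indicator ?B x * exp (t * \<phi> x))" for t by (rule trunc_mgf_integrable)
  \<comment> \<open>The quadratic bound on \<open>exp\<close> is used at
    \<open>s * \<phi> x\<close>; the restriction on \<open>s\<close> keeps this argument within
    1.\<close>
  have upper: "m (t0 + s) \<le> m t0 + s * m1 + s\<^sup>2 * (K\<^sup>2 * m t0)" if "\<bar>s\<bar> \<le> 1 / K" for s
  proof -
    have "m (t0 + s) \<le> (\<integral>x. indicator ?B x * exp (t0 * \<phi> x) + s * (indicator ?B x * (\<phi> x * exp (t0 * \<phi> x)))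
        + s\<^sup>2 * (K\<^sup>2 * (indicator ?B x * exp (t0 * \<phi> x))) \<partial>Q)"
      unfolding m_def trunc_mgf_def
    proof (intro integral_mono)
      fix x
      have "exp ((t0 + s) * \<phi> x) \<le> exp (t0 * \<phi> x) + s * (\<phi> x * exp (t0 * \<phi> x)) + s\<^sup>2 * (K\<^sup>2 * exp (t0 * \<phi> x))"
        if x: "\<bar>\<phi> x\<bar> \<le> K"
      proof -
        have "\<bar>s * \<phi> x\<bar> \<le> 1 / K * K" unfolding abs_mult using \<open>\<bar>s\<bar> \<le> 1 / K\<close> x K by (intro mult_mono) auto
        then have "exp (s * \<phi> x) \<le> 1 + s * \<phi> x + (s * \<phi> x)\<^sup>2" using K by (intro exp_le_quadratic) auto
        also have "(s * \<phi> x)\<^sup>2 \<le> s\<^sup>2 * K\<^sup>2"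
          unfolding power_mult_distrib using x K abs_le_square_iff[of "\<phi> x" K] by (intro mult_left_mono) auto
        finally have "exp (t0 * \<phi> x) * exp (s * \<phi> x) \<le> exp (t0 * \<phi> x) * (1 + s * \<phi> x + s\<^sup>2 * K\<^sup>2)"
          by (intro mult_left_mono) auto
        then show ?thesis by (simp add: algebra_simps flip: exp_add)
      qed
      then show "indicator ?B x * exp ((t0 + s) * \<phi> x) \<le> indicator ?B x * exp (t0 * \<phi> x)
          + s * (indicator ?B x * (\<phi> x * exp (t0 * \<phi> x))) + s\<^sup>2 * (K\<^sup>2 * (indicator ?B x * exp (t0 * \<phi> x)))"
        by (auto simp: indicator_def)
    qed (use m_int m1_int in auto)
    also have "\<dots> = m t0 + s * m1 + s\<^sup>2 * (K\<^sup>2 * m t0)"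
      using m_int m1_int by (simp add: m_def m1_def trunc_mgf_def)
    finally show ?thesis .
  qed
  have m1_0: "m1 = 0"
  proof (rule linear_coeff_zero_of_nonneg_near_0)
    show "1 / K > 0" using K by simp
    show "0 \<le> s * m1 + s\<^sup>2 * (K\<^sup>2 * m t0)" if "\<bar>s\<bar> \<le> 1 / K" for s
      using upper[OF that] min[of "t0 + s"] unfolding m_def by linarith
  qed
  \<comment> \<open>The mass where \<open>\<phi>\<close> is nonzero makes the minimum strict, which
    later renders the part of the tilted mass with nonpositive sum negligible.\<close>
  have strict: "m t0 < m (t0 + s)" if "s \<noteq> 0" for s
  proof -
    define g where "g x = indicator ?B x * (exp (t0 * \<phi> x) * (exp (s * \<phi> x) - 1 - s * \<phi> x))" for x
    have g_eq: "g x = indicator ?B x * exp ((t0 + s) * \<phi> x) - indicator ?B x * exp (t0 * \<phi> x)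
        - s * (indicator ?B x * (\<phi> x * exp (t0 * \<phi> x)))" for x
      by (simp add: g_def algebra_simps exp_add)
    have g_int: "integrable Q g" unfolding g_eq[abs_def] using m_int m1_int by auto
    have g_nn: "g x \<ge> 0" for x unfolding g_def using exp_ge_add_one_self[of "s * \<phi> x"]
      by (intro mult_nonneg_nonneg) (auto simp: algebra_simps)
    have "(\<integral>x. g x \<partial>Q) \<noteq> 0"
    proof
      assume "(\<integral>x. g x \<partial>Q) = 0"
      then have "AE x in Q. g x = 0" by (subst (asm) integral_nonneg_eq_0_iff_AE[OF g_int]) (auto simp: g_nn)
      then have "AE x in Q. x \<notin> {x. 0 < \<bar>\<phi> x\<bar> \<and> \<bar>\<phi> x\<bar> \<le> K}"
      proof eventually_elim
        case (elim x)
        have "exp (s * \<phi> x) - 1 - s * \<phi> x > 0" if "\<phi> x \<noteq> 0"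
          using exp_gt_add_one[of "s * \<phi> x"] that \<open>s \<noteq> 0\<close> by auto
        then show ?case using elim by (auto simp: g_def indicator_def)
      qed
      then have "emeasure Q {x. 0 < \<bar>\<phi> x\<bar> \<and> \<bar>\<phi> x\<bar> \<le> K} = 0"
        by (subst (asm) AE_iff_measurable[OF _ refl]) auto
      with pos show False by (simp add: measure_def)
    qed
    moreover have "(\<integral>x. g x \<partial>Q) \<ge> 0" using g_nn by simp
    moreover have "(\<integral>x. g x \<partial>Q) = m (t0 + s) - m t0 - s * m1"
      unfolding g_eq using m_int m1_int by (simp add: m_def m1_def trunc_mgf_def)
    ultimately show ?thesis using m1_0 by simp
  qed
  \<comment> \<open>For sums in the interval from 0 to \<open>e * n\<close> and tilts of size at
    most \<open>\<bar>t0\<bar> + 1\<close>, the density factor then stays below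
    \<open>exp (\<delta> / 2 * n)\<close>.\<close>
  define e where "e = \<delta> / (2 * (\<bar>t0\<bar> + 1))"
  have e: "e > 0" using \<open>\<delta> > 0\<close> by (simp add: e_def)
  \<comment> \<open>The three bounds serve the size of the tilt \<open>t0 + s\<close>, the validity
    of \<open>upper\<close> at \<open>2 * s\<close>, and the inequality
    \<open>4 * s^2 * K^2 \<le> s * e\<close> behind \<open>far\<close>.\<close>
  define s where "s = min 1 (min (1 / (2 * K)) (e / (8 * K\<^sup>2)))"
  have s: "s > 0" "s \<le> 1" "2 * s \<le> 1 / K" "s \<le> e / (8 * K\<^sup>2)"
  proof -
    show "s > 0" "s \<le> 1" using e K by (auto simp: s_def)
    have "s \<le> 1 / (2 * K)" "s \<le> e / (8 * K\<^sup>2)" by (auto simp: s_def)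
    then show "2 * s \<le> 1 / K" "s \<le> e / (8 * K\<^sup>2)" using K by (auto simp: field_simps)
  qed
  have m_nn: "m t \<ge> 0" for t unfolding m_def by (rule trunc_mgf_nonneg)
  have mpos: "m (t0 + s) > 0" using strict[of s] m_nn[of t0] s by linarith
  have far: "exp (- (s * e)) * m (t0 + s + s) \<le> m t0"
  proof -
    have "m (t0 + 2 * s) \<le> m t0 * (1 + (2 * s)\<^sup>2 * K\<^sup>2)"
    proof -
      have "\<bar>2 * s\<bar> \<le> 1 / K" using s by simp
      from upper[OF this] show ?thesis by (simp only: m1_0) (simp add: algebra_simps)
    qed
    also have "\<dots> \<le> m t0 * exp ((2 * s)\<^sup>2 * K\<^sup>2)"
      using m_nn exp_ge_add_one_self by (intro mult_left_mono) auto
    also have "(2 * s)\<^sup>2 * K\<^sup>2 \<le> s * e"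
    proof -
      have "s * K\<^sup>2 \<le> e / (8 * K\<^sup>2) * K\<^sup>2" using s by (intro mult_right_mono) auto
      also have "\<dots> = e / 8" using K by simp
      finally have "s * (4 * (s * K\<^sup>2)) \<le> s * e" using s e by (intro mult_left_mono) auto
      then show ?thesis by (simp add: power2_eq_square algebra_simps)
    qed
    finally have "m (t0 + 2 * s) \<le> m t0 * exp (s * e)" using m_nn by (simp add: mult_left_mono)
    then have "exp (- (s * e)) * m (t0 + 2 * s) \<le> exp (- (s * e)) * (m t0 * exp (s * e))"
      by (intro mult_left_mono) auto
    also have "\<dots> = m t0" by (simp add: exp_minus)
    finally show ?thesis by (simp add: add.assoc)
  qed
  define t where "t = t0 + s"
  \<comment> \<open>The tilted mass at \<open>t = t0 + s\<close> is split by the sum. Where it is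
    nonpositive, the smaller tilt \<open>t0\<close> dominates; where it exceeds
    \<open>e * n\<close>, tilting once more by \<open>s\<close> gains
    \<open>exp (- (s * e * n))\<close>, which cancels the quadratic growth. What remains is carried
    by the event whose probability is sought.\<close>
  have split: "m t ^ n \<le> 2 * m t0 ^ n + exp (\<delta> / 2 * n) * measure paths {y. (\<Sum>k<n. \<phi> (y k)) > 0}" for n
  proof -
    define w where "w u x = ennreal (indicator ?B x * exp (u * \<phi> x))" for u x
    have [measurable]: "w u \<in> borel_measurable borel" for u unfolding w_def by measurable
    have w: "(\<integral>\<^sup>+y. (\<Prod>k<n. w u (y k)) \<partial>paths) = ennreal (m u ^ n)" for u
    proof -
      have "(\<integral>\<^sup>+x. w u x \<partial>Q) = ennreal (m u)" unfolding w_def m_def by (rule nn_integral_trunc_mgf)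
      then show ?thesis using m_nn by (subst nn_integral_paths_prod) (simp_all add: ennreal_power)
    qed
    have W: "(\<Prod>k<n. w u (y k)) = ennreal ((\<Prod>k<n. indicator ?B (y k)) * exp (u * (\<Sum>k<n. \<phi> (y k))))" for u y
      by (simp add: w_def prod_ennreal exp_sum_eq_prod prod.distrib)
    have I01: "(\<Prod>k<n. indicator ?B (y k) :: real) \<in> {0, 1}" for y
    proof (cases "\<forall>k<n. y k \<in> ?B")
      case True
      then have "(\<Prod>k<n. indicator ?B (y k) :: real) = (\<Prod>k<n. 1)" by (intro prod.cong) auto
      then show ?thesis by simp
    next
      case False
      then obtain k where "k < n" "y k \<notin> ?B" by blast
      then have "(\<Prod>k<n. indicator ?B (y k) :: real) = 0"
        by (intro prod_zero bexI[of _ k]) (simp_all add: indicator_def)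
      then show ?thesis by simp
    qed
    have "ennreal (m t ^ n) = (\<integral>\<^sup>+y. (\<Prod>k<n. w t (y k)) \<partial>paths)" by (simp add: w)
    also have "\<dots> \<le> (\<integral>\<^sup>+y. (\<Prod>k<n. w t0 (y k)) + ennreal (exp (- (s * e * n))) * (\<Prod>k<n. w (t + s) (y k))
         + ennreal (exp (\<delta> / 2 * n)) * indicator {y. (\<Sum>k<n. \<phi> (y k)) > 0} y \<partial>paths)"
    proof (intro nn_integral_mono)
      fix y
      define \<Sigma> where "\<Sigma> = (\<Sum>k<n. \<phi> (y k))"
      consider "\<Sigma> \<le> 0" | "\<Sigma> > e * n" | "\<Sigma> > 0" "\<Sigma> \<le> e * n" by linarith
      then have "exp (t * \<Sigma>) \<le> exp (t0 * \<Sigma>) + exp (- (s * e * n)) * exp ((t + s) * \<Sigma>) + exp (\<delta> / 2 * n) * indicator {0<..} \<Sigma>"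
      proof cases
        case 1
        then have "t * \<Sigma> \<le> t0 * \<Sigma>" using s by (simp add: t_def algebra_simps mult_nonpos_nonneg)
        then have "exp (t * \<Sigma>) \<le> exp (t0 * \<Sigma>)" by simp
        then show ?thesis by (simp add: add_nonneg_nonneg add_increasing2)
      next
        case 2
        have "t * \<Sigma> \<le> - (s * e * n) + (t + s) * \<Sigma>" using 2 s by (simp add: algebra_simps)
        then have "exp (t * \<Sigma>) \<le> exp (- (s * e * n)) * exp ((t + s) * \<Sigma>)" by (simp flip: exp_add)
        moreover have "0 \<le> exp (t0 * \<Sigma>)" "0 \<le> exp (\<delta> / 2 * n) * indicator {0<..} \<Sigma>" by simp_all
        ultimately show ?thesis by linarith
      next
        case 3
        have "t * \<Sigma> \<le> (\<bar>t0\<bar> + 1) * \<Sigma>" using 3 s by (intro mult_right_mono) (auto simp: t_def)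
        also have "\<dots> \<le> (\<bar>t0\<bar> + 1) * (e * n)" using 3 by (intro mult_left_mono) auto
        also have "\<dots> = \<delta> / 2 * n" unfolding e_def by (simp add: field_simps add_pos_nonneg)
        finally have "exp (t * \<Sigma>) \<le> exp (\<delta> / 2 * n)" by simp
        then show ?thesis using 3 by (simp add: add_nonneg_nonneg add_increasing)
      qed
      then have "(\<Prod>k<n. indicator ?B (y k)) * exp (t * \<Sigma>)
         \<le> (\<Prod>k<n. indicator ?B (y k)) * exp (t0 * \<Sigma>) + exp (- (s * e * n)) * ((\<Prod>k<n. indicator ?B (y k)) * exp ((t + s) * \<Sigma>))
           + exp (\<delta> / 2 * n) * indicator {0<..} \<Sigma>"
      proof (cases "(\<Prod>k<n. indicator ?B (y k) :: real) = 0")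
        case True
        show ?thesis unfolding True by simp
      next
        case False
        then have 1: "(\<Prod>k<n. indicator ?B (y k) :: real) = 1" using I01[of y] by blast
        show ?thesis unfolding 1 using \<open>exp (t * \<Sigma>) \<le> _\<close> by simp
      qed
      moreover have "(\<Prod>k<n. indicator ?B (y k) :: real) \<ge> 0" by (intro prod_nonneg) auto
      moreover have "indicator {y. (\<Sum>k<n. \<phi> (y k)) > 0} y = ennreal (indicator {0<..} \<Sigma>)"
        by (simp add: \<Sigma>_def indicator_def)
      ultimately show "(\<Prod>k<n. w t (y k)) \<le> (\<Prod>k<n. w t0 (y k)) + ennreal (exp (- (s * e * n))) * (\<Prod>k<n. w (t + s) (y k))
         + ennreal (exp (\<delta> / 2 * n)) * indicator {y. (\<Sum>k<n. \<phi> (y k)) > 0} y"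
        unfolding W \<Sigma>_def[symmetric] by (simp add: ennreal_leI flip: ennreal_plus ennreal_mult)
    qed
    also have "\<dots> = ennreal (m t0 ^ n) + ennreal (exp (- (s * e * n))) * ennreal (m (t + s) ^ n)
        + ennreal (exp (\<delta> / 2 * n)) * emeasure paths {y. (\<Sum>k<n. \<phi> (y k)) > 0}"
      by (subst nn_integral_add | subst nn_integral_cmult | subst nn_integral_indicator
           | simp add: w sets_paths_Collect del: sets_paths)+
    also have "\<dots> = ennreal (m t0 ^ n + exp (- (s * e * n)) * m (t + s) ^ n
        + exp (\<delta> / 2 * n) * measure paths {y. (\<Sum>k<n. \<phi> (y k)) > 0})"
      using m_nn by (simp add: paths.emeasure_eq_measure flip: ennreal_plus ennreal_mult)
    finally have "m t ^ n \<le> m t0 ^ n + exp (- (s * e * n)) * m (t + s) ^ n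
        + exp (\<delta> / 2 * n) * measure paths {y. (\<Sum>k<n. \<phi> (y k)) > 0}"
      using m_nn by (subst (asm) ennreal_le_iff) (auto intro!: add_nonneg_nonneg)
    moreover have "exp (- (s * e * n)) * m (t + s) ^ n \<le> m t0 ^ n"
    proof -
      have "(exp (- (s * e)) * m (t + s)) ^ n \<le> m t0 ^ n"
        using far m_nn by (intro power_mono) (auto simp: t_def)
      then show ?thesis by (simp add: power_mult_distrib algebra_simps flip: exp_of_nat_mult)
    qed
    ultimately show ?thesis by linarith
  qed
  have "(\<lambda>n. (m t0 / m t) ^ n) \<longlonglongrightarrow> 0"
    using mpos m_nn strict[of s] s by (intro LIMSEQ_realpow_zero) (auto simp: t_def)
  then have ev1: "\<forall>\<^sub>F n in sequentially. (m t0 / m t) ^ n < 1 / 4"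
    by (rule order_tendstoD) simp
  \<comment> \<open>Half of \<open>\<delta>\<close> is spent on the density factor in
    \<open>split\<close>; the other half absorbs the factor 2 lost when the negligible terms are
    moved across.\<close>
  have "(\<lambda>n. (exp (- (\<delta> / 2))) ^ n) \<longlonglongrightarrow> 0"
    using \<open>\<delta> > 0\<close> by (intro LIMSEQ_realpow_zero) auto
  then have ev2: "\<forall>\<^sub>F n in sequentially. (exp (- (\<delta> / 2))) ^ n < 1 / 2"
    by (rule order_tendstoD) simp
  from ev1 ev2 show ?thesis
  proof eventually_elim
    case (elim n)
    let ?p = "measure paths {y. (\<Sum>k<n. \<phi> (y k)) > 0}"
    have "m t ^ n > 0" using mpos by (simp add: t_def)
    then have "2 * m t0 ^ n \<le> m t ^ n / 2" using elim(1) by (simp add: power_divide field_simps)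
    then have "m t ^ n / 2 \<le> exp (\<delta> / 2 * n) * ?p" using split[of n] by linarith
    then have "exp (- (\<delta> / 2 * n)) * (m t ^ n / 2) \<le> exp (- (\<delta> / 2 * n)) * (exp (\<delta> / 2 * n) * ?p)"
      by (intro mult_left_mono) auto
    also have "\<dots> = ?p" by (simp only: mult.assoc[symmetric] exp_add[symmetric]) simp
    finally have 1: "exp (- (\<delta> / 2 * n)) * (m t ^ n / 2) \<le> ?p" .
    have "(m t0 * exp (- \<delta>)) ^ n \<le> (m t * exp (- \<delta>)) ^ n"
      using m_nn min[of t] by (intro power_mono mult_right_mono) (auto simp: m_def)
    also have "\<dots> = exp (- (\<delta> / 2)) ^ n * (exp (- (\<delta> / 2 * n)) * m t ^ n)"
      by (simp add: power_mult_distrib algebra_simps flip: exp_of_nat_mult exp_add)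
    also have "\<dots> \<le> 1 / 2 * (exp (- (\<delta> / 2 * n)) * m t ^ n)"
      using elim(2) m_nn by (intro mult_right_mono) auto
    also have "\<dots> \<le> ?p" using 1 by simp
    finally show ?case unfolding m_def .
  qed
qed

end

end

text \<open>Eventual positivity is part of the notion because the logarithm carries no information
  about \<open>p n\<close> where \<open>p n\<close> is not positive.\<close>

definition decays :: "(nat \<Rightarrow> real) \<Rightarrow> real \<Rightarrow> bool" where
  "decays p I \<longleftrightarrow> (\<lambda>n. ln (p n) / real n) \<longlonglongrightarrow> - I \<and> (\<forall>\<^sub>F n in sequentially. p n > 0)"

lemma decays_cong:
  assumes "decays p I" and ev: "\<forall>\<^sub>F n in sequentially. p n = q n"
  shows "decays q I"
proof -
  have "\<forall>\<^sub>F n in sequentially. ln (p n) / real n = ln (q n) / real n" using ev by eventually_elim simp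
  moreover have "(\<forall>\<^sub>F n in sequentially. p n > 0) = (\<forall>\<^sub>F n in sequentially. q n > 0)"
    by (rule eventually_subst) (use ev in eventually_elim, simp)
  ultimately show ?thesis using assms(1) by (auto simp: decays_def elim: Lim_transform_eventually)
qed

text \<open>The upper bound holds at every \<open>t\<close>, and for each \<open>\<delta>\<close>
  the lower bound nearly matches it at some \<open>t\<close>; so the rate is the negative logarithm
  of the infimum of \<open>M\<close>. That \<open>t\<close> may depend on \<open>\<delta>\<close>
  allows for an infimum that is not attained.\<close>

lemma exponential_rate:
  fixes M :: "real \<Rightarrow> ennreal" and p :: "nat \<Rightarrow> real"
  assumes p: "\<And>n. p n \<ge> 0" and upper: "\<And>t n. ennreal (p n) \<le> M t ^ n"
    and lower: "\<And>\<delta>. \<delta> > 0 \<Longrightarrow> \<exists>t c. 0 < c \<and> M t \<le> ennreal c \<and> (\<forall>\<^sub>F n in sequentially. (c * exp (- \<delta>)) ^ n \<le> p n)"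
  shows "\<exists>I. (SUP t. - extended_ln (M t)) = ereal I \<and> decays p I"
proof -
  obtain t1 c1 where 1: "0 < c1" "M t1 \<le> ennreal c1" "\<forall>\<^sub>F n in sequentially. (c1 * exp (- 1)) ^ n \<le> p n"
    using lower[of 1] by auto
  \<comment> \<open>A single \<open>n1\<close> with a positive lower bound on \<open>p n1\<close>
    bounds all values of \<open>M\<close> away from zero at once, which makes the supremum
    finite.\<close>
  have "\<forall>\<^sub>F n in sequentially. n > 0 \<and> (c1 * exp (- 1)) ^ n \<le> p n"
    using 1(3) eventually_gt_at_top[of 0] by eventually_elim auto
  then obtain n1 where n1: "n1 > 0" "(c1 * exp (- 1)) ^ n1 \<le> p n1"
    using eventually_happens'[OF sequentially_bot] by blast
  have M_ge: "M t \<ge> ennreal (c1 * exp (- 1))" for t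
  proof (rule ccontr)
    assume "\<not> ?thesis"
    then have lt: "M t < ennreal (c1 * exp (- 1))" by simp
    then obtain a where a: "M t = ennreal a" "a \<ge> 0" by (cases "M t") auto
    have "ennreal (p n1) \<le> ennreal (a ^ n1)" using upper[of n1 t] a by (simp add: ennreal_power)
    then have "p n1 \<le> a ^ n1" using a by simp
    moreover have "a < c1 * exp (- 1)" using lt a by (simp add: ennreal_less_iff)
    then have "a ^ n1 < (c1 * exp (- 1)) ^ n1" using a n1 by (intro power_strict_mono) auto
    ultimately show False using n1 by simp
  qed
  have M_pos: "M t \<noteq> 0" for t using M_ge[of t] 1(1) by (auto simp: ennreal_eq_0_iff mult_le_0_iff)
  have ln_le: "ereal (- ln c) \<le> - extended_ln (M t)" if "M t \<le> ennreal c" "c > 0" for t c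
  proof -
    have "M t \<noteq> \<infinity>" using that by (auto simp: top_unique)
    then obtain a where a: "M t = ennreal a" "a \<ge> 0" by (cases "M t") auto
    have "a > 0" using a M_pos[of t] by (cases "a = 0") auto
    moreover have "a \<le> c" using that a by simp
    ultimately show ?thesis using a by (simp add: extended_ln_def)
  qed
  have ln_ge: "- extended_ln (M t) \<le> ereal (- ln c)" if "ennreal c \<le> M t" "c > 0" for t c
  proof (cases "M t")
    case (real a)
    moreover have "c \<le> a" using that real by simp
    ultimately show ?thesis using \<open>c > 0\<close> by (simp add: extended_ln_def)
  qed (use that in \<open>simp add: extended_ln_def\<close>)
  define J where "J = (SUP t. - extended_ln (M t))"
  have "J \<le> ereal (- ln (c1 * exp (- 1)))"
    unfolding J_def using M_ge 1(1) by (intro SUP_least ln_ge) auto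
  moreover have "ereal (- ln c1) \<le> J"
    unfolding J_def using ln_le[OF 1(2,1)] by (intro SUP_upper2[of t1]) auto
  ultimately obtain I where I: "J = ereal I" by (cases J) auto
  have lo: "\<forall>\<^sub>F n in sequentially. exp (- (I + \<delta>)) ^ n \<le> p n" if "\<delta> > 0" for \<delta>
  proof -
    obtain t c where c: "0 < c" "M t \<le> ennreal c" "\<forall>\<^sub>F n in sequentially. (c * exp (- \<delta>)) ^ n \<le> p n"
      using lower[OF \<open>\<delta> > 0\<close>] by blast
    have "ereal (- ln c) \<le> J" unfolding J_def using ln_le[OF c(2,1)] by (intro SUP_upper2[of t]) auto
    then have "- I \<le> ln c" using I by simp
    then have "exp (- I) \<le> c" using c(1) by (simp add: ln_ge_iff)
    then have "exp (- (I + \<delta>)) \<le> c * exp (- \<delta>)" by (simp add: exp_add exp_diff exp_minus field_simps)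
    then have "exp (- (I + \<delta>)) ^ n \<le> (c * exp (- \<delta>)) ^ n" for n by (intro power_mono) auto
    with c(3) show ?thesis by (auto elim!: eventually_mono intro: order.trans)
  qed
  have up: "p n \<le> exp (- (I - \<delta>)) ^ n" if "\<delta> > 0" for \<delta> n
  proof -
    have "ereal (I - \<delta>) < J" using I that by simp
    then obtain t where t: "ereal (I - \<delta>) < - extended_ln (M t)" unfolding J_def less_SUP_iff by blast
    have "M t \<noteq> \<infinity>" using t by (auto simp: extended_ln_def)
    then obtain a where a: "M t = ennreal a" "a \<ge> 0" by (cases "M t") auto
    then have "a > 0" using M_pos[of t] by (cases "a = 0") auto
    then have "I - \<delta> < - ln a" using a t by (simp add: extended_ln_def)
    then have "ln a < - (I - \<delta>)" by simp
    then have "a < exp (- (I - \<delta>))" using \<open>a > 0\<close> by (metis exp_less_cancel_iff exp_ln)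
    have "ennreal (p n) \<le> ennreal (a ^ n)" using upper[of n t] a by (simp add: ennreal_power)
    then have "p n \<le> a ^ n" using a by simp
    also have "\<dots> \<le> exp (- (I - \<delta>)) ^ n" using \<open>a < _\<close> a by (intro power_mono) auto
    finally show ?thesis .
  qed
  have pos: "\<forall>\<^sub>F n in sequentially. p n > 0"
    using lo[of 1, simplified] by eventually_elim (auto intro: less_le_trans[rotated])
  have "(\<lambda>n. ln (p n) / real n) \<longlonglongrightarrow> - I"
  proof (rule tendstoI)
    fix e :: real assume "e > 0"
    then have "e / 2 > 0" by simp
    from lo[OF this] pos eventually_gt_at_top[of 0]
    show "\<forall>\<^sub>F n in sequentially. dist (ln (p n) / real n) (- I) < e"
    proof eventually_elim
      case (elim n)
      have "ln (exp (- (I + e / 2)) ^ n) \<le> ln (p n)" using elim by (subst ln_le_cancel_iff) auto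
      then have "- (I + e / 2) * n \<le> ln (p n)" by (simp add: ln_realpow mult.commute)
      then have "- (I + e / 2) \<le> ln (p n) / n" using elim by (simp add: field_simps)
      moreover have "ln (p n) \<le> ln (exp (- (I - e / 2)) ^ n)"
        using elim up[OF \<open>e / 2 > 0\<close>, of n] by (subst ln_le_cancel_iff) auto
      then have "ln (p n) \<le> - (I - e / 2) * n" by (simp add: ln_realpow mult.commute)
      then have "ln (p n) / n \<le> - (I - e / 2)" using elim by (simp add: field_simps)
      ultimately show ?case using \<open>e > 0\<close> unfolding dist_real_def by linarith
    qed
  qed
  with I pos show ?thesis unfolding J_def decays_def by blast
qed

section \<open>Removing the truncation; Cramer's theorem for half lines\<close>

context iid_sequence
begin

abbreviation mgf_of :: "(real \<Rightarrow> real) \<Rightarrow> real \<Rightarrow> ennreal" where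
  "mgf_of \<phi> t \<equiv> (\<integral>\<^sup>+x. ennreal (exp (t * \<phi> x)) \<partial>Q)"

lemma exists_positive_slab:
  assumes [measurable]: "\<phi> \<in> borel_measurable borel" and pos: "measure Q {x. \<phi> x > 0} > 0"
  shows "\<exists>j. measure Q {x. 1 / real (Suc j) \<le> \<phi> x \<and> \<phi> x \<le> real (Suc j)} > 0"
proof (rule ccontr)
  let ?A = "\<lambda>j. {x. 1 / real (Suc j) \<le> \<phi> x \<and> \<phi> x \<le> real (Suc j)}"
  have [measurable]: "?A j \<in> sets Q" for j by simp
  assume "\<not> ?thesis"
  then have "measure Q (?A j) = 0" for j by (simp add: not_less measure_le_0_iff)
  then have "emeasure Q (?A j) = 0" for j by (simp add: emeasure_eq_measure)
  then have "emeasure Q (\<Union>j. ?A j) = 0" by (intro emeasure_UN_eq_0) auto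
  moreover have "(\<Union>j. ?A j) = {x. \<phi> x > 0}"
  proof (intro set_eqI iffI)
    fix x assume "x \<in> {x. \<phi> x > 0}"
    then have "\<phi> x > 0" by simp
    obtain j where j: "max (\<phi> x) (1 / \<phi> x) < real j" using reals_Archimedean2 by blast
    have "1 / \<phi> x \<le> real (Suc j)" "\<phi> x \<le> real (Suc j)" using j by auto
    then have "1 / real (Suc j) \<le> \<phi> x" using \<open>\<phi> x > 0\<close> by (simp add: field_simps)
    with \<open>\<phi> x \<le> real (Suc j)\<close> show "x \<in> (\<Union>j. ?A j)" by blast
  next
    fix x assume "x \<in> (\<Union>j. ?A j)"
    then obtain j where "1 / real (Suc j) \<le> \<phi> x" by blast
    moreover have "0 < 1 / real (Suc j)" by simp
    ultimately show "x \<in> {x. \<phi> x > 0}" unfolding mem_Collect_eq by linarith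
  qed
  ultimately show False using pos by (simp add: measure_def)
qed

text \<open>Mass on both sides of zero makes all truncated generating functions grow at infinity at
  a common rate, so their minimisers stay in one compact interval. The minimal values increase to a
  limit \<open>R\<close>; compactness gives one \<open>t\<close> where every truncation is at most
  \<open>R\<close>, and monotone convergence passes this to the full function.\<close>

lemma prob_sum_pos_ge:
  assumes [measurable]: "\<phi> \<in> borel_measurable borel"
    and pos: "measure Q {x. \<phi> x > 0} > 0" and neg: "measure Q {x. \<phi> x < 0} > 0"
  shows "\<exists>t c. 0 < c \<and> (mgf_of \<phi> t) \<le> ennreal c
    \<and> (\<forall>\<delta>>0. \<forall>\<^sub>F n in sequentially. (c * exp (- \<delta>)) ^ n \<le> measure paths {y. (\<Sum>k<n. \<phi> (y k)) > 0})"
proof -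
  obtain j1 where j1: "measure Q {x. 1 / real (Suc j1) \<le> \<phi> x \<and> \<phi> x \<le> real (Suc j1)} > 0"
    using exists_positive_slab[OF _ pos] by auto
  obtain j2 where j2: "measure Q {x. 1 / real (Suc j2) \<le> - \<phi> x \<and> - \<phi> x \<le> real (Suc j2)} > 0"
    using exists_positive_slab[of "\<lambda>x. - \<phi> x"] neg by auto
  define J where "J = Suc (max j1 j2)"
  define A1 where "A1 = {x. 1 / real J \<le> \<phi> x \<and> \<phi> x \<le> real J}"
  define A2 where "A2 = {x. 1 / real J \<le> - \<phi> x \<and> - \<phi> x \<le> real J}"
  have [measurable]: "A1 \<in> sets Q" "A2 \<in> sets Q" unfolding A1_def A2_def by simp_all
  have J: "real J \<ge> real (Suc j1)" "real J \<ge> real (Suc j2)" "real J \<ge> 1" by (auto simp: J_def)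
  then have J': "1 / real J \<le> 1 / real (Suc j1)" "1 / real J \<le> 1 / real (Suc j2)" by (intro divide_left_mono; simp)+
  have "measure Q A1 > 0"
    by (rule less_le_trans[OF j1]) (use J J' in \<open>auto simp: A1_def simp del: of_nat_Suc intro!: finite_measure_mono intro: order.trans\<close>)
  have "measure Q A2 > 0"
    by (rule less_le_trans[OF j2]) (use J J' in \<open>auto simp: A2_def simp del: of_nat_Suc intro!: finite_measure_mono intro: order.trans\<close>)
  define \<alpha> where "\<alpha> = min (measure Q A1) (measure Q A2)"
  have \<alpha>: "0 < \<alpha>" "\<alpha> \<le> 1" using \<open>measure Q A1 > 0\<close> \<open>measure Q A2 > 0\<close> by (auto simp: \<alpha>_def min_def)
  define c where "c = 1 / real J"
  have c: "c > 0" using J by (simp add: c_def)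
  define K where "K i = real J + real i" for i
  have K: "K i > 0" "real J \<le> K i" "K i \<le> K (Suc i)" for i using J by (auto simp: K_def)
  define m where "m i = trunc_mgf \<phi> (K i)" for i
  have coercive: "\<alpha> * exp (c * \<bar>t\<bar>) \<le> m i t" for i t
  proof -
    define A where "A = (if t \<ge> 0 then A1 else A2)"
    have "\<alpha> * exp (c * \<bar>t\<bar>) \<le> measure Q A * exp (c * \<bar>t\<bar>)"
      by (intro mult_right_mono) (auto simp: \<alpha>_def A_def)
    also have "\<dots> = (\<integral>x. indicator A x * exp (c * \<bar>t\<bar>) \<partial>Q)" by (simp add: A_def)
    also have "\<dots> \<le> m i t"
      unfolding m_def trunc_mgf_def
    proof (intro integral_mono trunc_mgf_integrable)
      fix x
      have "\<bar>\<phi> x\<bar> \<le> K i \<and> c * \<bar>t\<bar> \<le> t * \<phi> x" if "x \<in> A"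
      proof (cases "t \<ge> 0")
        case True
        then have "c \<le> \<phi> x" "\<phi> x \<le> J" using that by (auto simp: A_def A1_def c_def)
        then show ?thesis using True c K(2)[of i] by (auto simp: mult.commute[of c] intro!: mult_left_mono)
      next
        case False
        then have "c \<le> - \<phi> x" "- \<phi> x \<le> J" using that by (auto simp: A_def A2_def c_def)
        moreover from this have "(- t) * c \<le> (- t) * (- \<phi> x)" using False by (intro mult_left_mono) auto
        ultimately show ?thesis using False c K(2)[of i] by (auto simp: mult.commute[of c])
      qed
      then show "indicator A x * exp (c * \<bar>t\<bar>) \<le> indicator {x. \<bar>\<phi> x\<bar> \<le> K i} x * exp (t * \<phi> x)"
        by (auto simp: indicator_def)
      show "integrable Q (\<lambda>x. indicator A x * exp (c * \<bar>t\<bar>))" unfolding A_def using \<open>A1 \<in> sets Q\<close> \<open>A2 \<in> sets Q\<close>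
        by (cases "t \<ge> 0") (simp_all add: integrable_real_indicator emeasure_eq_measure)
    qed (use K in auto)
    finally show ?thesis .
  qed
  \<comment> \<open>The value is such that \<open>\<alpha> * exp (c * L)\<close> equals
    \<open>exp 1\<close>, which exceeds the value at 0; hence no minimiser lies beyond
    \<open>L\<close>.\<close>
  define L where "L = (1 - ln \<alpha>) / c"
  have "ln \<alpha> \<le> 0" using \<alpha> by simp
  then have L: "L > 0" using c by (simp add: L_def)
  have m0: "m i 0 \<le> 1" for i
  proof -
    have "m i 0 = measure Q {x. \<bar>\<phi> x\<bar> \<le> K i}" by (simp add: m_def trunc_mgf_def)
    then show ?thesis by simp
  qed
  have big: "m i t > 1" if "\<bar>t\<bar> > L" for i t
  proof -
    have "1 < exp 1 * (1::real)" by simp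
    also have "exp 1 * 1 = \<alpha> * exp (c * L)" using c \<alpha> by (simp add: L_def exp_diff)
    also have "\<dots> \<le> \<alpha> * exp (c * \<bar>t\<bar>)" using that c \<alpha> by (intro mult_left_mono) auto
    also have "\<dots> \<le> m i t" by (rule coercive)
    finally show ?thesis .
  qed
  have "\<exists>s. (\<forall>t. m i s \<le> m i t) \<and> \<bar>s\<bar> \<le> L" for i
  proof -
    have "continuous_on {-L..L} (m i)"
      unfolding m_def using continuous_on_trunc_mgf[OF assms(1) K(1)] by (rule continuous_on_subset) simp
    then obtain s where s: "s \<in> {-L..L}" "\<And>t. t \<in> {-L..L} \<Longrightarrow> m i s \<le> m i t"
      using continuous_attains_inf[of "{-L..L}" "m i"] L by auto
    have "m i s \<le> m i t" for t
    proof (cases "\<bar>t\<bar> \<le> L")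
      case True
      then show ?thesis by (intro s) auto
    next
      case False
      then have "m i t > 1" using big by simp
      moreover have "m i s \<le> 1" using s(2)[of 0] L m0[of i] by auto
      ultimately show ?thesis by simp
    qed
    with s show ?thesis by (intro exI[of _ s]) auto
  qed
  then obtain s where s: "\<And>i t. m i (s i) \<le> m i t" "\<And>i. \<bar>s i\<bar> \<le> L" by metis
  have m_mono: "m i t \<le> m (Suc i) t" for i t
    unfolding m_def trunc_mgf_def using K[of i] K[of "Suc i"]
    by (intro integral_mono trunc_mgf_integrable) (auto simp: indicator_def)
  define \<rho> where "\<rho> i = m i (s i)" for i
  have \<rho>_le1: "\<rho> i \<le> 1" for i using s(1)[of i 0] m0[of i] by (simp add: \<rho>_def)
  have \<rho>_mono: "incseq \<rho>"
    unfolding \<rho>_def by (intro incseq_SucI order.trans[OF s(1) m_mono])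
  define R where "R = (SUP i. \<rho> i)"
  have lim: "\<rho> \<longlonglongrightarrow> R"
    unfolding R_def using \<rho>_le1 \<rho>_mono by (intro LIMSEQ_incseq_SUP) (auto simp: bdd_above_def)
  have \<rho>_R: "\<rho> i \<le> R" for i using incseq_le[OF \<rho>_mono lim] .
  have "\<rho> 0 > 0"
    unfolding \<rho>_def by (rule less_le_trans[OF _ coercive]) (use \<alpha> in simp)
  then have R: "R > 0" using \<rho>_R[of 0] by simp
  \<comment> \<open>Sublevel sets at height \<open>R\<close> are compact, nonempty because they
    contain the minimisers \<open>s i\<close>, and decreasing because the truncations increase; a
    common point is the required \<open>t\<close>.\<close>
  define F where "F i = {t \<in> {-L..L}. m i t \<le> R}" for i
  have "(\<Inter>i. F i) \<noteq> {}"
  proof (rule compact_nest)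
    fix i
    have "closed {t. m i t \<le> R}"
      unfolding m_def using continuous_on_trunc_mgf[OF assms(1) K(1)]
      by (intro closed_Collect_le continuous_on_const)
    then have "compact ({-L..L} \<inter> {t. m i t \<le> R})" by (intro compact_Int_closed) auto
    also have "{-L..L} \<inter> {t. m i t \<le> R} = F i" by (auto simp: F_def)
    finally show "compact (F i)" .
    have "s i \<in> F i" using s(2)[of i] \<rho>_R[of i] by (auto simp: F_def \<rho>_def)
    then show "F i \<noteq> {}" by blast
  next
    fix i j :: nat assume "i \<le> j"
    then have "m i t \<le> m j t" for t
      using m_mono by (induction rule: dec_induct) (auto intro: order.trans)
    then show "F j \<subseteq> F i" unfolding F_def by (auto intro: order.trans)
  qed
  then obtain t where t: "m i t \<le> R" for i unfolding F_def by blast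
  have "(mgf_of \<phi> t) \<le> ennreal R"
  proof -
    define f where "f i x = ennreal (indicator {x. \<bar>\<phi> x\<bar> \<le> K i} x * exp (t * \<phi> x))" for i x
    have "incseq f"
    proof (intro incseq_SucI le_funI)
      fix i x
      show "f i x \<le> f (Suc i) x" unfolding f_def using K(3)[of i]
        by (intro ennreal_leI mult_right_mono) (auto simp: indicator_def)
    qed
    have "(SUP i. f i x) = ennreal (exp (t * \<phi> x))" for x
    proof (rule antisym)
      show "(SUP i. f i x) \<le> ennreal (exp (t * \<phi> x))"
        by (intro SUP_least) (auto simp: f_def indicator_def)
      obtain i where "\<bar>\<phi> x\<bar> < real i" using reals_Archimedean2 by blast
      then have "f i x = ennreal (exp (t * \<phi> x))" by (simp add: f_def K_def)
      then show "ennreal (exp (t * \<phi> x)) \<le> (SUP i. f i x)" by (metis SUP_upper UNIV_I)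
    qed
    then have "(mgf_of \<phi> t) = (\<integral>\<^sup>+x. (SUP i. f i x) \<partial>Q)" by simp
    also have "\<dots> = (SUP i. \<integral>\<^sup>+x. f i x \<partial>Q)"
    proof (rule nn_integral_monotone_convergence_SUP[OF \<open>incseq f\<close>])
      show "f i \<in> borel_measurable Q" for i unfolding f_def by measurable
    qed
    also have "\<dots> \<le> ennreal R"
    proof (rule SUP_least)
      fix i show "(\<integral>\<^sup>+x. f i x \<partial>Q) \<le> ennreal R"
        unfolding f_def using t[of i] by (subst nn_integral_trunc_mgf) (auto simp: m_def K intro: ennreal_leI)
    qed
    finally show ?thesis .
  qed
  moreover have "\<forall>\<^sub>F n in sequentially. (R * exp (- \<delta>)) ^ n \<le> measure paths {y. (\<Sum>k<n. \<phi> (y k)) > 0}"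
    if "\<delta> > 0" for \<delta>
  proof -
    have "R * exp (- (\<delta> / 2)) < R" using R that by simp
    then obtain i where i: "R * exp (- (\<delta> / 2)) < \<rho> i"
      using eventually_happens'[OF sequentially_bot order_tendstoD(1)[OF lim]] by blast
    have "measure Q {x. 0 < \<bar>\<phi> x\<bar> \<and> \<bar>\<phi> x\<bar> \<le> K i} > 0"
    proof (rule less_le_trans[OF \<open>measure Q A1 > 0\<close>])
      have "A1 \<subseteq> {x. 0 < \<bar>\<phi> x\<bar> \<and> \<bar>\<phi> x\<bar> \<le> K i}"
        using c K(2)[of i] by (auto simp: A1_def c_def[symmetric])
      then show "measure Q A1 \<le> measure Q {x. 0 < \<bar>\<phi> x\<bar> \<and> \<bar>\<phi> x\<bar> \<le> K i}"
        by (intro finite_measure_mono) auto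
    qed
    from prob_sum_pos_ge_trunc_mgf[OF assms(1) K(1) _ this, of "s i" "\<delta> / 2"] s(1)[of i] that
    have "\<forall>\<^sub>F n in sequentially. (\<rho> i * exp (- (\<delta> / 2))) ^ n \<le> measure paths {y. (\<Sum>k<n. \<phi> (y k)) > 0}"
      by (simp add: m_def \<rho>_def)
    then show ?thesis
    proof eventually_elim
      case (elim n)
      have "R * exp (- \<delta>) = R * exp (- (\<delta> / 2)) * exp (- (\<delta> / 2))" by (simp flip: exp_add)
      also have "\<dots> \<le> \<rho> i * exp (- (\<delta> / 2))" using i by (intro mult_right_mono) auto
      finally have "(R * exp (- \<delta>)) ^ n \<le> (\<rho> i * exp (- (\<delta> / 2))) ^ n" using R by (intro power_mono) auto
      with elim show ?case by simp
    qed
  qed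
  ultimately show ?thesis using R by blast
qed

text \<open>For \<open>t \<ge> 0\<close> this is Markov's inequality. For negative \<open>t\<close>
  the nonpositive mean makes the generating function at least 1, so the bound is trivial there and
  the supremum may range over the whole line, as in \<open>legendre_fenchel\<close>.\<close>

lemma chernoff:
  assumes [measurable]: "\<phi> \<in> borel_measurable borel" and int: "integrable Q \<phi>" and mean: "(\<integral>x. \<phi> x \<partial>Q) \<le> 0"
  shows "ennreal (measure paths {y. (\<Sum>k<n. \<phi> (y k)) \<ge> 0}) \<le> (mgf_of \<phi> t) ^ n"
proof (cases "t \<ge> 0")
  case True
  have "ennreal (measure paths {y. (\<Sum>k<n. \<phi> (y k)) \<ge> 0}) = (\<integral>\<^sup>+y. indicator {y. (\<Sum>k<n. \<phi> (y k)) \<ge> 0} y \<partial>paths)"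
    by (subst nn_integral_indicator) (simp_all add: sets_paths_Collect paths.emeasure_eq_measure del: sets_paths)
  also have "\<dots> \<le> (\<integral>\<^sup>+y. (\<Prod>k<n. ennreal (exp (t * \<phi> (y k)))) \<partial>paths)"
    using True by (intro nn_integral_mono) (auto simp: prod_ennreal indicator_def simp flip: exp_sum_eq_prod)
  also have "\<dots> = (mgf_of \<phi> t) ^ n"
    by (rule nn_integral_paths_prod) simp
  finally show ?thesis .
next
  case False
  have "1 \<le> (mgf_of \<phi> t)"
  proof (cases "(mgf_of \<phi> t) = \<infinity>")
    case fin: False
    have i: "integrable Q (\<lambda>x. exp (t * \<phi> x))"
      using fin by (intro integrableI_bounded) (simp_all add: top.not_eq_extremum)
    have "0 \<le> t * (\<integral>x. \<phi> x \<partial>Q)" using False mean by (intro mult_nonpos_nonpos) auto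
    then have "1 \<le> 1 + t * (\<integral>x. \<phi> x \<partial>Q)" by simp
    also have "\<dots> = (\<integral>x. 1 + t * \<phi> x \<partial>Q)" using int prob_space by simp
    also have "\<dots> \<le> (\<integral>x. exp (t * \<phi> x) \<partial>Q)"
      using int i exp_ge_add_one_self by (intro integral_mono) auto
    finally have "ennreal 1 \<le> ennreal (\<integral>x. exp (t * \<phi> x) \<partial>Q)" by (rule ennreal_leI)
    then show ?thesis using i by (subst nn_integral_eq_integral) simp_all
  qed simp
  then have "1 ^ n \<le> (mgf_of \<phi> t) ^ n" by (intro power_mono) auto
  then have "1 \<le> (mgf_of \<phi> t) ^ n" by simp
  with paths.prob_le_1 show ?thesis by (meson ennreal_le_1 order.trans)
qed

text \<open>If \<open>\<phi>\<close> is positive with positive probability, the negative mean forces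
  mass on the other side too, and the strict event already has the full exponential order. Otherwise
  the walk cannot rise, and the weak event amounts to all steps being zero, whose probability is a
  pure power.\<close>

lemma cramer_half_line:
  assumes [measurable]: "\<phi> \<in> borel_measurable borel" and int: "integrable Q \<phi>" and mean: "(\<integral>x. \<phi> x \<partial>Q) < 0"
    and E: "(\<forall>n. E n = {y. (\<Sum>k<n. \<phi> (y k)) > 0}) \<and> measure Q {x. \<phi> x > 0} > 0
      \<or> (\<forall>n. E n = {y. (\<Sum>k<n. \<phi> (y k)) \<ge> 0}) \<and> measure Q {x. \<phi> x \<ge> 0} > 0"
  shows "\<exists>I. (SUP t. - extended_ln (mgf_of \<phi> t)) = ereal I
    \<and> decays (\<lambda>n. measure paths (E n)) I"
proof (rule exponential_rate)
  have meas: "{y. (\<Sum>k<n. \<phi> (y k)) > 0} \<in> sets paths" "{y. (\<Sum>k<n. \<phi> (y k)) \<ge> 0} \<in> sets paths" for n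
    by (simp_all add: sets_paths_Collect del: sets_paths)
  have sub: "measure paths (E n) \<le> measure paths {y. (\<Sum>k<n. \<phi> (y k)) \<ge> 0}" for n
    using E meas[of n] by (intro paths.finite_measure_mono) auto
  show "ennreal (measure paths (E n)) \<le> (mgf_of \<phi> t) ^ n" for t n
    by (rule order.trans[OF ennreal_leI[OF sub] chernoff]) (use int mean in auto)
  show "\<exists>t c. 0 < c \<and> (mgf_of \<phi> t) \<le> ennreal c
      \<and> (\<forall>\<^sub>F n in sequentially. (c * exp (- \<delta>)) ^ n \<le> measure paths (E n))" if \<delta>: "\<delta> > 0" for \<delta>
  proof (cases "measure Q {x. \<phi> x > 0} > 0")
    case True
    have "measure Q {x. \<phi> x < 0} > 0"
    proof (rule ccontr)
      assume "\<not> ?thesis"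
      then have "emeasure Q {x. \<phi> x < 0} = 0" by (simp add: emeasure_eq_measure not_less measure_le_0_iff)
      then have "AE x in Q. x \<notin> {x. \<phi> x < 0}" by (intro AE_not_in) (auto simp: null_sets_def)
      then have "(\<integral>x. \<phi> x \<partial>Q) \<ge> 0" by (intro integral_nonneg_AE) auto
      with mean show False by simp
    qed
    from prob_sum_pos_ge[OF assms(1) True this] obtain t c where
      tc: "0 < c" "(mgf_of \<phi> t) \<le> ennreal c"
        "\<forall>\<^sub>F n in sequentially. (c * exp (- \<delta>)) ^ n \<le> measure paths {y. (\<Sum>k<n. \<phi> (y k)) > 0}"
      using \<delta> by blast
    have "measure paths {y. (\<Sum>k<n. \<phi> (y k)) > 0} \<le> measure paths (E n)" for n
      using E meas[of n] by (intro paths.finite_measure_mono) auto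
    with tc show ?thesis by (intro exI[of _ t] exI[of _ c]) (auto elim!: eventually_mono intro: order.trans)
  next
    case False
    define p where "p = measure Q {x. \<phi> x \<ge> 0}"
    have E': "E n = {y. (\<Sum>k<n. \<phi> (y k)) \<ge> 0}" for n using E False by auto
    have p: "p > 0" using E False by (auto simp: p_def)
    have "emeasure Q {x. \<phi> x > 0} = 0" using False by (simp add: emeasure_eq_measure not_less measure_le_0_iff)
    then have "AE x in Q. x \<notin> {x. \<phi> x > 0}" by (intro AE_not_in) (auto simp: null_sets_def)
    then have le0: "AE x in Q. \<phi> x \<le> 0" by eventually_elim auto
    \<comment> \<open>As the tilt tends to infinity only the atom at zero survives, so some integer
      tilt brings the generating function within the factor \<open>exp \<delta>\<close> of
      \<open>p\<close>.\<close>
    have "(\<lambda>i. \<integral>x. exp (real i * \<phi> x) \<partial>Q) \<longlonglongrightarrow> (\<integral>x. indicator {x. \<phi> x \<ge> 0} x \<partial>Q)"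
    proof (rule integral_dominated_convergence[where w="\<lambda>_. 1"])
      show "AE x in Q. (\<lambda>i. exp (real i * \<phi> x)) \<longlonglongrightarrow> indicator {x. \<phi> x \<ge> 0} x"
        using le0
      proof eventually_elim
        case (elim x)
        show ?case
        proof (cases "\<phi> x = 0")
          case False
          then have "(\<lambda>i. exp (\<phi> x) ^ i) \<longlonglongrightarrow> 0" using elim by (intro LIMSEQ_realpow_zero) auto
          with False elim show ?thesis by (simp add: exp_of_nat_mult)
        qed simp
      qed
      show "AE x in Q. norm (exp (real i * \<phi> x)) \<le> 1" for i
        using le0 by eventually_elim (auto simp: mult_nonneg_nonpos)
    qed auto
    then have "(\<lambda>i. \<integral>x. exp (real i * \<phi> x) \<partial>Q) \<longlonglongrightarrow> p" by (simp add: p_def)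
    moreover have "p < p * exp \<delta>" using p \<delta> by simp
    ultimately obtain i where i: "(\<integral>x. exp (real i * \<phi> x) \<partial>Q) < p * exp \<delta>"
      using eventually_happens'[OF sequentially_bot order_tendstoD(2)] by blast
    have "integrable Q (\<lambda>x. exp (real i * \<phi> x))"
      using le0 by (intro integrable_const_bound[of _ 1]) (auto elim!: eventually_mono simp: mult_nonneg_nonpos)
    then have 1: "(\<integral>\<^sup>+x. ennreal (exp (real i * \<phi> x)) \<partial>Q) \<le> ennreal (p * exp \<delta>)"
      using i by (subst nn_integral_eq_integral) (auto intro!: ennreal_leI)
    have 2: "p ^ n \<le> measure paths (E n)" for n
    proof -
      have "ennreal (p ^ n) = (\<integral>\<^sup>+y. (\<Prod>k<n. indicator {x. \<phi> x \<ge> 0} (y k)) \<partial>paths)"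
        by (subst nn_integral_paths_prod) (auto simp: p_def emeasure_eq_measure ennreal_power)
      also have "\<dots> \<le> (\<integral>\<^sup>+y. indicator (E n) y \<partial>paths)"
      proof (intro nn_integral_mono)
        fix y
        show "(\<Prod>k<n. indicator {x. \<phi> x \<ge> 0} (y k)) \<le> (indicator (E n) y :: ennreal)"
        proof (cases "\<forall>k<n. \<phi> (y k) \<ge> 0")
          case True
          then have "y \<in> E n" by (auto simp: E' intro!: sum_nonneg)
          then have "indicator (E n) y = (1 :: ennreal)" by simp
          moreover have "(\<Prod>k<n. indicator {x. \<phi> x \<ge> 0} (y k)) \<le> (1 :: ennreal)"
            by (intro prod_le_1) (simp add: indicator_def)
          ultimately show ?thesis by metis
        next
          case False
          then obtain k where "k < n" "\<not> \<phi> (y k) \<ge> 0" by blast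
          then have "(\<Prod>k<n. indicator {x. \<phi> x \<ge> 0} (y k)) = (0 :: ennreal)"
            by (intro prod_zero) (auto simp: indicator_def intro!: bexI[of _ k])
          then show ?thesis by (simp only: zero_le)
        qed
      qed
      also have "\<dots> = ennreal (measure paths (E n))"
        using meas[of n] E' by (subst nn_integral_indicator) (auto simp: paths.emeasure_eq_measure)
      finally show ?thesis by simp
    qed
    show ?thesis
      using 1 2 p by (intro exI[of _ "real i", OF exI[of _ "p * exp \<delta>"]]) (simp add: mult.assoc flip: exp_add)
  qed
qed simp

end

section \<open>Positive correlation of monotone events\<close>

text \<open>The flag lets upward and downward exits share one proof; false reverses the
  order.\<close>

definition le_dir :: "bool \<Rightarrow> 'a :: ord \<Rightarrow> 'a \<Rightarrow> bool" where
  "le_dir up a b \<longleftrightarrow> (if up then a \<le> b else b \<le> a)"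

definition closed_dir :: "bool \<Rightarrow> real set \<Rightarrow> bool" where
  "closed_dir up C \<longleftrightarrow> (\<forall>b\<in>C. \<forall>c. le_dir up b c \<longrightarrow> c \<in> C)"

context iid_sequence
begin

lemma integral_paths_Cons:
  fixes f :: "(nat \<Rightarrow> real) \<Rightarrow> real"
  assumes [measurable]: "f \<in> borel_measurable seqM" and bd: "\<And>y. \<bar>f y\<bar> \<le> C"
  shows "(\<integral>y. f y \<partial>paths) = (\<integral>x. (\<integral>y. f (case_nat x y) \<partial>paths) \<partial>Q)"
proof -
  interpret pair: pair_prob_space Q paths ..
  have "paths = distr (Q \<Otimes>\<^sub>M paths) paths (\<lambda>(x, y). case_nat x y)"
    using seq.PiM_iter unfolding paths_def by simp
  then have "(\<integral>y. f y \<partial>paths) = (\<integral>y. f y \<partial>distr (Q \<Otimes>\<^sub>M paths) paths (\<lambda>(x, y). case_nat x y))"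
    by simp
  also have "\<dots> = (\<integral>p. f (case_nat (fst p) (snd p)) \<partial>(Q \<Otimes>\<^sub>M paths))"
    by (subst integral_distr) (auto simp: case_prod_beta)
  also have "\<dots> = (\<integral>x. (\<integral>y. f (case_nat x y) \<partial>paths) \<partial>Q)"
    by (subst pair.integral_fst'[symmetric])
       (use bd in \<open>auto intro!: pair.integrable_const_bound[of _ C]\<close>)
  finally show ?thesis .
qed

text \<open>For two monotone functions the product of the differences between independent copies is
  nonnegative; integrating over both copies gives twice the covariance.\<close>

lemma chebyshev_correlation:
  fixes F G :: "real \<Rightarrow> real"
  assumes [measurable]: "F \<in> borel_measurable borel" "G \<in> borel_measurable borel"
    and bd: "\<And>x. \<bar>F x\<bar> \<le> 1" "\<And>x. \<bar>G x\<bar> \<le> 1"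
    and mono: "mono F" "mono G"
  shows "(\<integral>x. F x \<partial>Q) * (\<integral>x. G x \<partial>Q) \<le> (\<integral>x. F x * G x \<partial>Q)"
proof -
  have FG: "\<bar>F x * G x\<bar> \<le> 1" for x using bd[of x] by (simp add: abs_mult mult_le_one)
  have int: "integrable Q F" "integrable Q G" "integrable Q (\<lambda>x. F x * G x)"
    using bd FG by (auto intro!: integrable_const_bound[of _ 1])
  have "0 \<le> (\<integral>x. F x * G x \<partial>Q) - F z * (\<integral>x. G x \<partial>Q) - G z * (\<integral>x. F x \<partial>Q) + F z * G z" for z
  proof -
    have "0 \<le> (F x - F z) * (G x - G z)" for x
    proof (cases "x \<le> z")
      case True
      then show ?thesis using mono by (intro mult_nonpos_nonpos) (auto dest: monoD)
    next
      case False
      then have "F z \<le> F x" "G z \<le> G x" using mono by (auto intro!: monoD[of F] monoD[of G])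
      then show ?thesis by simp
    qed
    then have "0 \<le> (\<integral>x. (F x - F z) * (G x - G z) \<partial>Q)" by simp
    also have "\<dots> = (\<integral>x. F x * G x - F z * G x - G z * F x + F z * G z \<partial>Q)"
      by (simp add: algebra_simps)
    also have "\<dots> = (\<integral>x. F x * G x \<partial>Q) - F z * (\<integral>x. G x \<partial>Q) - G z * (\<integral>x. F x \<partial>Q) + F z * G z"
      using int prob_space by simp
    finally show ?thesis .
  qed
  then have "0 \<le> (\<integral>z. (\<integral>x. F x * G x \<partial>Q) - F z * (\<integral>x. G x \<partial>Q) - G z * (\<integral>x. F x \<partial>Q) + F z * G z \<partial>Q)"
    by simp
  also have "\<dots> = 2 * ((\<integral>x. F x * G x \<partial>Q) - (\<integral>x. F x \<partial>Q) * (\<integral>x. G x \<partial>Q))"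
    using int prob_space by simp
  finally show ?thesis by simp
qed

text \<open>Induction on the number of coordinates: given the first one, the induction hypothesis
  handles the rest, and the partial integrals are again monotone functions of that coordinate, to
  which the one-dimensional case applies.\<close>

lemma harris:
  fixes f g :: "(nat \<Rightarrow> real) \<Rightarrow> real"
  assumes "f \<in> borel_measurable seqM" "g \<in> borel_measurable seqM"
    and "\<And>y. 0 \<le> f y \<and> f y \<le> 1" "\<And>y. 0 \<le> g y \<and> g y \<le> 1"
    and "mono f" "mono g"
    and "\<And>y z. (\<And>k. k < n \<Longrightarrow> y k = z k) \<Longrightarrow> f y = f z" "\<And>y z. (\<And>k. k < n \<Longrightarrow> y k = z k) \<Longrightarrow> g y = g z"
  shows "(\<integral>y. f y \<partial>paths) * (\<integral>y. g y \<partial>paths) \<le> (\<integral>y. f y * g y \<partial>paths)"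
  using assms
proof (induction n arbitrary: f g)
  case 0
  have "f = (\<lambda>_. f (\<lambda>_. 0))" "g = (\<lambda>_. g (\<lambda>_. 0))" using "0.prems"(7,8) by (auto intro!: ext)
  then obtain a b where "f = (\<lambda>_. a)" "g = (\<lambda>_. b)" by metis
  then show ?case using paths.prob_space by simp
next
  case (Suc n)
  note [measurable] = Suc.prems(1,2)
  define F where "F x = (\<integral>y. f (case_nat x y) \<partial>paths)" for x
  define G where "G x = (\<integral>y. g (case_nat x y) \<partial>paths)" for x
  define H where "H x = (\<integral>y. f (case_nat x y) * g (case_nat x y) \<partial>paths)" for x
  have fg: "0 \<le> f y * g y \<and> f y * g y \<le> 1" for y
    using Suc.prems(3,4)[of y] by (auto intro: mult_le_one)
  have int: "integrable paths (\<lambda>y. f (case_nat x y))" "integrable paths (\<lambda>y. g (case_nat x y))" for x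
    using Suc.prems(3,4) by (auto intro!: paths.integrable_const_bound[of _ 1])
  have le1: "0 \<le> (\<integral>y. k y \<partial>paths) \<and> (\<integral>y. k y \<partial>paths) \<le> 1"
    if [measurable]: "k \<in> borel_measurable seqM" and k: "\<And>y. 0 \<le> k y \<and> k y \<le> 1" for k :: "(nat \<Rightarrow> real) \<Rightarrow> real"
  proof -
    have "integrable paths k" using k by (intro paths.integrable_const_bound[of _ 1]) auto
    then have "(\<integral>y. k y \<partial>paths) \<le> (\<integral>y. 1 \<partial>paths)" using k by (intro integral_mono) auto
    then show ?thesis using k paths.prob_space by simp
  qed
  have F01: "0 \<le> F x \<and> F x \<le> 1" and G01: "0 \<le> G x \<and> G x \<le> 1" and H01: "0 \<le> H x \<and> H x \<le> 1" for x
    unfolding F_def G_def H_def using Suc.prems(3,4) fg by (intro le1; simp)+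
  have [measurable]: "F \<in> borel_measurable borel" "G \<in> borel_measurable borel" "H \<in> borel_measurable borel"
    unfolding F_def G_def H_def by measurable
  have monoF: "mono F" and monoG: "mono G"
    unfolding F_def G_def using int Suc.prems(5,6)
    by (auto intro!: monoI integral_mono monoD[of f] monoD[of g] le_funI split: nat.split)
  have "(\<integral>y. f y \<partial>paths) * (\<integral>y. g y \<partial>paths) = (\<integral>x. F x \<partial>Q) * (\<integral>x. G x \<partial>Q)"
    unfolding F_def G_def using Suc.prems(3,4)
    by (subst (1 2) integral_paths_Cons[of _ 1]) auto
  also have "\<dots> \<le> (\<integral>x. F x * G x \<partial>Q)"
    using F01 G01 monoF monoG by (intro chebyshev_correlation) auto
  also have "\<dots> \<le> (\<integral>x. H x \<partial>Q)"
  proof (rule integral_mono)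
    have "\<bar>F x * G x\<bar> \<le> 1" for x using F01[of x] G01[of x] by (simp add: abs_mult mult_le_one)
    then show "integrable Q (\<lambda>x. F x * G x)" by (intro integrable_const_bound[of _ 1]) auto
    show "integrable Q H" using H01 by (intro integrable_const_bound[of _ 1]) auto
    fix x
    show "F x * G x \<le> H x"
      unfolding F_def G_def H_def
    proof (rule Suc.IH)
      show "mono (\<lambda>y. f (case_nat x y))" "mono (\<lambda>y. g (case_nat x y))"
        using Suc.prems(5,6) by (auto intro!: monoI monoD[of f] monoD[of g] le_funI split: nat.split dest: le_funD)
      show "f (case_nat x y) = f (case_nat x z)" if "\<And>k. k < n \<Longrightarrow> y k = z k" for y z
        using that by (intro Suc.prems(7)) (auto split: nat.split)
      show "g (case_nat x y) = g (case_nat x z)" if "\<And>k. k < n \<Longrightarrow> y k = z k" for y z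
        using that by (intro Suc.prems(8)) (auto split: nat.split)
    qed (use Suc.prems(3,4) in auto)
  qed
  also have "\<dots> = (\<integral>y. f y * g y \<partial>paths)"
    unfolding H_def using fg by (subst (2) integral_paths_Cons[of _ 1]) auto
  finally show ?case .
qed

text \<open>Two decreasing events are treated through their complements, which have the same
  covariance.\<close>

lemma harris_prob:
  assumes [measurable]: "Measurable.pred seqM R" "Measurable.pred seqM W"
    and mono: "\<And>y z. le_dir up y z \<Longrightarrow> R y \<Longrightarrow> R z" "\<And>y z. le_dir up y z \<Longrightarrow> W y \<Longrightarrow> W z"
    and dep: "\<And>y z. (\<And>k. k < n \<Longrightarrow> y k = z k) \<Longrightarrow> R y = R z" "\<And>y z. (\<And>k. k < n \<Longrightarrow> y k = z k) \<Longrightarrow> W y = W z"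
  shows "measure paths {y. R y} * measure paths {y. W y} \<le> measure paths {y. R y \<and> W y}"
proof -
  have [measurable]: "{y. R y} \<in> sets paths" "{y. W y} \<in> sets paths" "{y. R y \<and> W y} \<in> sets paths"
    by (rule sets_paths_Collect; measurable)+
  define f where "f = (\<lambda>y. of_bool (R y) :: real)"
  define g where "g = (\<lambda>y. of_bool (W y) :: real)"
  have fg_meas [measurable]: "f \<in> borel_measurable seqM" "g \<in> borel_measurable seqM"
    unfolding f_def g_def of_bool_def by measurable
  have [simp]: "integrable paths f" "integrable paths g" "integrable paths (\<lambda>y. f y * g y)"
  proof -
    have "\<bar>f y\<bar> \<le> 1" "\<bar>g y\<bar> \<le> 1" "\<bar>f y * g y\<bar> \<le> 1" for y by (simp_all add: f_def g_def)
    then show "integrable paths f" "integrable paths g" "integrable paths (\<lambda>y. f y * g y)"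
      by (intro paths.integrable_const_bound[of _ 1]; simp)+
  qed
  have i: "(\<integral>y. f y \<partial>paths) = measure paths {y. R y}" "(\<integral>y. g y \<partial>paths) = measure paths {y. W y}"
    "(\<integral>y. f y * g y \<partial>paths) = measure paths {y. R y \<and> W y}"
  proof -
    have "f = indicator {y. R y}" "g = indicator {y. W y}" "(\<lambda>y. f y * g y) = indicator {y. R y \<and> W y}"
      by (simp_all add: fun_eq_iff f_def g_def indicator_def)
    then show "(\<integral>y. f y \<partial>paths) = measure paths {y. R y}" "(\<integral>y. g y \<partial>paths) = measure paths {y. W y}"
      "(\<integral>y. f y * g y \<partial>paths) = measure paths {y. R y \<and> W y}" by simp_all
  qed
  have depf: "f y = f z" "g y = g z" if "\<And>k. k < n \<Longrightarrow> y k = z k" for y z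
    using dep[OF that] by (simp_all add: f_def g_def)
  have f01: "0 \<le> f y \<and> f y \<le> 1" "0 \<le> 1 - f y \<and> 1 - f y \<le> 1" for y by (simp_all add: f_def)
  have g01: "0 \<le> g y \<and> g y \<le> 1" "0 \<le> 1 - g y \<and> 1 - g y \<le> 1" for y by (simp_all add: g_def)
  show ?thesis
  proof (cases up)
    case True
    have "mono f" "mono g" using mono True by (auto simp: mono_def f_def g_def le_dir_def)
    from harris[OF fg_meas f01(1) g01(1) this depf] show ?thesis unfolding i by blast
  next
    case False
    have mono': "mono (\<lambda>y. 1 - f y)" "mono (\<lambda>y. 1 - g y)"
      using mono False by (auto simp: mono_def f_def g_def le_dir_def)
    have meas': "(\<lambda>y. 1 - f y) \<in> borel_measurable seqM" "(\<lambda>y. 1 - g y) \<in> borel_measurable seqM"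
      by (intro borel_measurable_diff borel_measurable_const fg_meas)+
    have dep': "1 - f y = 1 - f z" "1 - g y = 1 - g z" if "\<And>k. k < n \<Longrightarrow> y k = z k" for y z
      by (simp_all only: depf[OF that])
    from harris[OF meas' f01(2) g01(2) mono' dep']
    have "(\<integral>y. 1 - f y \<partial>paths) * (\<integral>y. 1 - g y \<partial>paths) \<le> (\<integral>y. (1 - f y) * (1 - g y) \<partial>paths)"
      by blast
    also have "(\<integral>y. (1 - f y) * (1 - g y) \<partial>paths) = (\<integral>y. 1 - f y - g y + f y * g y \<partial>paths)"
      by (simp add: algebra_simps)
    also have "\<dots> = 1 - measure paths {y. R y} - measure paths {y. W y} + measure paths {y. R y \<and> W y}"
      using paths.prob_space by (simp add: i)
    also have "(\<integral>y. 1 - f y \<partial>paths) = 1 - measure paths {y. R y}"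
      using paths.prob_space by (simp add: i)
    also have "(\<integral>y. 1 - g y \<partial>paths) = 1 - measure paths {y. W y}"
      using paths.prob_space by (simp add: i)
    finally show ?thesis by (simp add: algebra_simps)
  qed
qed

end

section \<open>Exit of a moving average from an interval\<close>

lemma emeasure_eq_nn_integral_of_bool:
  "{y. R y} \<in> sets M \<Longrightarrow> emeasure M {y. R y} = (\<integral>\<^sup>+y. of_bool (R y) \<partial>M)"
  using nn_integral_indicator[of "{y. R y}" M] by (simp add: indicator_def)

text \<open>Each term is at most the first term of its block; this is the source of the factor
  \<open>N\<close> lost in the exit estimate.\<close>

lemma suminf_le_blocks:
  fixes f :: "nat \<Rightarrow> ennreal"
  assumes "N > 0" and anti: "\<And>m n. m \<le> n \<Longrightarrow> f n \<le> f m"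
  shows "(\<Sum>n. f n) \<le> of_nat N * (\<Sum>k. f (k * N))"
proof -
  have "(\<Sum>n. f n) = (\<Sum>k. sum f {k * N..<k * N + N})"
    using sums_group[OF summable_sums \<open>N > 0\<close>, of f] by (simp add: sums_iff)
  also have "\<dots> \<le> (\<Sum>k. of_nat N * f (k * N))"
  proof (intro suminf_le)
    fix k
    have "sum f {k * N..<k * N + N} \<le> (\<Sum>n\<in>{k * N..<k * N + N}. f (k * N))" by (intro sum_mono anti) auto
    then show "sum f {k * N..<k * N + N} \<le> of_nat N * f (k * N)" by simp
  qed auto
  finally show ?thesis by simp
qed

text \<open>A single stay in a regime with increment law \<open>Q\<close>. \<open>A\<close> is the
  exit being counted and \<open>B\<close> the competing one; exchanging them treats the other
  direction.\<close>

locale window_exit = iid_sequence Q for Q :: "real measure" +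
  fixes N :: nat and A B :: "real set"
  assumes N_pos: "N > 0" and A_meas [measurable]: "A \<in> sets borel" and B_meas [measurable]: "B \<in> sets borel"
    and disjoint: "A \<inter> B = {}"
begin

definition hit :: "real set \<Rightarrow> nat \<Rightarrow> (nat \<Rightarrow> real) \<Rightarrow> bool" where
  "hit C n h \<longleftrightarrow> N \<le> n \<and> (\<Sum>k\<in>{n - N..<n}. h k) / real N \<in> C"

definition alive :: "nat \<Rightarrow> (nat \<Rightarrow> real) \<Rightarrow> bool" where
  "alive n h \<longleftrightarrow> (\<forall>k\<le>n. \<not> hit A k h \<and> \<not> hit B k h)"

text \<open>Counting from time 0 makes this the number of increments of the stay, the one that
  triggers the exit included; it is infinite if no exit occurs.\<close>

definition lifetime :: "(nat \<Rightarrow> real) \<Rightarrow> ennreal" where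
  "lifetime h = (\<Sum>n. of_bool (alive n h))"

text \<open>At most one term is nonzero, so this is the indicator of ending the stay through
  \<open>A\<close>.\<close>

definition exit_A :: "(nat \<Rightarrow> real) \<Rightarrow> ennreal" where
  "exit_A h = (\<Sum>n. of_bool (alive n h \<and> hit A (Suc n) h))"

lemma measurable_hit:
  assumes [measurable]: "C \<in> sets borel"
  shows "Measurable.pred seqM (hit C n)"
  unfolding hit_def[abs_def] by measurable

lemmas [measurable] = measurable_hit[OF A_meas] measurable_hit[OF B_meas]

lemma measurable_comb_seq_const [measurable]: "comb_seq m h \<in> measurable seqM seqM"
  by (rule measurable_comb_seq'[of "\<lambda>_. h" seqM borel "\<lambda>y. y"]) (simp_all add: space_PiM)

lemma measurable_alive [measurable]: "Measurable.pred seqM (alive n)"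
  unfolding alive_def[abs_def] by measurable

lemma measurable_of_bool_pred [measurable (raw)]:
  "Measurable.pred K R \<Longrightarrow> (\<lambda>x. of_bool (R x) :: ennreal) \<in> borel_measurable K"
  unfolding of_bool_def by measurable

lemma measurable_lifetime [measurable]: "lifetime \<in> borel_measurable seqM"
  unfolding lifetime_def[abs_def] by measurable

lemma measurable_exit_A [measurable]: "exit_A \<in> borel_measurable seqM"
  unfolding exit_A_def[abs_def] by measurable

lemma hit_cong: "(\<And>k. k < n \<Longrightarrow> h k = h' k) \<Longrightarrow> hit C n h = hit C n h'"
proof -
  assume "\<And>k. k < n \<Longrightarrow> h k = h' k"
  then have "(\<Sum>k\<in>{n - N..<n}. h k) = (\<Sum>k\<in>{n - N..<n}. h' k)" by (intro sum.cong) auto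
  then show ?thesis by (simp add: hit_def)
qed

lemma alive_cong: "(\<And>k. k < n \<Longrightarrow> h k = h' k) \<Longrightarrow> alive n h = alive n h'"
  unfolding alive_def by (auto simp: hit_cong[of _ h h'])

lemma alive_antimono: "m \<le> n \<Longrightarrow> alive n h \<Longrightarrow> alive m h"
  by (auto simp: alive_def)

lemma alive_0 [simp]: "alive 0 h"
  using N_pos by (simp add: alive_def hit_def)

lemma alive_Suc: "alive (Suc n) h \<longleftrightarrow> alive n h \<and> \<not> hit A (Suc n) h \<and> \<not> hit B (Suc n) h"
  by (auto simp: alive_def le_Suc_eq)

lemma alive_comb_seq: "n \<le> m \<Longrightarrow> alive n (comb_seq m h y) = alive n h"
  by (rule alive_cong) (simp add: comb_seq_less)

lemma hit_comb_seq:
  assumes "N \<le> n"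
  shows "hit C (m + n) (comb_seq m h y) = hit C n y"
proof -
  have "(\<Sum>k\<in>{m + n - N..<m + n}. comb_seq m h y k) = (\<Sum>k\<in>{n - N..<n}. comb_seq m h y (k + m))"
    using assms by (subst sum.shift_bounds_nat_ivl[symmetric]) (simp add: add.commute)
  then show ?thesis using assms by (simp add: hit_def comb_seq_add)
qed

lemma emeasure_paths_comb_seq:
  assumes [measurable]: "Measurable.pred seqM R"
  shows "emeasure paths {y. R y} = (\<integral>\<^sup>+h. emeasure paths {y. R (comb_seq m h y)} \<partial>paths)"
proof -
  have "emeasure paths {y. R y} = (\<integral>\<^sup>+y. of_bool (R y) \<partial>paths)"
    by (rule emeasure_eq_nn_integral_of_bool) (rule sets_paths_Collect, measurable)
  also have "\<dots> = (\<integral>\<^sup>+h. (\<integral>\<^sup>+y. of_bool (R (comb_seq m h y)) \<partial>paths) \<partial>paths)"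
    by (rule nn_integral_paths_comb_seq) measurable
  also have "\<dots> = (\<integral>\<^sup>+h. emeasure paths {y. R (comb_seq m h y)} \<partial>paths)"
    by (intro nn_integral_cong emeasure_eq_nn_integral_of_bool[symmetric] sets_paths_Collect
          measurable_compose[OF measurable_comb_seq_const assms])
  finally show ?thesis .
qed

definition pA :: ennreal where "pA = emeasure paths {y. hit A N y}"

definition mean_lifetime :: ennreal where "mean_lifetime = (\<integral>\<^sup>+y. lifetime y \<partial>paths)"

definition prob_exit_A :: ennreal where "prob_exit_A = (\<integral>\<^sup>+y. exit_A y \<partial>paths)"

definition survival :: "nat \<Rightarrow> ennreal" where "survival n = emeasure paths {y. alive n y}"

lemma mean_lifetime_eq: "mean_lifetime = (\<Sum>n. survival n)"
  unfolding mean_lifetime_def lifetime_def survival_def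
  by (subst nn_integral_suminf)
     (auto intro!: suminf_cong emeasure_eq_nn_integral_of_bool[symmetric] sets_paths_Collect simp del: sets_paths)

lemma prob_exit_A_eq: "prob_exit_A = (\<Sum>n. emeasure paths {y. alive n y \<and> hit A (Suc n) y})"
  unfolding prob_exit_A_def exit_A_def
  by (subst nn_integral_suminf)
     (auto intro!: suminf_cong emeasure_eq_nn_integral_of_bool[symmetric] sets_paths_Collect simp del: sets_paths)

lemma survival_antimono: "m \<le> n \<Longrightarrow> survival n \<le> survival m"
  unfolding survival_def by (intro emeasure_mono) (auto dest: alive_antimono simp: sets_paths_Collect simp del: sets_paths)

text \<open>The increments in the window that causes the exit are independent of survival up to its start.\<close>

lemma prob_exit_A_le: "prob_exit_A \<le> pA * mean_lifetime"
proof -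
  define e where "e n = emeasure paths {y. alive n y \<and> hit A (Suc n) y}" for n
  have "e n = 0" if "n < N - 1" for n
  proof -
    have "\<not> hit A (Suc n) y" for y using that by (auto simp: hit_def)
    then show ?thesis by (simp add: e_def)
  qed
  \<comment> \<open>The new index is the start of the decisive window: an exit at
    \<open>m + N\<close> reads precisely the increments from \<open>m\<close> on.\<close>
  then have "(\<Sum>n. e n) = (\<Sum>m. e (m + (N - 1)))"
    by (subst suminf_offset[of e "N - 1"]) auto
  also have "\<dots> \<le> (\<Sum>m. pA * survival m)"
  proof (intro suminf_le)
    fix m
    have "e (m + (N - 1)) \<le> emeasure paths {y. alive m y \<and> hit A (m + N) y}"
      unfolding e_def using N_pos
      by (intro emeasure_mono sets_paths_Collect) (auto dest: alive_antimono[rotated, of _ _ m])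
    also have "\<dots> = (\<integral>\<^sup>+h. emeasure paths {y. alive m (comb_seq m h y) \<and> hit A (m + N) (comb_seq m h y)} \<partial>paths)"
      by (rule emeasure_paths_comb_seq) measurable
    also have "\<dots> = (\<integral>\<^sup>+h. of_bool (alive m h) * pA \<partial>paths)"
      by (intro nn_integral_cong) (simp add: alive_comb_seq hit_comb_seq pA_def)
    also have "\<dots> = survival m * pA"
      unfolding survival_def by (subst nn_integral_multc)
        (simp_all add: emeasure_eq_nn_integral_of_bool sets_paths_Collect del: sets_paths)
    finally show "e (m + (N - 1)) \<le> pA * survival m" by (simp add: mult.commute)
  qed auto
  also have "\<dots> = pA * mean_lifetime" by (simp add: mean_lifetime_eq)
  finally show ?thesis by (simp add: prob_exit_A_eq e_def)
qed

lemma hit_mono: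
  assumes "closed_dir up C" and "le_dir up y z" and "hit C n y"
  shows "hit C n z"
proof -
  have "(\<Sum>k\<in>{n - N..<n}. y k) / N \<le> (\<Sum>k\<in>{n - N..<n}. z k) / N" if "y \<le> z" for y z :: "nat \<Rightarrow> real"
    using that by (intro divide_right_mono sum_mono) (auto dest: le_funD)
  then have "le_dir up ((\<Sum>k\<in>{n - N..<n}. y k) / N) ((\<Sum>k\<in>{n - N..<n}. z k) / N)"
    using assms(2) by (auto simp: le_dir_def split: if_splits)
  then show ?thesis using assms(1,3) unfolding hit_def closed_dir_def by blast
qed

text \<open>The reversal is needed for \<open>B\<close>, which is closed in the opposite direction:
  a path hitting \<open>B\<close> after a move towards \<open>A\<close> would have hit it
  before.\<close>

lemma comb_seq_le_dir: "le_dir up (y :: nat \<Rightarrow> real) z \<Longrightarrow> le_dir (\<not> up) (comb_seq m h z) (comb_seq m h y)"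
  by (auto simp: le_dir_def le_fun_def comb_seq_def split: if_splits)

text \<open>
  Given survival up to \<open>k N\<close>, exiting through \<open>A\<close> at \<open>k N + N\<close> and not meeting \<open>B\<close> in between are monotone
  events of the next \<open>N\<close> increments, hence positively correlated.
\<close>

lemma prob_exit_A_ge:
  assumes A_dir: "closed_dir up A" and B_dir: "closed_dir (\<not> up) B"
  shows "pA * mean_lifetime \<le> of_nat (2 * N) * prob_exit_A"
proof -
  define e where "e n = emeasure paths {y. alive n y \<and> hit A (Suc n) y}" for n
  define noB where "noB k y \<longleftrightarrow> (\<forall>j\<in>{k * N<..k * N + N}. \<not> hit B j y)" for k y
  have [measurable]: "Measurable.pred seqM (noB k)" for k unfolding noB_def[abs_def] by measurable
  define E where "E k = emeasure paths {y. alive (k * N) y \<and> noB k y \<and> hit A (k * N + N) y}" for k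
  \<comment> \<open>Alive at the block's start, in \<open>A\<close> at its end and never in
    \<open>B\<close> between: the first visit to \<open>A\<close> inside the block is then the true
    exit. Exits in distinct blocks are distinct terms of \<open>prob_exit_A\<close>.\<close>
  have sum_E: "(\<Sum>k. E k) \<le> prob_exit_A"
  proof -
    have "E k \<le> sum e {k * N..<k * N + N}" for k
    proof -
      have "{y. alive (k * N) y \<and> noB k y \<and> hit A (k * N + N) y} \<subseteq> (\<Union>n\<in>{k * N..<k * N + N}. {y. alive n y \<and> hit A (Suc n) y})"
      proof (clarify)
        fix y assume y: "alive (k * N) y" "noB k y" "hit A (k * N + N) y"
        define n where "n = (LEAST n. k * N < n \<and> hit A n y)"
        have n: "k * N < n \<and> hit A n y" unfolding n_def by (rule LeastI[of _ "k * N + N"]) (use y N_pos in auto)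
        have n_le: "n \<le> k * N + N" unfolding n_def by (rule Least_le) (use y N_pos in auto)
        have least: "\<not> hit A j y" if "k * N < j" "j < n" for j
          using not_less_Least[of j "\<lambda>n. k * N < n \<and> hit A n y"] that unfolding n_def by blast
        have "alive (n - 1) y"
          unfolding alive_def
        proof (intro allI impI)
          fix j assume "j \<le> n - 1"
          then have "j < n" using n by auto
          show "\<not> hit A j y \<and> \<not> hit B j y"
          proof (cases "j \<le> k * N")
            case True
            then show ?thesis using y(1) by (auto simp: alive_def)
          next
            case False
            then show ?thesis using least[of j] y(2) \<open>j < n\<close> n_le by (auto simp: noB_def)
          qed
        qed
        then show "y \<in> (\<Union>n\<in>{k * N..<k * N + N}. {y. alive n y \<and> hit A (Suc n) y})"
          using n n_le by (intro UN_I[of "n - 1"]) auto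
      qed
      then have "E k \<le> emeasure paths (\<Union>n\<in>{k * N..<k * N + N}. {y. alive n y \<and> hit A (Suc n) y})"
        unfolding E_def by (intro emeasure_mono sets.finite_UN sets_paths_Collect) auto
      also have "\<dots> \<le> sum e {k * N..<k * N + N}"
        unfolding e_def by (intro emeasure_subadditive_finite) (auto intro!: sets_paths_Collect simp del: sets_paths)
      finally show ?thesis .
    qed
    then have "(\<Sum>k. E k) \<le> (\<Sum>k. sum e {k * N..<k * N + N})" by (intro suminf_le) auto
    also have "\<dots> = (\<Sum>n. e n)"
      using sums_group[OF summable_sums N_pos, of e] by (simp add: sums_iff)
    finally show ?thesis by (simp add: prob_exit_A_eq e_def)
  qed
  \<comment> \<open>Survival to the end of the block includes avoiding \<open>B\<close> throughout
    it, so it can replace the avoidance event on the left-hand side.\<close>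
  have E_ge: "pA * survival (Suc k * N) \<le> E k" for k
  proof -
    let ?c = "comb_seq (k * N)"
    have noB_comb: "noB k (?c h y) = noB k (?c h z)" if "\<And>j. j < N \<Longrightarrow> y j = z j" for h y z
    proof -
      have "hit B j (?c h y) = hit B j (?c h z)" if "j \<le> k * N + N" for j
        using that \<open>\<And>j. j < N \<Longrightarrow> y j = z j\<close> by (intro hit_cong) (auto simp: comb_seq_def)
      then show ?thesis by (auto simp: noB_def)
    qed
    have corr: "emeasure paths {y. noB k (?c h y)} * pA \<le> emeasure paths {y. noB k (?c h y) \<and> hit A N y}" for h
    proof -
      have "measure paths {y. noB k (?c h y)} * measure paths {y. hit A N y}
          \<le> measure paths {y. noB k (?c h y) \<and> hit A N y}"
      proof (rule harris_prob[where n=N and up=up])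
        show "noB k (?c h z)" if "le_dir up y z" "noB k (?c h y)" for y z
          using that(2) hit_mono[OF B_dir comb_seq_le_dir[OF that(1)]] unfolding noB_def by blast
        show "hit A N z" if "le_dir up y z" "hit A N y" for y z by (rule hit_mono[OF A_dir that])
        show "noB k (?c h y) = noB k (?c h z)" if "\<And>j. j < N \<Longrightarrow> y j = z j" for y z by (rule noB_comb) fact
        show "hit A N y = hit A N z" if "\<And>j. j < N \<Longrightarrow> y j = z j" for y z by (rule hit_cong) fact
      qed measurable
      then show ?thesis unfolding pA_def paths.emeasure_eq_measure by (simp flip: ennreal_mult)
    qed
    have "survival (Suc k * N) \<le> emeasure paths {y. alive (k * N) y \<and> noB k y}"
      unfolding survival_def
      by (intro emeasure_mono sets_paths_Collect) (auto simp: alive_def noB_def)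
    also have "\<dots> = (\<integral>\<^sup>+h. emeasure paths {y. alive (k * N) (?c h y) \<and> noB k (?c h y)} \<partial>paths)"
      by (rule emeasure_paths_comb_seq) measurable
    also have "\<dots> = (\<integral>\<^sup>+h. of_bool (alive (k * N) h) * emeasure paths {y. noB k (?c h y)} \<partial>paths)"
      by (intro nn_integral_cong) (simp add: alive_comb_seq)
    finally have "pA * survival (Suc k * N) \<le> pA * (\<integral>\<^sup>+h. of_bool (alive (k * N) h) * emeasure paths {y. noB k (?c h y)} \<partial>paths)"
      by (rule mult_left_mono) simp
    also have "\<dots> = (\<integral>\<^sup>+h. pA * (of_bool (alive (k * N) h) * emeasure paths {y. noB k (?c h y)}) \<partial>paths)"
      by (rule nn_integral_cmult[symmetric]) measurable
    also have "\<dots> \<le> (\<integral>\<^sup>+h. of_bool (alive (k * N) h) * emeasure paths {y. noB k (?c h y) \<and> hit A N y} \<partial>paths)"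
      by (intro nn_integral_mono) (use corr in \<open>auto simp: mult.commute\<close>)
    also have "\<dots> = (\<integral>\<^sup>+h. emeasure paths {y. alive (k * N) (?c h y) \<and> noB k (?c h y) \<and> hit A (k * N + N) (?c h y)} \<partial>paths)"
      by (intro nn_integral_cong) (simp add: alive_comb_seq hit_comb_seq)
    also have "\<dots> = E k"
      unfolding E_def by (rule emeasure_paths_comb_seq[symmetric]) measurable
    finally show ?thesis .
  qed
  \<comment> \<open>Time \<open>N\<close> is the first at which a window is complete, and the two
    exit sets are disjoint, so in the block with \<open>k = 0\<close> hitting \<open>A\<close> at
    its end excludes any hit of \<open>B\<close>.\<close>
  have "hit A N y \<longleftrightarrow> alive 0 y \<and> noB 0 y \<and> hit A (0 + N) y" for y
  proof -
    have "\<not> hit B j y" if "hit A N y" "j \<le> N" for j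
      using that disjoint by (cases "j = N") (auto simp: hit_def)
    then show ?thesis by (auto simp: noB_def)
  qed
  then have E0: "E 0 = pA" by (simp add: E_def pA_def del: alive_0)
  have E0': "pA * survival 0 \<le> prob_exit_A"
  proof -
    have "pA * survival 0 = E 0" using E0 paths.emeasure_space_1 by (simp add: survival_def)
    also have "\<dots> \<le> (\<Sum>k. E k)" using sum_le_suminf[of E "{0}"] by simp
    finally show ?thesis using sum_E by simp
  qed
  \<comment> \<open>\<open>E_ge\<close> shifts survival by one block, so the term with
    \<open>k = 0\<close> is left over; it costs a second \<open>prob_exit_A\<close>.\<close>
  have "pA * mean_lifetime \<le> pA * (of_nat N * (\<Sum>k. survival (k * N)))"
    unfolding mean_lifetime_eq
    by (intro mult_left_mono suminf_le_blocks N_pos survival_antimono) auto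
  also have "\<dots> = of_nat N * (\<Sum>k. pA * survival (k * N))" by (simp add: mult.left_commute)
  also have "(\<Sum>k. pA * survival (k * N)) = (\<Sum>k. pA * survival (Suc k * N)) + pA * survival 0"
    using suminf_offset[of "\<lambda>k. pA * survival (k * N)" 1] by simp
  also have "\<dots> \<le> prob_exit_A + prob_exit_A"
    by (intro add_mono E0' order.trans[OF suminf_le sum_E] E_ge) auto
  finally have "pA * mean_lifetime \<le> of_nat N * (prob_exit_A + prob_exit_A)" by (auto simp: mult_left_mono)
  then show ?thesis by (simp add: mult_2 distrib_left distrib_right)
qed

end

section \<open>The compensated exit count\<close>

context window_exit
begin

definition stay_prob :: real where
  "stay_prob = measure paths {y. \<not> hit A N y \<and> \<not> hit B N y}"

text \<open>A pointwise version of the conditional expectation given the first \<open>m\<close>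
  increments, defined for every history rather than up to null sets, so that it can be evaluated
  along a path.\<close>

definition cond_mean :: "((nat \<Rightarrow> real) \<Rightarrow> ennreal) \<Rightarrow> nat \<Rightarrow> (nat \<Rightarrow> real) \<Rightarrow> ennreal" where
  "cond_mean \<Psi> m h = (\<integral>\<^sup>+y. \<Psi> (comb_seq m h y) \<partial>paths)"

lemma cond_mean_cong:
  "(\<And>k. k < m \<Longrightarrow> h k = h' k) \<Longrightarrow> cond_mean \<Psi> m h = cond_mean \<Psi> m h'"
proof -
  assume "\<And>k. k < m \<Longrightarrow> h k = h' k"
  then have "comb_seq m h = comb_seq m h'" by (auto simp: comb_seq_def fun_eq_iff)
  then show ?thesis by (simp add: cond_mean_def)
qed

lemma measurable_cond_mean [measurable]:
  assumes [measurable]: "\<Psi> \<in> borel_measurable seqM"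
  shows "cond_mean \<Psi> m \<in> borel_measurable seqM"
  unfolding cond_mean_def[abs_def] by measurable

lemma comb_seq_upd: "comb_seq (Suc m) (h(m := x)) y = comb_seq m h (case_nat x y)"
proof -
  have "comb_seq m (h(m := x)) = comb_seq m h" by (auto simp: comb_seq_def fun_eq_iff)
  then show ?thesis by (simp add: comb_seq_Suc)
qed

lemma measurable_fun_upd_seqM [measurable]: "(\<lambda>x. h(m := x)) \<in> measurable borel seqM"
  by (rule measurable_PiM_single') (auto simp: space_PiM fun_upd_def)

text \<open>The tower property over a single increment.\<close>

lemma nn_integral_cond_mean:
  assumes [measurable]: "\<Psi> \<in> borel_measurable seqM"
  shows "(\<integral>\<^sup>+x. cond_mean \<Psi> (Suc m) (h(m := x)) \<partial>Q) = cond_mean \<Psi> m h"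
proof -
  have "(\<integral>\<^sup>+y. \<Psi> (comb_seq m h y) \<partial>paths) = (\<integral>\<^sup>+x. (\<integral>\<^sup>+y. \<Psi> (comb_seq m h (case_nat x y)) \<partial>paths) \<partial>Q)"
    by (rule nn_integral_paths_Cons) (rule measurable_compose[OF measurable_comb_seq_const assms])
  then show ?thesis unfolding cond_mean_def comb_seq_upd by simp
qed

lemma cond_mean_0: "cond_mean \<Psi> 0 h = (\<integral>\<^sup>+y. \<Psi> y \<partial>paths)"
  by (simp add: cond_mean_def comb_seq_0)

lemma cond_mean_const:
  assumes "\<And>y. \<Psi> (comb_seq m h y) = c"
  shows "cond_mean \<Psi> m h = c"
  unfolding cond_mean_def assms using paths.emeasure_space_1 by simp

lemma exit_A_eq_1: "alive n h \<Longrightarrow> hit A (Suc n) h \<Longrightarrow> exit_A h = 1"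
proof -
  assume n: "alive n h" "hit A (Suc n) h"
  have "\<not> (alive k h \<and> hit A (Suc k) h)" if "k \<noteq> n" for k
    using that n by (cases "k < n") (auto simp: alive_def)
  then have "exit_A h = (\<Sum>k\<in>{n}. of_bool (alive k h \<and> hit A (Suc k) h))"
    unfolding exit_A_def by (intro suminf_finite) auto
  then show ?thesis using n by simp
qed

lemma exit_A_le_1: "exit_A h \<le> 1"
proof (cases "\<exists>n. alive n h \<and> hit A (Suc n) h")
  case True
  then show ?thesis using exit_A_eq_1 by force
next
  case False
  then have "exit_A h = (\<Sum>n. 0)" unfolding exit_A_def by (intro suminf_cong) auto
  then show ?thesis by simp
qed

lemma exit_A_eq_0: "alive n h \<Longrightarrow> hit B (Suc n) h \<Longrightarrow> exit_A h = 0"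
proof -
  assume n: "alive n h" "hit B (Suc n) h"
  have "\<not> (alive k h \<and> hit A (Suc k) h)" for k
  proof
    assume k: "alive k h \<and> hit A (Suc k) h"
    consider "k < n" | "k = n" | "n < k" by linarith
    then show False
    proof cases
      case 2
      then show False using n k disjoint by (auto simp: hit_def)
    qed (use n k in \<open>auto simp: alive_def\<close>)
  qed
  then have "exit_A h = (\<Sum>n. 0)" unfolding exit_A_def by (intro suminf_cong) auto
  then show ?thesis by simp
qed

lemma lifetime_eq: "alive n h \<Longrightarrow> \<not> alive (Suc n) h \<Longrightarrow> lifetime h = of_nat (Suc n)"
proof -
  assume n: "alive n h" "\<not> alive (Suc n) h"
  have "\<not> alive k h" if "k \<notin> {..n}" for k
    using that n alive_antimono[of "Suc n" k h] by auto
  then have "lifetime h = (\<Sum>k\<in>{..n}. of_bool (alive k h))"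
    unfolding lifetime_def by (intro suminf_finite) auto
  also have "\<dots> = (\<Sum>k\<in>{..n}. 1)" using n alive_antimono by (intro sum.cong) auto
  finally show ?thesis by simp
qed

section \<open>Geometric bound on the remaining lifetime\<close>

lemma lifetime_split:
  "lifetime h = (\<Sum>n. of_bool (alive (n + m) h)) + (\<Sum>n<m. of_bool (alive n h))"
  unfolding lifetime_def by (rule suminf_offset) simp

text \<open>Only the disjoint windows that end at multiples of \<open>N\<close> are inspected; their
  independence turns the probability into an exact power.\<close>

definition good_blocks :: "nat \<Rightarrow> (nat \<Rightarrow> real) \<Rightarrow> bool" where
  "good_blocks k y \<longleftrightarrow> (\<forall>j<k. \<not> hit A (j * N + N) y \<and> \<not> hit B (j * N + N) y)"

lemma measurable_good_blocks [measurable]: "Measurable.pred seqM (good_blocks k)"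
  unfolding good_blocks_def[abs_def] by measurable

lemma emeasure_good_blocks: "emeasure paths {y. good_blocks k y} = ennreal (stay_prob ^ k)"
proof (induction k)
  case 0
  then show ?case using paths.emeasure_space_1 by (simp add: good_blocks_def)
next
  case (Suc k)
  have eq: "good_blocks (Suc k) (comb_seq N h y) \<longleftrightarrow> (\<not> hit A N h \<and> \<not> hit B N h) \<and> good_blocks k y" for h y
  proof -
    have "hit C (Suc j * N + N) (comb_seq N h y) = hit C (j * N + N) y" for C j
      using hit_comb_seq[of "j * N + N" C N h y] by (simp add: ac_simps)
    moreover have "hit C (0 * N + N) (comb_seq N h y) = hit C N h" for C
      by (simp, rule hit_cong) (simp add: comb_seq_less)
    ultimately show ?thesis unfolding good_blocks_def All_less_Suc2 by simp
  qed
  have "emeasure paths {y. good_blocks (Suc k) y} = (\<integral>\<^sup>+h. emeasure paths {y. good_blocks (Suc k) (comb_seq N h y)} \<partial>paths)"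
    by (rule emeasure_paths_comb_seq) measurable
  also have "\<dots> = (\<integral>\<^sup>+h. of_bool (\<not> hit A N h \<and> \<not> hit B N h) * emeasure paths {y. good_blocks k y} \<partial>paths)"
    by (intro nn_integral_cong) (simp add: eq)
  also have "\<dots> = emeasure paths {y. \<not> hit A N y \<and> \<not> hit B N y} * emeasure paths {y. good_blocks k y}"
    by (subst nn_integral_multc) (simp_all add: emeasure_eq_nn_integral_of_bool sets_paths_Collect del: sets_paths)
  also have "\<dots> = ennreal (stay_prob ^ Suc k)"
    unfolding Suc.IH by (simp add: stay_prob_def paths.emeasure_eq_measure flip: ennreal_mult)
  finally show ?case .
qed

definition rem_bound :: real where "rem_bound = real N / (1 - stay_prob)"

text \<open>Windows that lie wholly after time \<open>m\<close> do not see the history, and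
  surviving requires all of them to be good. The geometric series over blocks of length
  \<open>N\<close> gives \<open>rem_bound\<close>, uniformly in \<open>m\<close> and
  \<open>h\<close>.\<close>

lemma mean_remaining_le:
  assumes "stay_prob < 1"
  shows "(\<integral>\<^sup>+y. (\<Sum>n. of_bool (alive (n + m) (comb_seq m h y))) \<partial>paths) \<le> ennreal rem_bound"
proof -
  have q: "0 \<le> stay_prob" by (simp add: stay_prob_def)
  have "(\<Sum>n. of_bool (alive (n + m) (comb_seq m h y))) \<le> of_nat N * (\<Sum>k. of_bool (good_blocks k y) :: ennreal)" for y
  proof -
    have "(\<Sum>n. of_bool (alive (n + m) (comb_seq m h y))) \<le> of_nat N * (\<Sum>k. of_bool (alive (k * N + m) (comb_seq m h y)) :: ennreal)"
      by (rule suminf_le_blocks[OF N_pos]) (auto simp: of_bool_def intro: alive_antimono[of "_ + m" "_ + m"])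
    also have "\<dots> \<le> of_nat N * (\<Sum>k. of_bool (good_blocks k y))"
    proof (intro mult_left_mono suminf_le)
      fix k
      have "good_blocks k y" if al: "alive (k * N + m) (comb_seq m h y)"
        unfolding good_blocks_def
      proof (intro allI impI)
        fix j assume "j < k"
        then have "j * N + N \<le> k * N" by (metis Suc_leI add.commute mult_Suc mult_le_mono1)
        then show "\<not> hit A (j * N + N) y \<and> \<not> hit B (j * N + N) y"
          using al hit_comb_seq[of "j * N + N" A m h y] hit_comb_seq[of "j * N + N" B m h y]
          by (auto simp: alive_def)
      qed
      then show "of_bool (alive (k * N + m) (comb_seq m h y)) \<le> (of_bool (good_blocks k y) :: ennreal)"
        by (auto simp: of_bool_def)
    qed auto
    finally show ?thesis .
  qed
  then have "(\<integral>\<^sup>+y. (\<Sum>n. of_bool (alive (n + m) (comb_seq m h y))) \<partial>paths)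
      \<le> (\<integral>\<^sup>+y. of_nat N * (\<Sum>k. of_bool (good_blocks k y)) \<partial>paths)"
    by (rule nn_integral_mono)
  also have "\<dots> = of_nat N * (\<integral>\<^sup>+y. (\<Sum>k. of_bool (good_blocks k y)) \<partial>paths)"
    by (rule nn_integral_cmult) measurable
  also have "(\<integral>\<^sup>+y. (\<Sum>k. of_bool (good_blocks k y)) \<partial>paths) = (\<Sum>k. \<integral>\<^sup>+y. of_bool (good_blocks k y) \<partial>paths)"
    by (rule nn_integral_suminf) measurable
  also have "(\<Sum>k. \<integral>\<^sup>+y. of_bool (good_blocks k y) \<partial>paths) = (\<Sum>k. ennreal (stay_prob ^ k))"
    unfolding emeasure_good_blocks[symmetric]
    by (intro suminf_cong emeasure_eq_nn_integral_of_bool[symmetric] sets_paths_Collect) measurable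
  also have "\<dots> = ennreal (\<Sum>k. stay_prob ^ k)"
    using q assms by (intro suminf_ennreal2) (auto intro!: summable_geometric)
  also have "(\<Sum>k. stay_prob ^ k) = 1 / (1 - stay_prob)"
    using q assms by (intro suminf_geometric) auto
  also have "of_nat N * ennreal (1 / (1 - stay_prob)) = ennreal rem_bound"
    using assms by (simp add: rem_bound_def ennreal_of_nat_eq_real_of_nat flip: ennreal_mult)
  finally show ?thesis .
qed

lemma cond_mean_lifetime:
  shows "cond_mean lifetime m h = (\<integral>\<^sup>+y. (\<Sum>n. of_bool (alive (n + m) (comb_seq m h y))) \<partial>paths) + (\<Sum>n<m. of_bool (alive n h))"
proof -
  have "cond_mean lifetime m h = (\<integral>\<^sup>+y. (\<Sum>n. of_bool (alive (n + m) (comb_seq m h y))) + (\<Sum>n<m. of_bool (alive n h)) \<partial>paths)"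
    unfolding cond_mean_def
  proof (intro nn_integral_cong)
    fix y
    have "(\<Sum>n<m. of_bool (alive n (comb_seq m h y)) :: ennreal) = (\<Sum>n<m. of_bool (alive n h))"
      by (intro sum.cong) (simp_all add: alive_comb_seq)
    then show "lifetime (comb_seq m h y) = (\<Sum>n. of_bool (alive (n + m) (comb_seq m h y))) + (\<Sum>n<m. of_bool (alive n h))"
      by (subst lifetime_split[of _ m]) simp
  qed
  also have "\<dots> = (\<integral>\<^sup>+y. (\<Sum>n. of_bool (alive (n + m) (comb_seq m h y))) \<partial>paths) + (\<integral>\<^sup>+y. (\<Sum>n<m. of_bool (alive n h)) \<partial>paths)"
    by (rule nn_integral_add) (auto intro!: borel_measurable_suminf_order measurable_of_bool_pred measurable_compose[OF measurable_comb_seq_const])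
  finally show ?thesis using paths.emeasure_space_1 by simp
qed

lemma cond_mean_exit_A_le: "cond_mean exit_A m h \<le> 1"
proof -
  have "cond_mean exit_A m h \<le> (\<integral>\<^sup>+y. 1 \<partial>paths)"
    unfolding cond_mean_def by (intro nn_integral_mono exit_A_le_1)
  then show ?thesis using paths.emeasure_space_1 by simp
qed

definition rate :: real where "rate = enn2real prob_exit_A / enn2real mean_lifetime"

text \<open>
  The Doob martingale of \<open>exit_A - rate * lifetime\<close>, which has mean 0: it compensates the number of exits
  through \<open>A\<close> by \<open>rate\<close> times the time spent in the regime.
\<close>

definition pot :: "nat \<Rightarrow> (nat \<Rightarrow> real) \<Rightarrow> real" where
  "pot m h = enn2real (cond_mean exit_A m h) - rate * enn2real (cond_mean lifetime m h)"

lemma pot_cong: "(\<And>k. k < m \<Longrightarrow> h k = h' k) \<Longrightarrow> pot m h = pot m h'"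
  unfolding pot_def using cond_mean_cong[of m h h'] by simp

lemma measurable_pot [measurable]: "pot m \<in> borel_measurable seqM"
  unfolding pot_def[abs_def] by measurable

lemma rate_nonneg: "rate \<ge> 0"
  by (simp add: rate_def)

section \<open>Bounded martingale increments and bounds on the rate\<close>

context
  assumes stay: "stay_prob < 1"
begin

lemma rem_bound_nonneg: "rem_bound \<ge> 0"
  using stay by (simp add: rem_bound_def)

lemma cond_mean_lifetime_le: "cond_mean lifetime m h \<le> ennreal (rem_bound + real m)"
proof -
  have "(\<Sum>n<m. of_bool (alive n h) :: ennreal) \<le> (\<Sum>n<m. 1)" by (intro sum_mono) auto
  then have "(\<Sum>n<m. of_bool (alive n h) :: ennreal) \<le> ennreal (real m)" by (simp add: ennreal_of_nat_eq_real_of_nat)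
  then show ?thesis unfolding cond_mean_lifetime
    using mean_remaining_le[OF stay, of m h] rem_bound_nonneg by (auto intro: add_mono simp: ennreal_plus)
qed

lemma cond_mean_lifetime_ge: "alive m h \<Longrightarrow> ennreal (real m) \<le> cond_mean lifetime m h"
proof -
  assume "alive m h"
  then have "(\<Sum>n<m. of_bool (alive n h) :: ennreal) = (\<Sum>n<m. 1)"
    by (intro sum.cong) (auto intro: alive_antimono[of _ m h])
  then show ?thesis unfolding cond_mean_lifetime by (simp add: ennreal_of_nat_eq_real_of_nat)
qed

lemma cond_mean_finite: "cond_mean lifetime m h < \<top>" "cond_mean exit_A m h < \<top>"
  using cond_mean_lifetime_le[of m h] cond_mean_exit_A_le[of m h]
  by (auto intro: le_less_trans)

lemma enn2real_cond_mean_exit_A: "0 \<le> enn2real (cond_mean exit_A m h) \<and> enn2real (cond_mean exit_A m h) \<le> 1"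
  using cond_mean_exit_A_le[of m h] enn2real_mono[of "cond_mean exit_A m h" 1] by simp

lemma enn2real_cond_mean_lifetime_le: "enn2real (cond_mean lifetime m h) \<le> rem_bound + real m"
  using enn2real_mono[OF cond_mean_lifetime_le[of m h]] rem_bound_nonneg by (simp del: ennreal_plus)

text \<open>While the stay lasts, the expected lifetime is the time \<open>m\<close> already spent
  plus a remainder between 0 and \<open>rem_bound\<close>; adding \<open>rate * m\<close> removes
  the unbounded part.\<close>

lemma pot_alive_bound: "alive m h \<Longrightarrow> \<bar>pot m h + rate * real m\<bar> \<le> 1 + rate * rem_bound"
proof -
  assume al: "alive m h"
  define x where "x = enn2real (cond_mean lifetime m h)"
  have "real m \<le> x"
    using enn2real_mono[OF cond_mean_lifetime_ge[OF al] cond_mean_finite(1)] by (simp add: x_def)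
  moreover have "x \<le> rem_bound + real m" unfolding x_def by (rule enn2real_cond_mean_lifetime_le)
  ultimately have "0 \<le> rate * (x - real m)" "rate * (x - real m) \<le> rate * rem_bound"
    using rate_nonneg by (auto intro!: mult_left_mono)
  moreover have "pot m h + rate * real m = enn2real (cond_mean exit_A m h) - rate * (x - real m)"
    by (simp add: pot_def x_def algebra_simps)
  ultimately show ?thesis using enn2real_cond_mean_exit_A[of m h] by linarith
qed

text \<open>The martingale property: the history is frozen and only the next increment is
  random.\<close>

lemma pot_step:
  shows "integrable Q (\<lambda>x. pot (Suc m) (h(m := x)))" and "(\<integral>x. pot (Suc m) (h(m := x)) \<partial>Q) = pot m h"
proof -
  have *: "integrable Q (\<lambda>x. enn2real (cond_mean \<Psi> (Suc m) (h(m := x)))) \<and>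
      (\<integral>x. enn2real (cond_mean \<Psi> (Suc m) (h(m := x))) \<partial>Q) = enn2real (cond_mean \<Psi> m h)"
    if [measurable]: "\<Psi> \<in> borel_measurable seqM" and fin: "\<And>m h. cond_mean \<Psi> m h < \<top>" for \<Psi>
  proof -
    have [measurable]: "(\<lambda>x. cond_mean \<Psi> (Suc m) (h(m := x))) \<in> borel_measurable borel"
      by (rule measurable_compose[OF measurable_fun_upd_seqM]) measurable
    have eq: "(\<integral>\<^sup>+x. ennreal (enn2real (cond_mean \<Psi> (Suc m) (h(m := x)))) \<partial>Q) = cond_mean \<Psi> m h"
      using fin by (simp add: nn_integral_cond_mean)
    have int: "integrable Q (\<lambda>x. enn2real (cond_mean \<Psi> (Suc m) (h(m := x))))"
      using fin[of m h] by (intro integrableI_nonneg) (auto simp: eq)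
    show ?thesis using int eq by (simp add: integral_eq_nn_integral)
  qed
  note 1 = *[OF measurable_exit_A cond_mean_finite(2)] and 2 = *[OF measurable_lifetime cond_mean_finite(1)]
  show "integrable Q (\<lambda>x. pot (Suc m) (h(m := x)))" "(\<integral>x. pot (Suc m) (h(m := x)) \<partial>Q) = pot m h"
    unfolding pot_def using 1 2 by simp_all
qed

lemma mean_lifetime_props: "1 \<le> mean_lifetime" "mean_lifetime < \<top>" "prob_exit_A \<le> 1"
proof -
  have "survival 0 \<le> mean_lifetime"
    unfolding mean_lifetime_eq using sum_le_suminf[of survival "{0}"] by simp
  then show "1 \<le> mean_lifetime" using paths.emeasure_space_1 by (simp add: survival_def)
  show "mean_lifetime < \<top>" using cond_mean_finite(1)[of 0] by (simp add: cond_mean_0 mean_lifetime_def)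
  show "prob_exit_A \<le> 1" using cond_mean_exit_A_le[of 0] by (simp add: cond_mean_0 prob_exit_A_def)
qed

text \<open>This equation dictates the value of \<open>rate\<close>: with it, a new stay starts at
  potential 0 and successive stays can be joined.\<close>

lemma pot_0: "pot 0 h = 0"
proof -
  have "enn2real mean_lifetime > 0"
    using mean_lifetime_props(1,2) by (simp add: enn2real_positive_iff order.strict_trans2[of 0 1])
  then show ?thesis by (simp add: pot_def cond_mean_0 rate_def prob_exit_A_def mean_lifetime_def)
qed

lemma pot_exit_A:
  assumes "alive m h" "hit A (Suc m) h"
  shows "pot (Suc m) h = 1 - rate * real (Suc m)"
proof -
  have "alive m (comb_seq (Suc m) h y)" "hit A (Suc m) (comb_seq (Suc m) h y)" for y
    using assms alive_comb_seq[of m "Suc m" h y] hit_cong[of "Suc m" "comb_seq (Suc m) h y" h A]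
    by (simp_all add: comb_seq_less)
  then have "cond_mean exit_A (Suc m) h = 1" "cond_mean lifetime (Suc m) h = of_nat (Suc m)"
    by (auto intro!: cond_mean_const exit_A_eq_1 lifetime_eq simp: alive_Suc simp del: of_nat_Suc)
  then show ?thesis by (simp add: pot_def del: of_nat_Suc)
qed

lemma pot_exit_B:
  assumes "alive m h" "hit B (Suc m) h"
  shows "pot (Suc m) h = - rate * real (Suc m)"
proof -
  have "alive m (comb_seq (Suc m) h y)" "hit B (Suc m) (comb_seq (Suc m) h y)" for y
    using assms alive_comb_seq[of m "Suc m" h y] hit_cong[of "Suc m" "comb_seq (Suc m) h y" h B]
    by (simp_all add: comb_seq_less)
  then have "cond_mean exit_A (Suc m) h = 0" "cond_mean lifetime (Suc m) h = of_nat (Suc m)"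
    by (auto intro!: cond_mean_const exit_A_eq_0 lifetime_eq simp: alive_Suc simp del: of_nat_Suc)
  then show ?thesis by (simp add: pot_def del: of_nat_Suc)
qed

text \<open>Lifetimes are unbounded, but \<open>pot\<close> plus \<open>rate\<close> times the
  elapsed time is bounded both before the step and after it, also when the step is an exit; one step
  changes the compensator by \<open>rate\<close>.\<close>

lemma pot_increment_bound:
  assumes "alive m h"
  shows "\<bar>pot (Suc m) h - pot m h\<bar> \<le> 2 * (1 + rate * rem_bound) + rate"
proof -
  have rb: "0 \<le> rate * rem_bound" using rate_nonneg rem_bound_nonneg by simp
  have "\<bar>pot (Suc m) h + rate * real (Suc m)\<bar> \<le> 1 + rate * rem_bound"
  proof -
    consider "alive (Suc m) h" | "hit A (Suc m) h" | "hit B (Suc m) h" using assms alive_Suc by blast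
    then show ?thesis
    proof cases
      case 1
      then show ?thesis by (rule pot_alive_bound)
    next
      case 2
      then show ?thesis using pot_exit_A[OF assms 2] rb by simp
    next
      case 3
      then show ?thesis using pot_exit_B[OF assms 3] rb by simp
    qed
  qed
  moreover have "\<bar>pot m h + rate * real m\<bar> \<le> 1 + rate * rem_bound" by (rule pot_alive_bound) fact
  moreover have "rate * real (Suc m) = rate * real m + rate" by (simp add: algebra_simps)
  ultimately show ?thesis using rate_nonneg by (smt (verit))
qed

lemma rate_bounds:
  shows "rate \<le> measure paths {y. hit A N y}"
    and "closed_dir up A \<Longrightarrow> closed_dir (\<not> up) B \<Longrightarrow> measure paths {y. hit A N y} \<le> 2 * real N * rate"
proof -
  let ?a = "measure paths {y. hit A N y}"
  obtain E where E: "mean_lifetime = ennreal E" "E \<ge> 0" using mean_lifetime_props(2) by (cases mean_lifetime) auto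
  have "E \<ge> 1" using mean_lifetime_props(1) E by simp
  have "prob_exit_A < \<top>" using mean_lifetime_props(3) by (auto intro: le_less_trans)
  then obtain p where p: "prob_exit_A = ennreal p" "p \<ge> 0" by (cases prob_exit_A) auto
  have r: "rate = p / E" using E p by (simp add: rate_def)
  have a: "pA = ennreal ?a" by (simp add: pA_def paths.emeasure_eq_measure)
  have "p \<le> ?a * E" using prob_exit_A_le E p unfolding a by (simp flip: ennreal_mult)
  then show "rate \<le> ?a" using \<open>E \<ge> 1\<close> by (simp add: r field_simps)
  assume dir: "closed_dir up A" "closed_dir (\<not> up) B"
  have "?a * E \<le> 2 * real N * p"
    using prob_exit_A_ge[OF dir] E p unfolding a
    by (simp add: ennreal_of_nat_eq_real_of_nat del: of_nat_mult flip: ennreal_mult)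
  then show "?a \<le> 2 * real N * rate" using \<open>E \<ge> 1\<close> by (simp add: r field_simps)
qed

end

end

section \<open>Paths of the delayed process\<close>

text \<open>The number of increments already made in the current stay, the first stay being counted
  from time 0.\<close>

primrec age :: "(nat \<Rightarrow> nat) \<Rightarrow> nat \<Rightarrow> nat" where
  "age j 0 = 0"
| "age j (Suc n) = (if j (Suc n) = j n then Suc (age j n) else 0)"

lemma age_le: "age j n \<le> n"
  by (induction n) auto

lemma regime_const_of_age: "k \<le> age j n \<Longrightarrow> j (n - k) = j n"
proof (induction n arbitrary: k)
  case (Suc n)
  show ?case
  proof (cases k)
    case (Suc k')
    then have "j (Suc n) = j n" "k' \<le> age j n" using Suc.prems by (auto split: if_splits)
    then show ?thesis using Suc.IH[of k'] Suc by simp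
  qed simp
qed simp

lemma regime_before_entry: "age j n < n \<Longrightarrow> j (n - age j n - 1) \<noteq> j n"
proof (induction n)
  case (Suc n)
  then show ?case by (cases "j (Suc n) = j n") auto
qed simp

text \<open>Increments counted from the start of the current stay. The entry at index
  \<open>age j n\<close> is the one about to be made, and later entries lie in the future; they are
  never read, by the congruence rules for \<open>alive\<close>, \<open>hit\<close> and
  \<open>pot\<close>.\<close>

definition sojourn :: "(nat \<Rightarrow> real) \<Rightarrow> (nat \<Rightarrow> nat) \<Rightarrow> nat \<Rightarrow> nat \<Rightarrow> real" where
  "sojourn x j n k = x (Suc (n - age j n + k)) - x (n - age j n + k)"

lemma sojourn_Suc: "j (Suc n) = j n \<Longrightarrow> sojourn x j (Suc n) = sojourn x j n"
  by (simp add: sojourn_def fun_eq_iff)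

lemma sojourn_last: "sojourn x j n (age j n) = x (Suc n) - x n"
  using age_le[of j n] by (simp add: sojourn_def)

lemma sum_sojourn_window:
  assumes "N \<le> Suc (age j n)"
  shows "(\<Sum>k\<in>{Suc (age j n) - N..<Suc (age j n)}. sojourn x j n k) = x (Suc n) - x (Suc n - N)"
proof -
  let ?m = "age j n"
  define f where "f k = x (n - ?m + k)" for k
  have "(\<Sum>k\<in>{Suc ?m - N..<Suc ?m}. sojourn x j n k) = (\<Sum>k\<in>{Suc ?m - N..<Suc ?m}. f (Suc k) - f k)"
    by (simp add: sojourn_def f_def)
  also have "\<dots> = f (Suc ?m) - f (Suc ?m - N)" by (rule sum_Suc_diff') simp
  finally show ?thesis using age_le[of j n] assms by (simp add: f_def Suc_diff_le)
qed

locale regime_path =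
  fixes l :: nat and r :: "nat \<Rightarrow> real" and N i_start :: nat and x :: "nat \<Rightarrow> real" and j :: "nat \<Rightarrow> nat"
  assumes N_pos: "N > 0" and init: "\<And>n. n < N \<Longrightarrow> j n = i_start"
    and rec: "\<And>n. N \<le> n \<Longrightarrow> j n = (if j (n - N) = j (n - 1) then next_regime l r (j (n - 1)) ((x n - x (n - N)) / real N)
        else j (n - 1))"
begin

text \<open>The rule compares regimes only at two times, so it must be excluded that the process
  left and came back within the window. By induction the preceding stay had at least
  \<open>N\<close> steps; were the current one shorter, the earlier time would fall into that
  preceding stay, whose regime differs.\<close>

lemma age_at_change: "j (Suc n) \<noteq> j n \<Longrightarrow> N \<le> Suc (age j n)"
proof (induction n rule: less_induct)
  case (less n)
  have nN: "N \<le> Suc n" using init[of n] init[of "Suc n"] less.prems by (cases "N \<le> Suc n") auto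
  then have eq: "j (Suc n - N) = j n" using rec[of "Suc n"] less.prems by (auto split: if_splits)
  show ?case
  proof (cases "age j n = n")
    case True
    then show ?thesis using nN by simp
  next
    case False
    define m where "m = age j n"
    define e where "e = n - m - 1"
    have m: "m < n" using False age_le[of j n] by (simp add: m_def)
    have ne: "j e \<noteq> j n" using regime_before_entry[of j n] m by (simp add: e_def m_def)
    have "Suc e = n - m" using m by (simp add: e_def)
    then have "j (Suc e) = j n" using regime_const_of_age[of m j n] by (simp add: m_def)
    then have age_e: "N \<le> Suc (age j e)" using less.IH[of e] ne m by (simp add: e_def)
    show ?thesis
    proof (rule ccontr)
      assume "\<not> ?thesis"
      then have "Suc m < N" by (simp add: m_def)
      \<comment> \<open>\<open>e\<close> is the last time of the preceding stay; counted back from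
        it, the start of the window is \<open>N - m - 2\<close> steps away, still within that
        stay.\<close>
      then have "Suc n - N = e - (N - m - 2)" "N - m - 2 \<le> age j e" using m nN age_e by (auto simp: e_def)
      then have "j (Suc n - N) = j e" using regime_const_of_age[of "N - m - 2" j e] by simp
      with eq ne show False by simp
    qed
  qed
qed

text \<open>The comparison of two regimes becomes a condition on the age, the form in which
  \<open>hit\<close> states it.\<close>

lemma regime_Suc:
  "j (Suc n) = (if N \<le> Suc (age j n) then next_regime l r (j n) ((x (Suc n) - x (Suc n - N)) / real N) else j n)"
proof (cases "N \<le> Suc (age j n)")
  case True
  then have nN: "N \<le> Suc n" using age_le[of j n] by linarith
  have "j (n - (N - 1)) = j n" using True by (intro regime_const_of_age) auto
  moreover have "n - (N - 1) = Suc n - N" using N_pos nN by auto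
  ultimately show ?thesis using rec[OF nN] True by simp
next
  case False
  then show ?thesis using age_at_change by auto
qed

end

text \<open>Joins the path with the model of one stay in regime \<open>i\<close>: \<open>A\<close>
  leads to \<open>i'\<close>, \<open>B\<close> to some third regime. Both the upward and the
  downward exit are instances.\<close>

locale regime_path_exit = regime_path l r N i_start x j + window_exit Q N A B
  for l r N i_start x j Q A B +
  fixes i i' :: nat
  assumes neq: "i' \<noteq> i"
    and nxt_A: "\<And>a. a \<in> A \<Longrightarrow> next_regime l r i a = i'"
    and nxt_B: "\<And>a. a \<in> B \<Longrightarrow> next_regime l r i a \<noteq> i \<and> next_regime l r i a \<noteq> i'"
    and nxt_else: "\<And>a. a \<notin> A \<Longrightarrow> a \<notin> B \<Longrightarrow> next_regime l r i a = i"
begin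

lemma hit_sojourn:
  "hit C (Suc (age j n)) (sojourn x j n) \<longleftrightarrow> N \<le> Suc (age j n) \<and> (x (Suc n) - x (Suc n - N)) / real N \<in> C"
  unfolding hit_def using sum_sojourn_window[of N j n x] by auto

lemma regime_step_cases:
  assumes "j n = i"
  obtains "hit A (Suc (age j n)) (sojourn x j n)" "j (Suc n) = i'"
  | "hit B (Suc (age j n)) (sojourn x j n)" "j (Suc n) \<noteq> i" "j (Suc n) \<noteq> i'"
  | "\<not> hit A (Suc (age j n)) (sojourn x j n)" "\<not> hit B (Suc (age j n)) (sojourn x j n)" "j (Suc n) = i"
proof -
  define a where "a = (x (Suc n) - x (Suc n - N)) / real N"
  have s: "j (Suc n) = (if N \<le> Suc (age j n) then next_regime l r i a else i)"
    using regime_Suc[of n] assms by (simp add: a_def)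
  have h: "hit C (Suc (age j n)) (sojourn x j n) \<longleftrightarrow> N \<le> Suc (age j n) \<and> a \<in> C" for C
    unfolding a_def by (rule hit_sojourn)
  show ?thesis
  proof (cases "N \<le> Suc (age j n)")
    case False
    then show ?thesis using that(3) s h by auto
  next
    case True
    then show ?thesis using that s h nxt_A[of a] nxt_B[of a] nxt_else[of a] by auto
  qed
qed

lemma alive_sojourn: "j n = i \<Longrightarrow> alive (age j n) (sojourn x j n)"
proof (induction n)
  case (Suc n)
  show ?case
  proof (cases "j (Suc n) = j n")
    case True
    then have "j n = i" using Suc.prems by simp
    from this have "\<not> hit A (Suc (age j n)) (sojourn x j n) \<and> \<not> hit B (Suc (age j n)) (sojourn x j n)"
      by (rule regime_step_cases[of n]) (use True neq \<open>j n = i\<close> in auto)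
    then show ?thesis using True Suc.IH[OF \<open>j n = i\<close>] by (simp add: alive_Suc sojourn_Suc)
  qed simp
qed simp

text \<open>Telescoping over stays: a completed stay in \<open>i\<close> contributes 1 or 0
  according to its exit, minus \<open>rate\<close> times its length. The last summand corrects for
  the stay in progress.\<close>

lemma sum_pot_increments:
  assumes stay: "stay_prob < 1"
  shows "(\<Sum>k<n. of_bool (j k = i) * (pot (Suc (age j k)) (sojourn x j k) - pot (age j k) (sojourn x j k)))
    = (\<Sum>k<n. of_bool (j k = i \<and> j (Suc k) = i')) - rate * (\<Sum>k<n. of_bool (j k = i))
      + of_bool (j n = i) * (pot (age j n) (sojourn x j n) + rate * real (age j n))"
proof (induction n)
  case 0
  then show ?case by (simp add: pot_0[OF stay])
next
  case (Suc n)
  let ?h = "sojourn x j n"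
  let ?m = "age j n"
  show ?case
  proof (cases "j n = i")
    case False
    then have "of_bool (j (Suc n) = i) * (pot (age j (Suc n)) (sojourn x j (Suc n)) + rate * real (age j (Suc n))) = 0"
      using pot_0[OF stay] by auto
    then show ?thesis using False Suc.IH by simp
  next
    case True
    note al = alive_sojourn[OF True]
    from True show ?thesis
    proof (cases rule: regime_step_cases)
      case 1
      have "pot (Suc ?m) ?h = 1 - rate * real (Suc ?m)" using pot_exit_A[OF stay al 1(1)] .
      then show ?thesis using True 1(2) neq Suc.IH by (simp add: algebra_simps)
    next
      case 2
      have "pot (Suc ?m) ?h = - rate * real (Suc ?m)" using pot_exit_B[OF stay al 2(1)] .
      then show ?thesis using True 2(2,3) Suc.IH by (simp add: algebra_simps)
    next
      case 3
      then have "sojourn x j (Suc n) = ?h" "age j (Suc n) = Suc ?m" using True by (simp_all add: sojourn_Suc)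
      then show ?thesis using True 3(3) neq Suc.IH by (simp add: algebra_simps)
    qed
  qed
qed

lemma exits_minus_rate_bound:
  assumes stay: "stay_prob < 1"
  shows "\<bar>(\<Sum>k<n. of_bool (j k = i) * (pot (Suc (age j k)) (sojourn x j k) - pot (age j k) (sojourn x j k)))
    - ((\<Sum>k<n. of_bool (j k = i \<and> j (Suc k) = i')) - rate * (\<Sum>k<n. of_bool (j k = i)))\<bar> \<le> 1 + rate * rem_bound"
proof -
  have "0 \<le> 1 + rate * rem_bound"
    using rate_nonneg rem_bound_nonneg[OF stay] by simp
  then show ?thesis
    using sum_pot_increments[OF stay, of n] pot_alive_bound[OF stay alive_sojourn[of n]]
    by (cases "j n = i") auto
qed

end

section \<open>Increments with a prescribed conditional law\<close>

lemma space_past [simp]: "space (past M X J n) = space M"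
  by (simp add: past_def)

lemma measurable_past:
  assumes "k \<le> n"
  shows "X k \<in> borel_measurable (past M X J n)" "J k \<in> measurable (past M X J n) (count_space UNIV)"
proof -
  let ?H = "\<lambda>\<omega>. \<lambda>k\<in>{..n}. (X k \<omega>, J k \<omega>)"
  let ?P = "\<Pi>\<^sub>M k\<in>{..n}. borel \<Otimes>\<^sub>M count_space UNIV"
  have H: "?H \<in> measurable (past M X J n) ?P"
    unfolding past_def by (rule measurable_vimage_algebra1) (auto simp: space_PiM space_pair_measure)
  have c: "(\<lambda>h. h k) \<in> measurable ?P (borel \<Otimes>\<^sub>M count_space UNIV)"
    using assms by (intro measurable_component_singleton) auto
  have p: "(\<lambda>\<omega>. (X k \<omega>, J k \<omega>)) \<in> measurable (past M X J n) (borel \<Otimes>\<^sub>M count_space UNIV)"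
    using measurable_compose[OF H c] assms by simp
  show "X k \<in> borel_measurable (past M X J n)" using measurable_compose[OF p measurable_fst] by simp
  show "J k \<in> measurable (past M X J n) (count_space UNIV)" using measurable_compose[OF p measurable_snd] by simp
qed

lemma sets_past_mono:
  assumes "m \<le> n"
  shows "sets (past M X J m) \<subseteq> sets (past M X J n)"
proof -
  have "(\<lambda>\<omega>. \<lambda>k\<in>{..m}. (X k \<omega>, J k \<omega>)) \<in> measurable (past M X J n) (\<Pi>\<^sub>M k\<in>{..m}. borel \<Otimes>\<^sub>M count_space UNIV)"
    using measurable_past[where n=n and M=M and X=X and J=J] assms by (intro measurable_restrict measurable_Pair) auto
  then show ?thesis
    unfolding past_def[of M X J m] by (intro sets_image_in_sets) auto
qed

text \<open>The conditional law is known set by set, each set with its own null set, and only where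
  the regime is \<open>i\<close>; the other regimes get their own instances.\<close>

locale conditional_increments = prob_space M for M :: "'a measure" +
  fixes X :: "nat \<Rightarrow> 'a \<Rightarrow> real" and J :: "nat \<Rightarrow> 'a \<Rightarrow> nat" and i :: nat and Q :: "real measure"
  assumes X_meas [measurable]: "\<And>n. X n \<in> borel_measurable M"
    and J_meas [measurable]: "\<And>n. J n \<in> measurable M (count_space UNIV)"
    and Q_dist: "real_distribution Q"
    and cond: "\<And>n A. A \<in> sets borel \<Longrightarrow> AE \<omega> in M. J n \<omega> = i \<longrightarrow>
      real_cond_exp M (past M X J n) (\<lambda>\<omega>'. indicator A (X (n + 1) \<omega>' - X n \<omega>')) \<omega> = measure Q A"
begin

sublocale Q: real_distribution Q by (rule Q_dist)

abbreviation F :: "nat \<Rightarrow> 'a measure" where "F n \<equiv> past M X J n"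

abbreviation xi :: "nat \<Rightarrow> 'a \<Rightarrow> real" where "xi n \<omega> \<equiv> X (Suc n) \<omega> - X n \<omega>"

definition on_i :: "nat \<Rightarrow> 'a set" where "on_i n = {\<omega> \<in> space M. J n \<omega> = i}"

lemma subalg: "subalgebra M (F n)"
  by (rule subalgebra_past) measurable

lemma F_to_M: "f \<in> measurable (F n) K \<Longrightarrow> f \<in> measurable M K"
  by (rule measurable_from_subalg[OF subalg])

lemma on_i_F: "on_i n \<in> sets (F n)"
proof -
  have "J n -` {i} \<inter> space (F n) \<in> sets (F n)"
    by (rule measurable_sets[OF measurable_past(2)]) auto
  moreover have "J n -` {i} \<inter> space (F n) = on_i n" by (auto simp: on_i_def)
  ultimately show ?thesis by simp
qed

lemma on_i_M [measurable]: "on_i n \<in> sets M"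
  using on_i_F[of n] subalg[of n] by (auto simp: subalgebra_def)

text \<open>Restriction to the event of being in regime \<open>i\<close> without renormalising,
  since that event may be null.\<close>

definition Mi :: "nat \<Rightarrow> 'a measure" where "Mi n = density M (indicator (on_i n))"

lemma sets_Mi [measurable_cong, simp]: "sets (Mi n) = sets M"
  by (simp add: Mi_def)

lemma space_Mi [simp]: "space (Mi n) = space M"
  by (simp add: Mi_def)

lemma measurable_id_past: "(\<lambda>\<omega>. \<omega>) \<in> measurable M (F n)"
  using subalg[of n] by (auto simp: subalgebra_def measurable_def)

lemma measurable_pair_past: "(\<lambda>\<omega>. (\<omega>, xi n \<omega>)) \<in> measurable M (F n \<Otimes>\<^sub>M borel)"
  by (intro measurable_Pair measurable_id_past) measurable

lemma measurable_Mi_id: "(\<lambda>\<omega>. \<omega>) \<in> measurable (Mi n) (F n)"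
  using measurable_id_past by (simp cong: measurable_cong_sets)

lemma measurable_Mi_pair: "(\<lambda>\<omega>. (\<omega>, xi n \<omega>)) \<in> measurable (Mi n) (F n \<Otimes>\<^sub>M borel)"
  using measurable_pair_past by (simp cong: measurable_cong_sets)

lemma finite_Mi: "finite_measure (Mi n)"
proof (rule finite_measureI)
  have "emeasure (Mi n) (space (Mi n)) = emeasure M (on_i n)"
    unfolding Mi_def by (subst emeasure_density) (auto simp: nn_integral_cmult_indicator)
  then show "emeasure (Mi n) (space (Mi n)) \<noteq> \<infinity>" by simp
qed

text \<open>In regime \<open>i\<close> the next increment is independent of the past with law
  \<open>Q\<close>. Testing on rectangles suffices, so the set-by-set conditional probabilities are
  enough and the exceptional null sets need not be merged.\<close>

lemma joint_law: "distr (Mi n) (F n) (\<lambda>\<omega>. \<omega>) \<Otimes>\<^sub>M Q = distr (Mi n) (F n \<Otimes>\<^sub>M borel) (\<lambda>\<omega>. (\<omega>, xi n \<omega>))"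
proof (rule pair_measure_eqI)
  interpret Mi: finite_measure "Mi n" by (rule finite_Mi)
  have "finite_measure (distr (Mi n) (F n) (\<lambda>\<omega>. \<omega>))" by (rule Mi.finite_measure_distr[OF measurable_Mi_id])
  then show "sigma_finite_measure (distr (Mi n) (F n) (\<lambda>\<omega>. \<omega>))" by (simp add: finite_measure_def)
  show "sigma_finite_measure Q" by unfold_locales
  show "sets (distr (Mi n) (F n) (\<lambda>\<omega>. \<omega>) \<Otimes>\<^sub>M Q) = sets (distr (Mi n) (F n \<Otimes>\<^sub>M borel) (\<lambda>\<omega>. (\<omega>, xi n \<omega>)))"
    by (simp cong: sets_pair_measure_cong)
  fix A B assume A: "A \<in> sets (distr (Mi n) (F n) (\<lambda>\<omega>. \<omega>))" and B: "B \<in> sets Q"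
  then have A': "A \<in> sets (F n)" and B' [measurable]: "B \<in> sets borel" by auto
  have AM [measurable]: "A \<in> sets M" using A' subalg[of n] by (auto simp: subalgebra_def)
  define C where "C = A \<inter> on_i n"
  have C: "C \<in> sets (F n)" using A' on_i_F by (auto simp: C_def)
  have CM [measurable]: "C \<in> sets M" by (simp add: C_def)
  have AM': "A \<subseteq> space M" using AM by (rule sets.sets_into_space)
  interpret fs: finite_measure_subalgebra M "F n" using subalg by unfold_locales
  have "emeasure (distr (Mi n) (F n) (\<lambda>\<omega>. \<omega>)) A = emeasure (Mi n) A"
    using A' measurable_Mi_id AM' by (subst emeasure_distr) (auto intro!: arg_cong[where f="emeasure (Mi n)"])
  also have "\<dots> = emeasure M C"
    unfolding Mi_def C_def by (subst emeasure_density) (auto simp: Int_commute simp flip: indicator_inter_arith)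
  finally have 1: "emeasure (distr (Mi n) (F n) (\<lambda>\<omega>. \<omega>)) A = emeasure M C" .
  have "emeasure (distr (Mi n) (F n \<Otimes>\<^sub>M borel) (\<lambda>\<omega>. (\<omega>, xi n \<omega>))) (A \<times> B) = emeasure (Mi n) (A \<inter> {\<omega> \<in> space M. xi n \<omega> \<in> B})"
    using A' measurable_Mi_pair AM' by (subst emeasure_distr) (auto intro!: arg_cong[where f="emeasure (Mi n)"])
  also have "\<dots> = emeasure M (C \<inter> {\<omega> \<in> space M. xi n \<omega> \<in> B})"
    unfolding Mi_def C_def
    by (subst emeasure_density) (auto simp: Int_ac simp flip: indicator_inter_arith)
  also have "\<dots> = ennreal (\<integral>\<omega>. indicator C \<omega> * indicator B (xi n \<omega>) \<partial>M)"
  proof -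
    have "(\<lambda>\<omega>. indicator C \<omega> * indicator B (xi n \<omega>) :: real) = indicator (C \<inter> {\<omega> \<in> space M. xi n \<omega> \<in> B})"
      using sets.sets_into_space[OF CM] by (auto simp: indicator_def fun_eq_iff)
    then show ?thesis by (simp add: emeasure_eq_measure)
  qed
  also have "(\<integral>\<omega>. indicator C \<omega> * indicator B (xi n \<omega>) \<partial>M) = (\<integral>\<omega>\<in>C. (indicator B (xi n \<omega>) :: real) \<partial>M)"
    by (simp add: set_lebesgue_integral_def)
  also have "\<dots> = (\<integral>\<omega>\<in>C. real_cond_exp M (F n) (\<lambda>\<omega>'. indicator B (xi n \<omega>')) \<omega> \<partial>M)"
    by (rule fs.real_cond_exp_intA[OF _ C]) (auto intro!: integrable_const_bound[of _ 1])
  also have "\<dots> = (\<integral>\<omega>. indicator C \<omega> * measure Q B \<partial>M)"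
    unfolding set_lebesgue_integral_def
  proof (rule integral_cong_AE)
    show "AE \<omega> in M. indicator C \<omega> *\<^sub>R real_cond_exp M (F n) (\<lambda>\<omega>'. indicator B (xi n \<omega>')) \<omega> = indicator C \<omega> * measure Q B"
      using cond[OF B', of n] by eventually_elim (auto simp: C_def on_i_def indicator_def)
  qed auto
  also have "\<dots> = measure M C * measure Q B" using sets.sets_into_space[OF CM] by (simp add: Int_absorb2)
  finally show "emeasure (distr (Mi n) (F n) (\<lambda>\<omega>. \<omega>)) A * emeasure Q B
      = emeasure (distr (Mi n) (F n \<Otimes>\<^sub>M borel) (\<lambda>\<omega>. (\<omega>, xi n \<omega>))) (A \<times> B)"
    unfolding 1 by (simp add: emeasure_eq_measure Q.emeasure_eq_measure ennreal_mult)
qed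

lemma nn_integral_increment:
  assumes f: "f \<in> borel_measurable (F n \<Otimes>\<^sub>M borel)"
  shows "(\<integral>\<^sup>+\<omega>. indicator (on_i n) \<omega> * f (\<omega>, xi n \<omega>) \<partial>M) = (\<integral>\<^sup>+\<omega>. indicator (on_i n) \<omega> * (\<integral>\<^sup>+x. f (\<omega>, x) \<partial>Q) \<partial>M)"
proof -
  have fQ: "f \<in> borel_measurable (F n \<Otimes>\<^sub>M Q)" using f by (simp cong: measurable_cong_sets sets_pair_measure_cong)
  have f': "(\<lambda>\<omega>. \<integral>\<^sup>+x. f (\<omega>, x) \<partial>Q) \<in> borel_measurable (F n)"
    using fQ by (rule Q.borel_measurable_nn_integral_fst)
  have [measurable]: "(\<lambda>\<omega>. f (\<omega>, xi n \<omega>)) \<in> borel_measurable M" by (rule measurable_compose[OF measurable_pair_past f])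
  have [measurable]: "(\<lambda>\<omega>. \<integral>\<^sup>+x. f (\<omega>, x) \<partial>Q) \<in> borel_measurable M" by (rule F_to_M[OF f'])
  have "(\<integral>\<^sup>+\<omega>. indicator (on_i n) \<omega> * f (\<omega>, xi n \<omega>) \<partial>M) = (\<integral>\<^sup>+\<omega>. f (\<omega>, xi n \<omega>) \<partial>Mi n)"
    unfolding Mi_def by (subst nn_integral_density) auto
  also have "\<dots> = (\<integral>\<^sup>+p. f p \<partial>distr (Mi n) (F n \<Otimes>\<^sub>M borel) (\<lambda>\<omega>. (\<omega>, xi n \<omega>)))"
    by (rule nn_integral_distr[OF measurable_Mi_pair, symmetric]) (use f in simp)
  also have "\<dots> = (\<integral>\<^sup>+\<omega>. (\<integral>\<^sup>+x. f (\<omega>, x) \<partial>Q) \<partial>distr (Mi n) (F n) (\<lambda>\<omega>. \<omega>))"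
    unfolding joint_law[symmetric]
    by (rule Q.nn_integral_fst[symmetric]) (use fQ in \<open>simp cong: measurable_cong_sets sets_pair_measure_cong\<close>)
  also have "\<dots> = (\<integral>\<^sup>+\<omega>. (\<integral>\<^sup>+x. f (\<omega>, x) \<partial>Q) \<partial>Mi n)"
    by (rule nn_integral_distr[OF measurable_Mi_id]) (use f' in simp)
  also have "\<dots> = (\<integral>\<^sup>+\<omega>. indicator (on_i n) \<omega> * (\<integral>\<^sup>+x. f (\<omega>, x) \<partial>Q) \<partial>M)"
    unfolding Mi_def by (subst nn_integral_density) auto
  finally show ?thesis .
qed

text \<open>By Fubini the past may be frozen and the increment averaged first.\<close>

lemma integral_increment_eq_0:
  fixes f :: "'a \<times> real \<Rightarrow> real"
  assumes f: "f \<in> borel_measurable (F n \<Otimes>\<^sub>M borel)" and 0: "\<And>\<omega>. \<omega> \<in> space M \<Longrightarrow> (\<integral>x. f (\<omega>, x) \<partial>Q) = 0"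
    and int: "integrable M (\<lambda>\<omega>. indicator (on_i n) \<omega> * f (\<omega>, xi n \<omega>))"
  shows "(\<integral>\<omega>. indicator (on_i n) \<omega> * f (\<omega>, xi n \<omega>) \<partial>M) = 0"
proof -
  interpret Mi: finite_measure "Mi n" by (rule finite_Mi)
  interpret D: finite_measure "distr (Mi n) (F n) (\<lambda>\<omega>. \<omega>)" by (rule Mi.finite_measure_distr[OF measurable_Mi_id])
  interpret P: pair_sigma_finite "distr (Mi n) (F n) (\<lambda>\<omega>. \<omega>)" Q ..
  have [measurable]: "(\<lambda>\<omega>. f (\<omega>, xi n \<omega>)) \<in> borel_measurable M" by (rule measurable_compose[OF measurable_pair_past f])
  have dens: "Mi n = density M (\<lambda>\<omega>. ennreal (indicator (on_i n) \<omega>))" by (simp add: Mi_def ennreal_indicator)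
  have int1: "integrable (Mi n) (\<lambda>\<omega>. f (\<omega>, xi n \<omega>))"
    unfolding dens using int by (subst integrable_density) auto
  have int2: "integrable (distr (Mi n) (F n) (\<lambda>\<omega>. \<omega>) \<Otimes>\<^sub>M Q) f"
    unfolding joint_law using int1 by (subst integrable_distr_eq[OF measurable_Mi_pair f]) simp
  have "(\<integral>\<omega>. indicator (on_i n) \<omega> * f (\<omega>, xi n \<omega>) \<partial>M) = (\<integral>\<omega>. f (\<omega>, xi n \<omega>) \<partial>Mi n)"
    unfolding dens by (subst integral_density) auto
  also have "\<dots> = (\<integral>p. f p \<partial>distr (Mi n) (F n \<Otimes>\<^sub>M borel) (\<lambda>\<omega>. (\<omega>, xi n \<omega>)))"
    by (rule integral_distr[symmetric, OF measurable_Mi_pair f])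
  also have "\<dots> = (\<integral>\<omega>. (\<integral>x. f (\<omega>, x) \<partial>Q) \<partial>distr (Mi n) (F n) (\<lambda>\<omega>. \<omega>))"
    unfolding joint_law[symmetric] by (rule P.integral_fst'[symmetric, OF int2])
  also have "\<dots> = (\<integral>\<omega>. 0 \<partial>distr (Mi n) (F n) (\<lambda>\<omega>. \<omega>))"
    using 0 by (intro Bochner_Integration.integral_cong) auto
  finally show ?thesis by simp
qed

text \<open>A term is centred given its past, and every earlier term is measurable with respect to
  that past; hence distinct terms are orthogonal.\<close>

lemma strong_law_increments:
  fixes f :: "nat \<Rightarrow> 'a \<times> real \<Rightarrow> real"
  assumes f: "\<And>n. f n \<in> borel_measurable (F n \<Otimes>\<^sub>M borel)"
    and 0: "\<And>n \<omega>. \<omega> \<in> space M \<Longrightarrow> (\<integral>x. f n (\<omega>, x) \<partial>Q) = 0"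
    and sq: "\<And>n \<omega>. \<omega> \<in> space M \<Longrightarrow> (\<integral>\<^sup>+x. ennreal ((f n (\<omega>, x))\<^sup>2) \<partial>Q) \<le> ennreal C" and C: "C \<ge> 0"
  shows "AE \<omega> in M. (\<lambda>n. (\<Sum>k<n. indicator (on_i k) \<omega> * f k (\<omega>, xi k \<omega>)) / real n) \<longlonglongrightarrow> 0"
proof -
  define D where "D k \<omega> = indicator (on_i k) \<omega> * f k (\<omega>, xi k \<omega>)" for k \<omega>
  have [measurable]: "(\<lambda>\<omega>. f k (\<omega>, xi k \<omega>)) \<in> borel_measurable M" for k
    by (rule measurable_compose[OF measurable_pair_past f])
  have [measurable]: "D k \<in> borel_measurable M" for k unfolding D_def by measurable
  have D_F: "D j \<in> borel_measurable (F k)" if "j < k" for j k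
  proof -
    have i: "on_i j \<in> sets (F k)" using on_i_F[of j] sets_past_mono[where m=j and n=k and M=M and X=X and J=J] that by auto
    have "(\<lambda>\<omega>. \<omega>) \<in> measurable (F k) (F j)"
      using sets_past_mono[where m=j and n=k and M=M and X=X and J=J] that by (auto simp: measurable_def)
    moreover have "X (Suc j) \<in> borel_measurable (F k)" "X j \<in> borel_measurable (F k)"
      using that by (auto intro: measurable_past)
    ultimately have "(\<lambda>\<omega>. (\<omega>, xi j \<omega>)) \<in> measurable (F k) (F j \<Otimes>\<^sub>M borel)"
      by (intro measurable_Pair borel_measurable_diff)
    then have "(\<lambda>\<omega>. f j (\<omega>, xi j \<omega>)) \<in> borel_measurable (F k)" using f by (rule measurable_compose)
    with i show ?thesis unfolding D_def by (intro borel_measurable_times borel_measurable_indicator)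
  qed
  have sq_nn: "(\<integral>\<^sup>+\<omega>. ennreal ((D k \<omega>)\<^sup>2) \<partial>M) \<le> ennreal C" for k
  proof -
    have f2: "(\<lambda>p. ennreal ((f k p)\<^sup>2)) \<in> borel_measurable (F k \<Otimes>\<^sub>M borel)" using f[of k] by measurable
    have "(\<integral>\<^sup>+\<omega>. ennreal ((D k \<omega>)\<^sup>2) \<partial>M) = (\<integral>\<^sup>+\<omega>. indicator (on_i k) \<omega> * ennreal ((f k (\<omega>, xi k \<omega>))\<^sup>2) \<partial>M)"
      by (intro nn_integral_cong) (auto simp: D_def indicator_def)
    also have "\<dots> = (\<integral>\<^sup>+\<omega>. indicator (on_i k) \<omega> * (\<integral>\<^sup>+x. ennreal ((f k (\<omega>, x))\<^sup>2) \<partial>Q) \<partial>M)"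
      by (rule nn_integral_increment[OF f2])
    also have "\<dots> \<le> (\<integral>\<^sup>+\<omega>. ennreal C \<partial>M)"
      using sq by (intro nn_integral_mono) (auto simp: indicator_def)
    also have "\<dots> = ennreal C" using emeasure_space_1 by simp
    finally show ?thesis .
  qed
  have sq_int: "integrable M (\<lambda>\<omega>. (D k \<omega>)\<^sup>2)" for k
    using sq_nn[of k] by (intro integrableI_nonneg) (auto intro: le_less_trans)
  have sq_le: "(\<integral>\<omega>. (D k \<omega>)\<^sup>2 \<partial>M) \<le> C" for k
    using sq_nn[of k] C by (subst (asm) nn_integral_eq_integral[OF sq_int]) auto
  have "(\<integral>\<omega>. D j \<omega> * D k \<omega> \<partial>M) = 0" if "j < k" for j k
  proof -
    define g where "g p = D j (fst p) * f k p" for p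
    have g: "g \<in> borel_measurable (F k \<Otimes>\<^sub>M borel)"
      unfolding g_def by (intro borel_measurable_times f measurable_compose[OF measurable_fst D_F[OF that]])
    have eq: "D j \<omega> * D k \<omega> = indicator (on_i k) \<omega> * g (\<omega>, xi k \<omega>)" for \<omega> by (simp add: g_def D_def[of k])
    have "integrable M (\<lambda>\<omega>. D j \<omega> * D k \<omega>)"
      by (intro integrable_mult_of_squares sq_int) measurable
    then have "integrable M (\<lambda>\<omega>. indicator (on_i k) \<omega> * g (\<omega>, xi k \<omega>))" by (simp only: eq)
    then show ?thesis unfolding eq by (intro integral_increment_eq_0[OF g]) (simp_all add: g_def 0)
  qed
  from strong_law_orthogonal[OF _ sq_int sq_le this] show ?thesis unfolding D_def by simp
qed

end

section \<open>Exit frequencies\<close>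

lemma measurable_age_past:
  assumes "m \<le> n"
  shows "(\<lambda>\<omega>. age (\<lambda>k. J k \<omega>) m) \<in> measurable (past M X J n) (count_space UNIV)"
  using assms
proof (induction m)
  case (Suc m)
  have [measurable]: "J m \<in> measurable (past M X J n) (count_space UNIV)"
    "J (Suc m) \<in> measurable (past M X J n) (count_space UNIV)"
    using Suc.prems by (auto intro: measurable_past)
  have [measurable]: "(\<lambda>\<omega>. age (\<lambda>k. J k \<omega>) m) \<in> measurable (past M X J n) (count_space UNIV)"
    using Suc by simp
  show ?case
    unfolding age.simps by (rule measurable_compose_countable[where g="J m"]) measurable
qed simp

lemma tendsto_0_of_bounded_difference:
  fixes a b :: "nat \<Rightarrow> real"
  assumes "(\<lambda>n. a n / real n) \<longlonglongrightarrow> 0" and "\<And>n. \<bar>a n - b n\<bar> \<le> C"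
  shows "(\<lambda>n. b n / real n) \<longlonglongrightarrow> 0"
proof -
  have "(\<lambda>n. (a n - b n) / real n) \<longlonglongrightarrow> 0"
  proof (rule Lim_null_comparison)
    show "\<forall>\<^sub>F n in sequentially. norm ((a n - b n) / real n) \<le> C / real n"
      using assms(2) by (intro always_eventually) (auto simp: abs_divide intro: divide_right_mono)
    show "(\<lambda>n. C / real n) \<longlonglongrightarrow> 0" by (rule lim_const_over_n)
  qed
  from tendsto_diff[OF assms(1) this] show ?thesis by (simp add: diff_divide_distrib)
qed

text \<open>The potential increments along the path have to be written as functions of the past and
  the next increment, on all of the space and with a uniform bound, before the strong law
  applies.\<close>

lemma exit_frequency:
  assumes C: "conditional_increments M X J i Q" and W: "window_exit Q N A B"
    and path: "\<And>\<omega>. \<omega> \<in> space M \<Longrightarrow> regime_path_exit l r N i_start (\<lambda>n. X n \<omega>) (\<lambda>n. J n \<omega>) Q A B i i'"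
    and stay: "window_exit.stay_prob Q N A B < 1"
  shows "AE \<omega> in M. (\<lambda>n. ((\<Sum>k<n. of_bool (J k \<omega> = i \<and> J (Suc k) \<omega> = i'))
      - window_exit.rate Q N A B * (\<Sum>k<n. of_bool (J k \<omega> = i))) / real n) \<longlonglongrightarrow> 0"
proof -
  interpret C: conditional_increments M X J i Q by (rule C)
  interpret W: window_exit Q N A B by (rule W)
  define ag where "ag n \<omega> = age (\<lambda>k. J k \<omega>) n" for n \<omega>
  \<comment> \<open>The increments of the current stay recovered from the past, for a hypothetical
    age \<open>m\<close>. The guard admits only positions up to time \<open>n\<close>, so this is
    measurable with respect to the past even for ages that do not occur.\<close>
  define hist where "hist m n \<omega> = (\<lambda>k. if k < m \<and> n - m + k < n then X (Suc (n - m + k)) \<omega> - X (n - m + k) \<omega> else 0)" for m n \<omega>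
  \<comment> \<open>The factor for being alive makes the bound on the increments valid at every
    point; on actual paths in regime \<open>i\<close> it equals 1.\<close>
  define fm where "fm m n p = of_bool (W.alive m (hist m n (fst p))) *
    (W.pot (Suc m) ((hist m n (fst p))(m := snd p)) - W.pot m (hist m n (fst p)))" for m n and p :: "'a \<times> real"
  \<comment> \<open>The age is random but takes countably many values, so measurability follows from
    that of each \<open>fm m n\<close>.\<close>
  define f where "f n p = fm (ag n (fst p)) n p" for n p
  have hist_meas: "hist m n \<in> measurable (C.F n) seqM" for m n
  proof (rule measurable_PiM_single')
    show "(\<lambda>\<omega>. hist m n \<omega> k) \<in> borel_measurable (C.F n)" for k
      unfolding hist_def by (cases "k < m \<and> n - m + k < n") (auto intro!: borel_measurable_diff measurable_past)
  qed (simp add: space_PiM)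
  have hist1: "(\<lambda>p. hist m n (fst p)) \<in> measurable (C.F n \<Otimes>\<^sub>M borel) seqM" for m n
    by (rule measurable_compose[OF measurable_fst hist_meas])
  have hist2: "(\<lambda>p. (hist m n (fst p))(m := snd p)) \<in> measurable (C.F n \<Otimes>\<^sub>M borel) seqM" for m n
  proof (rule measurable_PiM_single')
    fix k
    have "(\<lambda>p. hist m n (fst p) k) \<in> borel_measurable (C.F n \<Otimes>\<^sub>M borel)"
      by (rule measurable_compose[OF hist1 measurable_component_singleton]) simp
    then show "(\<lambda>p. ((hist m n (fst p))(m := snd p)) k) \<in> borel_measurable (C.F n \<Otimes>\<^sub>M borel)"
      by (cases "k = m") auto
  qed (simp add: space_PiM)
  have "(\<lambda>h. of_bool (W.alive m h) :: real) \<in> borel_measurable seqM" for m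
    unfolding of_bool_def by measurable
  then have fm_meas: "fm m n \<in> borel_measurable (C.F n \<Otimes>\<^sub>M borel)" for m n
    unfolding fm_def
    by (intro borel_measurable_times borel_measurable_diff measurable_compose[OF hist1] measurable_compose[OF hist2] W.measurable_pot)
  have f_meas: "f n \<in> borel_measurable (C.F n \<Otimes>\<^sub>M borel)" for n
    unfolding f_def[abs_def]
  proof (rule measurable_compose_countable[where f="\<lambda>m p. fm m n p" and g="\<lambda>p. ag n (fst p)"])
    show "(\<lambda>p. ag n (fst p)) \<in> measurable (C.F n \<Otimes>\<^sub>M borel) (count_space UNIV)"
      unfolding ag_def by (rule measurable_compose[OF measurable_fst measurable_age_past]) simp
  qed (rule fm_meas)
  define K where "K = 2 * (1 + W.rate * W.rem_bound) + W.rate"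
  have f_bound: "\<bar>f n (\<omega>, x)\<bar> \<le> K" for n \<omega> x
  proof -
    define m where "m = ag n \<omega>"
    define h where "h = hist m n \<omega>"
    have K: "0 \<le> K" unfolding K_def
      using W.rate_nonneg W.rem_bound_nonneg[OF stay] by (intro add_nonneg_nonneg mult_nonneg_nonneg) auto
    show ?thesis
    proof (cases "W.alive m h")
      case True
      have "W.alive m (h(m := x))" using True W.alive_cong[of m "h(m := x)" h] by simp
      from W.pot_increment_bound[OF stay this]
      have "\<bar>W.pot (Suc m) (h(m := x)) - W.pot m h\<bar> \<le> K"
        using W.pot_cong[of m "h(m := x)" h] by (simp add: K_def)
      then show ?thesis using True by (simp add: f_def fm_def m_def h_def)
    next
      case False
      then show ?thesis using K by (simp add: f_def fm_def m_def h_def)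
    qed
  qed
  have "AE \<omega> in M. (\<lambda>n. (\<Sum>k<n. indicator (C.on_i k) \<omega> * f k (\<omega>, C.xi k \<omega>)) / real n) \<longlonglongrightarrow> 0"
  proof (rule C.strong_law_increments[OF f_meas])
    show "(\<integral>x. f n (\<omega>, x) \<partial>Q) = 0" for n \<omega>
      unfolding f_def fm_def using W.pot_step[OF stay] C.Q.prob_space by simp
    show "(\<integral>\<^sup>+x. ennreal ((f n (\<omega>, x))\<^sup>2) \<partial>Q) \<le> ennreal (K\<^sup>2)" for n \<omega>
    proof -
      have "(\<integral>\<^sup>+x. ennreal ((f n (\<omega>, x))\<^sup>2) \<partial>Q) \<le> (\<integral>\<^sup>+x. ennreal (K\<^sup>2) \<partial>Q)"
      proof (intro nn_integral_mono ennreal_leI)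
        show "(f n (\<omega>, x))\<^sup>2 \<le> K\<^sup>2" for x
          using power_mono[OF f_bound[of n \<omega> x] abs_ge_zero, of 2] by simp
      qed
      then show ?thesis using C.Q.emeasure_space_1 by simp
    qed
  qed simp
  moreover have "AE \<omega> in M. \<omega> \<in> space M" by (rule AE_space)
  ultimately show ?thesis
  proof eventually_elim
    case (elim \<omega>)
    let ?j = "\<lambda>k. J k \<omega>" and ?x = "\<lambda>k. X k \<omega>"
    interpret R: regime_path_exit l r N i_start ?x ?j Q A B i i' by (rule path) (use elim in simp)
    have eq: "indicator (C.on_i k) \<omega> * f k (\<omega>, C.xi k \<omega>)
      = of_bool (J k \<omega> = i) * (W.pot (Suc (age ?j k)) (sojourn ?x ?j k) - W.pot (age ?j k) (sojourn ?x ?j k))" for k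
    proof (cases "J k \<omega> = i")
      case True
      let ?m = "age ?j k"
      have h: "hist ?m k \<omega> k' = sojourn ?x ?j k k'" if "k' < ?m" for k'
        using that age_le[of ?j k] by (auto simp: hist_def sojourn_def)
      have "W.alive ?m (hist ?m k \<omega>)"
        using W.alive_cong[OF h] R.alive_sojourn[OF True] by simp
      moreover have "W.pot ?m (hist ?m k \<omega>) = W.pot ?m (sojourn ?x ?j k)" by (rule W.pot_cong[OF h])
      moreover have "W.pot (Suc ?m) ((hist ?m k \<omega>)(?m := C.xi k \<omega>)) = W.pot (Suc ?m) (sojourn ?x ?j k)"
        by (rule W.pot_cong) (use h sojourn_last[of ?x ?j k] in \<open>auto simp: less_Suc_eq\<close>)
      ultimately show ?thesis using True elim by (simp add: f_def fm_def ag_def C.on_i_def)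
    qed (simp add: C.on_i_def)
    show ?case
      by (rule tendsto_0_of_bounded_difference[OF elim(1)[unfolded eq] R.exits_minus_rate_bound[OF stay]])
  qed
qed

lemma increments_frequency:
  assumes C: "conditional_increments M X J i Q" and int: "integrable Q (\<lambda>x. x)"
    and sq: "(\<integral>\<^sup>+x. ennreal ((x - mean Q)\<^sup>2) \<partial>Q) < \<infinity>"
  shows "AE \<omega> in M. (\<lambda>n. (\<Sum>k<n. of_bool (J k \<omega> = i) * (X (Suc k) \<omega> - X k \<omega> - mean Q)) / real n) \<longlonglongrightarrow> 0"
proof -
  interpret C: conditional_increments M X J i Q by (rule C)
  obtain c where c: "(\<integral>\<^sup>+x. ennreal ((x - mean Q)\<^sup>2) \<partial>Q) = ennreal c" "c \<ge> 0"
    using sq by (cases "\<integral>\<^sup>+x. ennreal ((x - mean Q)\<^sup>2) \<partial>Q") auto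
  have "AE \<omega> in M. (\<lambda>n. (\<Sum>k<n. indicator (C.on_i k) \<omega> * (snd (\<omega>, C.xi k \<omega>) - mean Q)) / real n) \<longlonglongrightarrow> 0"
  proof (rule C.strong_law_increments[where f="\<lambda>_ p. snd p - mean Q" and C=c])
    show "(\<integral>x. snd (\<omega>, x) - mean Q \<partial>Q) = 0" for \<omega> :: 'a
      using int C.Q.prob_space by (simp add: mean_def)
  qed (use c in auto)
  moreover have "AE \<omega> in M. \<omega> \<in> space M" by (rule AE_space)
  ultimately show ?thesis
  proof eventually_elim
    case (elim \<omega>)
    have "indicator (C.on_i k) \<omega> = (of_bool (J k \<omega> = i) :: real)" for k
      using elim by (simp add: C.on_i_def indicator_def)
    then show ?case using elim by simp
  qed
qed

section \<open>Crossings between neighbouring regimes\<close>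

context regime_path
begin

lemma regime_le:
  assumes "i_start \<le> l"
  shows "j n \<le> l"
proof (induction n)
  case 0
  show ?case using init[of 0] N_pos assms by simp
next
  case (Suc n)
  then show ?case
    by (subst regime_Suc) (auto simp: next_regime_def threshold_def)
qed

lemma regime_Suc_cases: "j (Suc n) = j n \<or> j (Suc n) = Suc (j n) \<or> j n = Suc (j (Suc n))"
  by (subst (1 2 3) regime_Suc) (auto simp: next_regime_def threshold_def)

text \<open>Regimes change by at most one, so the indicator of lying above the edge changes only at
  its crossings, by one each time; the difference of the counts telescopes.\<close>

lemma crossings_balance:
  "(\<Sum>k<n. of_bool (j k = i \<and> j (Suc k) = Suc i)) - (\<Sum>k<n. of_bool (j k = Suc i \<and> j (Suc k) = i))
    = (of_bool (Suc i \<le> j n) - of_bool (Suc i \<le> j 0) :: real)"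
proof (induction n)
  case (Suc n)
  have "of_bool (a = i \<and> b = Suc i) - of_bool (a = Suc i \<and> b = i)
      = (of_bool (Suc i \<le> b) - of_bool (Suc i \<le> a) :: real)"
    if "b = a \<or> b = Suc a \<or> a = Suc b" for a b :: nat
    using that by (auto simp: of_bool_def)
  from this[OF regime_Suc_cases[of n]] Suc show ?case by simp
qed simp

end

section \<open>Occupation weights\<close>

text \<open>The unnormalised stationary measure of a birth and death chain with upward rates
  \<open>u\<close> and downward rates \<open>d\<close>, with weight 1 at 0.\<close>

definition weight :: "(nat \<Rightarrow> real) \<Rightarrow> (nat \<Rightarrow> real) \<Rightarrow> nat \<Rightarrow> real" where
  "weight u d i = (\<Prod>k<i. u k / d (Suc k))"

text \<open>The balance relations tie every frequency asymptotically to \<open>weight u d i\<close>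
  times the frequency of 0, and the total 1 then determines the latter.\<close>

lemma occupation_limit:
  fixes t :: "nat \<Rightarrow> nat \<Rightarrow> real"
  assumes sum: "\<forall>\<^sub>F n in sequentially. (\<Sum>i\<le>l. t i n) = 1"
    and bal: "\<And>i. i < l \<Longrightarrow> (\<lambda>n. u i * t i n - d (Suc i) * t (Suc i) n) \<longlonglongrightarrow> 0"
    and u: "\<And>i. i < l \<Longrightarrow> u i > 0" and d: "\<And>i. i < l \<Longrightarrow> d (Suc i) > 0" and "i \<le> l"
  shows "t i \<longlonglongrightarrow> weight u d i / (\<Sum>k\<le>l. weight u d k)"
proof -
  have w: "weight u d i > 0" if "i \<le> l" for i
    unfolding weight_def using u d that by (intro prod_pos) auto
  have rel: "(\<lambda>n. t i n - weight u d i * t 0 n) \<longlonglongrightarrow> 0" if "i \<le> l" for i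
    using that
  proof (induction i)
    case (Suc i)
    then have i: "i < l" by simp
    have "(\<lambda>n. u i / d (Suc i) * (t i n - weight u d i * t 0 n) - (u i * t i n - d (Suc i) * t (Suc i) n) / d (Suc i))
        \<longlonglongrightarrow> u i / d (Suc i) * 0 - 0 / d (Suc i)"
      using Suc i bal[OF i] d[OF i] by (intro tendsto_intros) auto
    moreover have "u i / d (Suc i) * (t i n - weight u d i * t 0 n) - (u i * t i n - d (Suc i) * t (Suc i) n) / d (Suc i)
        = t (Suc i) n - weight u d (Suc i) * t 0 n" for n
      using d[OF i] by (simp add: weight_def field_simps)
    ultimately show ?case by simp
  qed (simp add: weight_def)
  define W where "W = (\<Sum>k\<le>l. weight u d k)"
  have W: "W > 0" unfolding W_def using w by (intro sum_pos) auto
  have "(\<lambda>n. \<Sum>i\<le>l. t i n - weight u d i * t 0 n) \<longlonglongrightarrow> (\<Sum>i\<le>l. 0)"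
    using rel by (intro tendsto_sum) auto
  moreover have "\<forall>\<^sub>F n in sequentially. (\<Sum>i\<le>l. t i n - weight u d i * t 0 n) = 1 - W * t 0 n"
    using sum by eventually_elim (simp add: sum_subtractf W_def sum_distrib_right)
  ultimately have "(\<lambda>n. 1 - W * t 0 n) \<longlonglongrightarrow> 0" by (simp add: tendsto_cong)
  then have "(\<lambda>n. (1 - (1 - W * t 0 n)) / W) \<longlonglongrightarrow> (1 - 0) / W" using W by (intro tendsto_intros) auto
  then have t0: "t 0 \<longlonglongrightarrow> 1 / W" using W by simp
  have "(\<lambda>n. (t i n - weight u d i * t 0 n) + weight u d i * t 0 n) \<longlonglongrightarrow> 0 + weight u d i * (1 / W)"
    using \<open>i \<le> l\<close> by (intro tendsto_add rel tendsto_mult tendsto_const t0)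
  then show ?thesis by (simp add: W_def)
qed

text \<open>Laplace's principle for a finite sum: the logarithm of each weight grows linearly in
  \<open>N\<close>, so divided by the weight of \<open>i0\<close> all others vanish.\<close>

lemma weighted_mean_limit:
  fixes u d :: "nat \<Rightarrow> nat \<Rightarrow> real"
  assumes u: "\<And>i. i < l \<Longrightarrow> decays (\<lambda>N. u N i) (Ju i)"
    and d: "\<And>i. i < l \<Longrightarrow> decays (\<lambda>N. d N (Suc i)) (Jd (Suc i))"
    and i0: "i0 \<le> l"
    and max: "\<And>i. i \<le> l \<Longrightarrow> i \<noteq> i0 \<Longrightarrow> (\<Sum>k<i. Jd (Suc k) - Ju k) < (\<Sum>k<i0. Jd (Suc k) - Ju k)"
  shows "(\<lambda>N. (\<Sum>i\<le>l. weight (u N) (d N) i * \<mu> i) / (\<Sum>i\<le>l. weight (u N) (d N) i)) \<longlonglongrightarrow> \<mu> i0"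
proof -
  define w where "w N = weight (u N) (d N)" for N
  have "\<forall>\<^sub>F N in sequentially. \<forall>i\<in>{..<l}. u N i > 0 \<and> d N (Suc i) > 0"
    using u d unfolding decays_def by (intro eventually_ball_finite ballI eventually_conj) auto
  then have pos: "\<forall>\<^sub>F N in sequentially. \<forall>i\<le>l. w N i > 0"
    by eventually_elim (auto simp: w_def weight_def intro!: prod_pos)
  define L where "L i = (\<Sum>k<i. Jd (Suc k) - Ju k)" for i
  have lnw: "(\<lambda>N. ln (w N i) / real N) \<longlonglongrightarrow> L i" if "i \<le> l" for i
  proof -
    have "(\<lambda>N. \<Sum>k<i. ln (u N k) / real N - ln (d N (Suc k)) / real N) \<longlonglongrightarrow> (\<Sum>k<i. - Ju k - - Jd (Suc k))"
      using that by (intro tendsto_sum tendsto_diff) (use u d in \<open>auto simp: decays_def\<close>)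
    moreover have "\<forall>\<^sub>F N in sequentially. (\<Sum>k<i. ln (u N k) / real N - ln (d N (Suc k)) / real N) = ln (w N i) / real N"
      using \<open>\<forall>\<^sub>F N in sequentially. \<forall>i\<in>{..<l}. u N i > 0 \<and> d N (Suc i) > 0\<close>
    proof eventually_elim
      case (elim N)
      have ud: "u N k > 0" "d N (Suc k) > 0" if "k < i" for k
        using elim that \<open>i \<le> l\<close> by auto
      have "ln (w N i) = (\<Sum>k<i. ln (u N k / d N (Suc k)))"
        unfolding w_def weight_def by (intro ln_prod) (simp_all add: ud less_imp_neq[symmetric])
      also have "\<dots> = (\<Sum>k<i. ln (u N k) - ln (d N (Suc k)))"
        by (intro sum.cong refl ln_divide_pos) (simp_all add: ud)
      finally show ?case by (simp add: sum_divide_distrib diff_divide_distrib)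
    qed
    ultimately have "(\<lambda>N. ln (w N i) / real N) \<longlonglongrightarrow> (\<Sum>k<i. - Ju k - - Jd (Suc k))"
      by (rule Lim_transform_eventually)
    then show ?thesis by (simp add: L_def)
  qed
  have ratio: "(\<lambda>N. w N i / w N i0) \<longlonglongrightarrow> of_bool (i = i0)" if "i \<le> l" for i
  proof (cases "i = i0")
    case True
    have "\<forall>\<^sub>F N in sequentially. w N i / w N i0 = 1"
      using pos by eventually_elim (use True i0 in force)
    then show ?thesis using True by (simp add: tendsto_cong)
  next
    case False
    then have neg: "L i - L i0 < 0" using max[OF that] by (simp add: L_def)
    have "filterlim (\<lambda>N. (ln (w N i) / real N - ln (w N i0) / real N) * real N) at_bot sequentially"
      by (rule filterlim_tendsto_neg_mult_at_bot[OF tendsto_diff[OF lnw[OF that] lnw[OF i0]] neg filterlim_real_sequentially])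
    then have "(\<lambda>N. exp ((ln (w N i) / real N - ln (w N i0) / real N) * real N)) \<longlonglongrightarrow> 0"
      by (rule filterlim_compose[OF exp_at_bot])
    moreover have "\<forall>\<^sub>F N in sequentially. exp ((ln (w N i) / real N - ln (w N i0) / real N) * real N)
        = w N i / w N i0"
      using pos eventually_gt_at_top[of 0]
    proof eventually_elim
      case (elim N)
      then have "w N i > 0" "w N i0 > 0" using that i0 by auto
      then show ?case using elim by (simp add: algebra_simps exp_diff)
    qed
    ultimately have "(\<lambda>N. w N i / w N i0) \<longlonglongrightarrow> 0"
      by (rule Lim_transform_eventually)
    then show ?thesis using False by simp
  qed
  have "(\<lambda>N. (\<Sum>i\<le>l. w N i / w N i0 * \<mu> i) / (\<Sum>i\<le>l. w N i / w N i0))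
      \<longlonglongrightarrow> (\<Sum>i\<le>l. of_bool (i = i0) * \<mu> i) / (\<Sum>i\<le>l. of_bool (i = i0))"
    using ratio i0 by (intro tendsto_divide tendsto_sum tendsto_mult tendsto_const) auto
  moreover have "(\<Sum>i\<le>l. of_bool (i = i0) * \<mu> i) / (\<Sum>i\<le>l. of_bool (i = i0)) = \<mu> i0"
  proof -
    have "(\<Sum>i\<le>l. of_bool (i = i0) * \<mu> i) = (\<Sum>i\<in>{i0}. \<mu> i)"
      using i0 by (intro sum.mono_neutral_cong_right) auto
    moreover have "(\<Sum>i\<le>l. of_bool (i = i0)) = (\<Sum>i\<in>{i0}. 1 :: real)"
      using i0 by (intro sum.mono_neutral_cong_right) auto
    ultimately show ?thesis by simp
  qed
  moreover have "\<forall>\<^sub>F N in sequentially. (\<Sum>i\<le>l. w N i / w N i0 * \<mu> i) / (\<Sum>i\<le>l. w N i / w N i0)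
      = (\<Sum>i\<le>l. w N i * \<mu> i) / (\<Sum>i\<le>l. w N i)"
    using pos
  proof eventually_elim
    case (elim N)
    then have "w N i0 \<noteq> 0" using i0 by force
    moreover have "(\<Sum>i\<le>l. w N i / w N i0 * \<mu> i) = (\<Sum>i\<le>l. w N i * \<mu> i) / w N i0"
      by (simp add: sum_divide_distrib)
    moreover have "(\<Sum>i\<le>l. w N i / w N i0) = (\<Sum>i\<le>l. w N i) / w N i0"
      by (simp add: sum_divide_distrib)
    ultimately show ?case by simp
  qed
  ultimately show ?thesis unfolding w_def[symmetric] using Lim_transform_eventually by fastforce
qed

section \<open>Exponential rates of the exits\<close>

definition exit_up :: "nat \<Rightarrow> (nat \<Rightarrow> real) \<Rightarrow> nat \<Rightarrow> real set" where
  "exit_up l r i = {a. threshold l r (Suc i) \<le> ereal a}"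

definition exit_down :: "nat \<Rightarrow> (nat \<Rightarrow> real) \<Rightarrow> nat \<Rightarrow> real set" where
  "exit_down l r i = {a. ereal a < threshold l r i}"

lemma exit_up_eq: "exit_up l r i = (if i < l then {r (Suc i)..} else {})"
  by (auto simp: exit_up_def threshold_def)

lemma exit_down_eq: "i \<le> l \<Longrightarrow> exit_down l r i = (if i = 0 then {} else {..<r i})"
  by (auto simp: exit_down_def threshold_def)

definition window_prob :: "real measure \<Rightarrow> nat \<Rightarrow> real set \<Rightarrow> real" where
  "window_prob Q N A = measure (iid_sequence.paths Q) {y. (\<Sum>k<N. y k) / real N \<in> A}"

lemma (in window_exit) window_prob_eq: "measure paths {y. hit A N y} = window_prob Q N A"
  by (simp add: window_prob_def hit_def lessThan_atLeast0)

lemma (in window_exit) window_prob_eq_B: "measure paths {y. hit B N y} = window_prob Q N B"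
  by (simp add: window_prob_def hit_def lessThan_atLeast0)

lemma (in window_exit) stay_prob_less_1:
  assumes "window_prob Q N A > 0 \<or> window_prob Q N B > 0"
  shows "stay_prob < 1"
proof -
  have *: "stay_prob < 1" if h: "measure paths {y. hit C N y} > 0" and C: "C = A \<or> C = B" for C
  proof -
    have m: "{y. hit C N y} \<in> sets paths" using C by (intro sets_paths_Collect) auto
    have "stay_prob \<le> measure paths (space paths - {y. hit C N y})"
      unfolding stay_prob_def using C by (intro paths.finite_measure_mono sets.compl_sets[OF m]) auto
    also have "\<dots> = 1 - measure paths {y. hit C N y}" using m by (rule paths.prob_compl)
    finally show ?thesis using h by simp
  qed
  show ?thesis using assms *[of A] *[of B] by (auto simp: window_prob_eq window_prob_eq_B)
qed

text \<open>The rate and the window probability differ at most by a factor \<open>2 * N\<close>,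
  whose logarithm is negligible against \<open>N\<close>.\<close>

lemma exit_rate_decays:
  assumes W: "\<And>N. N > 0 \<Longrightarrow> window_exit Q N A B"
    and dir: "closed_dir up A" "closed_dir (\<not> up) B"
    and dec: "decays (\<lambda>N. window_prob Q N A) I"
  shows "decays (\<lambda>N. window_exit.rate Q N A B) I"
proof -
  have lim: "(\<lambda>N. ln (window_prob Q N A) / real N) \<longlonglongrightarrow> - I" and pos: "\<forall>\<^sub>F N in sequentially. window_prob Q N A > 0"
    using dec by (simp_all add: decays_def)
  have ev: "\<forall>\<^sub>F N in sequentially. N > 0 \<and> window_prob Q N A > 0 \<and> window_exit.rate Q N A B \<le> window_prob Q N A
      \<and> window_prob Q N A \<le> 2 * real N * window_exit.rate Q N A B"
    using pos eventually_gt_at_top[of 0]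
  proof eventually_elim
    case (elim N)
    interpret W: window_exit Q N A B by (rule W) fact
    have "W.stay_prob < 1" using elim by (intro W.stay_prob_less_1) auto
    from W.rate_bounds[OF this] dir elim show ?case by (simp add: W.window_prob_eq)
  qed
  then have rate_pos: "\<forall>\<^sub>F N in sequentially. window_exit.rate Q N A B > 0"
  proof eventually_elim
    case (elim N)
    then have "0 < 2 * real N * window_exit.rate Q N A B" by linarith
    then show ?case by (simp add: zero_less_mult_iff)
  qed
  then have ev2: "\<forall>\<^sub>F N in sequentially. ln (window_prob Q N A) / real N - ln (2 * real N) / real N \<le> ln (window_exit.rate Q N A B) / real N
      \<and> ln (window_exit.rate Q N A B) / real N \<le> ln (window_prob Q N A) / real N"
    using ev
  proof eventually_elim
    case (elim N)
    have "ln (window_prob Q N A) \<le> ln (2 * real N * window_exit.rate Q N A B)"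
      using elim by (subst ln_le_cancel_iff) auto
    also have "\<dots> = ln (2 * real N) + ln (window_exit.rate Q N A B)"
      using elim by (intro ln_mult_pos) auto
    finally have "(ln (window_prob Q N A) - ln (2 * real N)) / real N \<le> ln (window_exit.rate Q N A B) / real N"
      by (intro divide_right_mono) auto
    moreover have "ln (window_exit.rate Q N A B) \<le> ln (window_prob Q N A)"
      using elim by (subst ln_le_cancel_iff) auto
    then have "ln (window_exit.rate Q N A B) / real N \<le> ln (window_prob Q N A) / real N"
      by (intro divide_right_mono) auto
    ultimately show ?case by (simp add: diff_divide_distrib)
  qed
  have "(\<lambda>N. ln (2 * real N) / real N) \<longlonglongrightarrow> 0" by real_asymp
  from tendsto_diff[OF lim this]
  have lo: "(\<lambda>N. ln (window_prob Q N A) / real N - ln (2 * real N) / real N) \<longlonglongrightarrow> - I" by simp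
  have "(\<lambda>N. ln (window_exit.rate Q N A B) / real N) \<longlonglongrightarrow> - I"
    by (rule tendsto_sandwich[OF _ _ lo lim]) (use ev2 in \<open>auto elim: eventually_mono\<close>)
  with rate_pos show ?thesis by (simp add: decays_def)
qed

section \<open>Cramer's rate as a Legendre-Fenchel transform\<close>

lemma extended_ln_exp_mult: "extended_ln (ennreal (exp s) * m) = ereal s + extended_ln m"
proof (cases m)
  case (real a)
  show ?thesis
  proof (cases "a = 0")
    case False
    then have "a > 0" using real by simp
    then have "ennreal (exp s) * m = ennreal (exp s * a)" using real by (simp add: ennreal_mult)
    then show ?thesis using real \<open>a > 0\<close> by (simp add: extended_ln_def ln_mult_pos)
  qed (use real in \<open>simp add: extended_ln_def\<close>)
qed (simp add: extended_ln_def ennreal_mult_top)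

text \<open>Centring at \<open>a\<close> produces the linear term of the transform. The version for
  lower half lines arises from reflecting \<open>t\<close>, which leaves a supremum over the whole
  line unchanged.\<close>

lemma legendre_fenchel_eq:
  assumes "real_distribution Q"
  shows "(SUP t. - extended_ln (\<integral>\<^sup>+x. ennreal (exp (t * (x - a))) \<partial>Q)) = legendre_fenchel Q a" (is ?A)
    and "(SUP t. - extended_ln (\<integral>\<^sup>+x. ennreal (exp (t * (a - x))) \<partial>Q)) = legendre_fenchel Q a" (is ?B)
proof -
  interpret real_distribution Q by fact
  have eq: "- extended_ln (\<integral>\<^sup>+x. ennreal (exp (t * (x - a))) \<partial>Q) = ereal (t * a) - extended_ln (mgf Q t)" for t
  proof -
    have "(\<integral>\<^sup>+x. ennreal (exp (t * (x - a))) \<partial>Q) = (\<integral>\<^sup>+x. ennreal (exp (- (t * a))) * ennreal (exp (t * x)) \<partial>Q)"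
      by (intro nn_integral_cong) (simp add: right_diff_distrib flip: ennreal_mult exp_add)
    also have "\<dots> = ennreal (exp (- (t * a))) * mgf Q t"
      unfolding mgf_def by (rule nn_integral_cmult) measurable
    finally have "extended_ln (\<integral>\<^sup>+x. ennreal (exp (t * (x - a))) \<partial>Q) = ereal (- (t * a)) + extended_ln (mgf Q t)"
      by (simp only: extended_ln_exp_mult)
    then show ?thesis by (cases "extended_ln (mgf Q t)") auto
  qed
  show A: ?A unfolding eq legendre_fenchel_def ..
  have "(SUP t. - extended_ln (\<integral>\<^sup>+x. ennreal (exp (t * (a - x))) \<partial>Q))
      = (SUP t\<in>range uminus. - extended_ln (\<integral>\<^sup>+x. ennreal (exp (t * (x - a))) \<partial>Q))"
    unfolding image_image by (simp add: algebra_simps)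
  also have "range (uminus :: real \<Rightarrow> real) = UNIV" by (metis surj_def minus_minus)
  finally show ?B using A by simp
qed

text \<open>An upward exit includes the threshold itself, hence the weak inequality;
  \<open>a\<close> may be the right end of the support, provided it carries mass.\<close>

lemma window_prob_decays_ge:
  assumes "real_distribution Q" and int: "integrable Q (\<lambda>x. x)" and "mean Q < a" and pos: "measure Q {a..} > 0"
  shows "\<exists>I. legendre_fenchel Q a = ereal I \<and> decays (\<lambda>N. window_prob Q N {a..}) I"
proof -
  interpret real_distribution Q by fact
  interpret iid_sequence Q by unfold_locales
  define E where "E n = {y :: nat \<Rightarrow> real. (\<Sum>k<n. y k - a) \<ge> 0}" for n
  have set_eq: "{x. x - a \<ge> 0} = {a..}" by auto
  have "\<exists>I. (SUP t. - extended_ln (\<integral>\<^sup>+x. ennreal (exp (t * (x - a))) \<partial>Q)) = ereal I \<and> decays (\<lambda>n. measure paths (E n)) I"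
  proof (rule cramer_half_line)
    show "integrable Q (\<lambda>x. x - a)" using int by simp
    have "(\<integral>x. x - a \<partial>Q) = mean Q - a" using int prob_space by (simp add: mean_def)
    then show "(\<integral>x. x - a \<partial>Q) < 0" using assms(3) by simp
    show "(\<forall>n. E n = {y. (\<Sum>k<n. y k - a) > 0}) \<and> measure Q {x. x - a > 0} > 0
      \<or> (\<forall>n. E n = {y. (\<Sum>k<n. y k - a) \<ge> 0}) \<and> measure Q {x. x - a \<ge> 0} > 0"
      unfolding set_eq using pos by (intro disjI2 conjI allI E_def)
  qed measurable
  then obtain I where I: "legendre_fenchel Q a = ereal I" "decays (\<lambda>n. measure paths (E n)) I"
    unfolding legendre_fenchel_eq[OF assms(1)] by blast
  have "\<forall>\<^sub>F n in sequentially. measure paths (E n) = window_prob Q n {a..}"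
    using eventually_gt_at_top[of 0]
  proof eventually_elim
    case (elim n)
    then have "E n = {y. (\<Sum>k<n. y k) / real n \<in> {a..}}"
      by (auto simp: E_def sum_subtractf field_simps)
    then show ?case by (simp add: window_prob_def)
  qed
  from decays_cong[OF I(2) this] I(1) show ?thesis by blast
qed

lemma window_prob_decays_less:
  assumes "real_distribution Q" and int: "integrable Q (\<lambda>x. x)" and "a < mean Q" and pos: "measure Q {..<a} > 0"
  shows "\<exists>I. legendre_fenchel Q a = ereal I \<and> decays (\<lambda>N. window_prob Q N {..<a}) I"
proof -
  interpret real_distribution Q by fact
  interpret iid_sequence Q by unfold_locales
  define E where "E n = {y :: nat \<Rightarrow> real. (\<Sum>k<n. a - y k) > 0}" for n
  have set_eq: "{x. a - x > 0} = {..<a}" by auto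
  have "\<exists>I. (SUP t. - extended_ln (\<integral>\<^sup>+x. ennreal (exp (t * (a - x))) \<partial>Q)) = ereal I \<and> decays (\<lambda>n. measure paths (E n)) I"
  proof (rule cramer_half_line)
    show "integrable Q (\<lambda>x. a - x)" using int by simp
    have "(\<integral>x. a - x \<partial>Q) = a - mean Q" using int prob_space by (simp add: mean_def)
    then show "(\<integral>x. a - x \<partial>Q) < 0" using assms(3) by simp
    show "(\<forall>n. E n = {y. (\<Sum>k<n. a - y k) > 0}) \<and> measure Q {x. a - x > 0} > 0
      \<or> (\<forall>n. E n = {y. (\<Sum>k<n. a - y k) \<ge> 0}) \<and> measure Q {x. a - x \<ge> 0} > 0"
      unfolding set_eq using pos by (intro disjI1 conjI allI E_def)
  qed measurable
  then obtain I where I: "legendre_fenchel Q a = ereal I" "decays (\<lambda>n. measure paths (E n)) I"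
    unfolding legendre_fenchel_eq[OF assms(1)] by blast
  have "\<forall>\<^sub>F n in sequentially. measure paths (E n) = window_prob Q n {..<a}"
    using eventually_gt_at_top[of 0]
  proof eventually_elim
    case (elim n)
    then have "E n = {y. (\<Sum>k<n. y k) / real n \<in> {..<a}}"
      by (auto simp: E_def sum_subtractf field_simps)
    then show ?case by (simp add: window_prob_def)
  qed
  from decays_cong[OF I(2) this] I(1) show ?thesis by blast
qed

text \<open>Assumption C enters here: finite exponential moments on both sides provide the second
  moments that the strong law asks for.\<close>

lemma second_moment_finite:
  assumes "real_distribution Q" and "t0 > 0" and "mgf Q t0 < \<infinity>" and "mgf Q (- t0) < \<infinity>"
  shows "(\<integral>\<^sup>+x. ennreal ((x - \<mu>)\<^sup>2) \<partial>Q) < \<infinity>"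
proof -
  interpret real_distribution Q by fact
  \<comment> \<open>Chosen so that \<open>c\<close> times the quadratic Taylor term of
    \<open>exp (t0 * x)\<close> is \<open>2 * x^2\<close>.\<close>
  define c where "c = 4 / t0\<^sup>2"
  have c: "c > 0" using \<open>t0 > 0\<close> by (simp add: c_def)
  have le: "(x - \<mu>)\<^sup>2 \<le> c * exp (t0 * x) + c * exp (- t0 * x) + 2 * \<mu>\<^sup>2" for x
  proof -
    have q: "y\<^sup>2 / 2 \<le> exp y" if "y \<ge> 0" for y :: real
      using exp_lower_Taylor_quadratic[OF that] that by simp
    have "(t0 * x)\<^sup>2 / 2 \<le> exp (t0 * x) + exp (- t0 * x)"
    proof (cases "x \<ge> 0")
      case True
      have "0 \<le> t0 * x" using True \<open>t0 > 0\<close> by simp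
      from q[OF this] show ?thesis by (simp add: add_increasing2)
    next
      case False
      have "0 \<le> - t0 * x" using False \<open>t0 > 0\<close> by (simp add: mult_nonneg_nonpos)
      from q[OF this] show ?thesis by (simp add: add_increasing)
    qed
    then have "c * ((t0 * x)\<^sup>2 / 2) \<le> c * (exp (t0 * x) + exp (- t0 * x))"
      using c by (intro mult_left_mono) auto
    moreover have "c * ((t0 * x)\<^sup>2 / 2) = 2 * x\<^sup>2" using \<open>t0 > 0\<close> by (simp add: c_def power_mult_distrib)
    moreover have "(x - \<mu>)\<^sup>2 \<le> 2 * x\<^sup>2 + 2 * \<mu>\<^sup>2"
      using zero_le_power2[of "x + \<mu>"] by (simp add: power2_sum power2_diff)
    ultimately show ?thesis unfolding distrib_left by linarith
  qed
  have "(\<integral>\<^sup>+x. ennreal ((x - \<mu>)\<^sup>2) \<partial>Q)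
      \<le> (\<integral>\<^sup>+x. ennreal c * ennreal (exp (t0 * x)) + ennreal c * ennreal (exp (- t0 * x)) + ennreal (2 * \<mu>\<^sup>2) \<partial>Q)"
  proof (intro nn_integral_mono)
    fix x
    have "ennreal ((x - \<mu>)\<^sup>2) \<le> ennreal (c * exp (t0 * x) + c * exp (- t0 * x) + 2 * \<mu>\<^sup>2)" by (intro ennreal_leI le)
    also have "\<dots> = ennreal c * ennreal (exp (t0 * x)) + ennreal c * ennreal (exp (- t0 * x)) + ennreal (2 * \<mu>\<^sup>2)"
      using c by (simp add: ennreal_mult)
    finally show "ennreal ((x - \<mu>)\<^sup>2) \<le> ennreal c * ennreal (exp (t0 * x)) + ennreal c * ennreal (exp (- t0 * x)) + ennreal (2 * \<mu>\<^sup>2)" .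
  qed
  also have "\<dots> = ennreal c * mgf Q t0 + ennreal c * mgf Q (- t0) + ennreal (2 * \<mu>\<^sup>2)"
    unfolding mgf_def by (simp add: nn_integral_add nn_integral_cmult emeasure_space_1[simplified])
  also have "\<dots> < \<infinity>" using assms(3,4) by (simp add: ennreal_mult_less_top)
  finally show ?thesis .
qed

section \<open>The speed of the delayed process\<close>

text \<open>In an inner regime the mean separates the two thresholds; this ordering makes the two
  exit sets disjoint.\<close>

lemma threshold_mono:
  assumes A: "assumption_A l P r" and "i \<le> l"
  shows "threshold l r i \<le> threshold l r (Suc i)"
proof -
  have "r i < r (Suc i)" if "i \<noteq> 0" "i < l"
  proof -
    have "i \<in> {1..l - 1}" using that by auto
    then show ?thesis using A unfolding assumption_A_def by force
  qed
  then show ?thesis by (auto simp: threshold_def)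
qed

lemma window_exit_thresholds:
  assumes "assumption_A l P r" "i \<le> l" "real_distribution (P i)" "N > 0"
  shows "window_exit (P i) N (exit_up l r i) (exit_down l r i)"
    and "window_exit (P i) N (exit_down l r i) (exit_up l r i)"
proof -
  interpret real_distribution "P i" by fact
  have disj: "exit_up l r i \<inter> exit_down l r i = {}"
    using threshold_mono[OF assms(1,2)] unfolding exit_up_def exit_down_def
    by (auto simp: not_less dest: order.trans order.strict_trans2)
  have "exit_up l r i \<in> sets borel" "exit_down l r i \<in> sets borel"
    using assms(2) by (simp_all add: exit_up_eq exit_down_eq)
  then show "window_exit (P i) N (exit_up l r i) (exit_down l r i)"
    "window_exit (P i) N (exit_down l r i) (exit_up l r i)"
    using disj \<open>N > 0\<close> by unfold_locales auto
qed

lemma exit_sets_monotone: "closed_dir True (exit_up l r i)" "closed_dir False (exit_down l r i)"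
  unfolding closed_dir_def le_dir_def exit_up_def exit_down_def
  by (auto intro: order.trans order.strict_trans1[of "ereal _" "ereal _"])

lemma speed_eqI:
  assumes "prob_space M" and lim: "AE \<omega> in M. (\<lambda>n. X n \<omega> / real n) \<longlonglongrightarrow> s"
  shows "speed M X = s"
  unfolding speed_def
proof (rule the_equality[where P="\<lambda>s. AE \<omega> in M. (\<lambda>n. X n \<omega> / real n) \<longlonglongrightarrow> s", OF lim])
  interpret prob_space M by fact
  fix s' assume "AE \<omega> in M. (\<lambda>n. X n \<omega> / real n) \<longlonglongrightarrow> s'"
  with lim have "AE \<omega> in M. s' = s" by eventually_elim (rule LIMSEQ_unique)
  then show "s' = s" by simp
qed

definition up_rate :: "nat \<Rightarrow> (nat \<Rightarrow> real measure) \<Rightarrow> (nat \<Rightarrow> real) \<Rightarrow> nat \<Rightarrow> nat \<Rightarrow> real" where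
  "up_rate l P r N i = window_exit.rate (P i) N (exit_up l r i) (exit_down l r i)"

definition down_rate :: "nat \<Rightarrow> (nat \<Rightarrow> real measure) \<Rightarrow> (nat \<Rightarrow> real) \<Rightarrow> nat \<Rightarrow> nat \<Rightarrow> real" where
  "down_rate l P r N i = window_exit.rate (P i) N (exit_down l r i) (exit_up l r i)"

lemma delayed_speed:
  assumes dist: "\<And>i. i \<le> l \<Longrightarrow> real_distribution (P i)" and int: "\<And>i. i \<le> l \<Longrightarrow> integrable (P i) (\<lambda>x. x)"
    and A: "assumption_A l P r" and C: "assumption_C l P" and start: "i_start \<le> l" and N: "N > 0"
    and dp: "delayed_process l P r N i_start M X J"
    and exit: "\<And>i. i \<le> l \<Longrightarrow> window_prob (P i) N (exit_up l r i) > 0 \<or> window_prob (P i) N (exit_down l r i) > 0"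
    and up: "\<And>i. i < l \<Longrightarrow> up_rate l P r N i > 0"
    and down: "\<And>i. i < l \<Longrightarrow> down_rate l P r N (Suc i) > 0"
  shows "speed M X = (\<Sum>i\<le>l. weight (up_rate l P r N) (down_rate l P r N) i * mean (P i))
    / (\<Sum>i\<le>l. weight (up_rate l P r N) (down_rate l P r N) i)"
proof (rule speed_eqI)
  let ?u = "up_rate l P r N" and ?d = "down_rate l P r N"
  show M: "prob_space M" using dp by (simp add: delayed_process_def)
  have path: "regime_path l r N i_start (\<lambda>n. X n \<omega>) (\<lambda>n. J n \<omega>)" if "\<omega> \<in> space M" for \<omega>
    using dp that N unfolding delayed_process_def by unfold_locales auto
  have ci: "conditional_increments M X J i (P i)" if "i \<le> l" for i
  proof -
    show ?thesis
    proof (intro conditional_increments.intro conditional_increments_axioms.intro M)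
      fix n and B :: "real set" assume "B \<in> sets borel"
      then have "AE \<omega> in M. real_cond_exp M (past M X J n) (\<lambda>\<omega>'. indicator B (X (n + 1) \<omega>' - X n \<omega>')) \<omega> = measure (P (J n \<omega>)) B"
        using dp by (simp add: delayed_process_def)
      then show "AE \<omega> in M. J n \<omega> = i \<longrightarrow>
          real_cond_exp M (past M X J n) (\<lambda>\<omega>'. indicator B (X (n + 1) \<omega>' - X n \<omega>')) \<omega> = measure (P i) B"
        by eventually_elim auto
    next
      show "X n \<in> borel_measurable M" "J n \<in> measurable M (count_space UNIV)" for n
        using dp unfolding delayed_process_def by blast+
    qed (rule dist[OF that])
  qed
  obtain t0 where t0: "t0 > 0" "\<And>i. i \<le> l \<Longrightarrow> mgf (P i) t0 < \<infinity> \<and> mgf (P i) (- t0) < \<infinity>"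
    using C by (auto simp: assumption_C_def)
  have ae_mean: "AE \<omega> in M. \<forall>i\<in>{..l}. (\<lambda>n. (\<Sum>k<n. of_bool (J k \<omega> = i) * (X (Suc k) \<omega> - X k \<omega> - mean (P i))) / real n) \<longlonglongrightarrow> 0"
  proof (intro AE_finite_allI finite_atMost)
    fix i assume "i \<in> {..l}"
    then show "AE \<omega> in M. (\<lambda>n. (\<Sum>k<n. of_bool (J k \<omega> = i) * (X (Suc k) \<omega> - X k \<omega> - mean (P i))) / real n) \<longlonglongrightarrow> 0"
      using t0 by (intro increments_frequency ci int second_moment_finite[OF dist t0(1)]) auto
  qed
  have ae_up: "AE \<omega> in M. \<forall>i\<in>{..<l}. (\<lambda>n. ((\<Sum>k<n. of_bool (J k \<omega> = i \<and> J (Suc k) \<omega> = Suc i))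
      - ?u i * (\<Sum>k<n. of_bool (J k \<omega> = i))) / real n) \<longlonglongrightarrow> 0"
  proof (intro AE_finite_allI finite_lessThan)
    fix i assume "i \<in> {..<l}"
    then have i: "i \<le> l" "i < l" by auto
    note W = window_exit_thresholds(1)[OF A i(1) dist[OF i(1)] N]
    show "AE \<omega> in M. (\<lambda>n. ((\<Sum>k<n. of_bool (J k \<omega> = i \<and> J (Suc k) \<omega> = Suc i))
        - ?u i * (\<Sum>k<n. of_bool (J k \<omega> = i))) / real n) \<longlonglongrightarrow> 0"
      unfolding up_rate_def
    proof (rule exit_frequency[OF ci[OF i(1)] W])
      fix \<omega> assume "\<omega> \<in> space M"
      interpret regime_path l r N i_start "\<lambda>n. X n \<omega>" "\<lambda>n. J n \<omega>" by (rule path) fact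
      interpret window_exit "P i" N "exit_up l r i" "exit_down l r i" by (rule W)
      \<comment> \<open>At regime 0 the truncated \<open>i - 1\<close> would be \<open>i\<close>
        itself, contrary to what is required of \<open>B\<close>; there the exit set is
        empty.\<close>
      have down_0: "i = 0 \<Longrightarrow> a \<notin> exit_down l r i" for a by (simp add: exit_down_eq)
      show "regime_path_exit l r N i_start (\<lambda>n. X n \<omega>) (\<lambda>n. J n \<omega>) (P i) (exit_up l r i) (exit_down l r i) i (Suc i)"
      proof
        show "next_regime l r i a = Suc i" if "a \<in> exit_up l r i" for a
          using that disjoint by (auto simp: next_regime_def exit_up_def exit_down_def)
        show "next_regime l r i a \<noteq> i \<and> next_regime l r i a \<noteq> Suc i" if "a \<in> exit_down l r i" for a
          using that down_0[of a] by (cases i) (auto simp: next_regime_def exit_down_def)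
        show "next_regime l r i a = i" if "a \<notin> exit_up l r i" "a \<notin> exit_down l r i" for a
          using that by (auto simp: next_regime_def exit_up_def exit_down_def)
      qed simp
    qed (use exit[OF i(1)] window_exit.stay_prob_less_1[OF W] in blast)
  qed
  have ae_down: "AE \<omega> in M. \<forall>i\<in>{..<l}. (\<lambda>n. ((\<Sum>k<n. of_bool (J k \<omega> = Suc i \<and> J (Suc k) \<omega> = i))
      - ?d (Suc i) * (\<Sum>k<n. of_bool (J k \<omega> = Suc i))) / real n) \<longlonglongrightarrow> 0"
  proof (intro AE_finite_allI finite_lessThan)
    fix i assume "i \<in> {..<l}"
    then have i: "Suc i \<le> l" by auto
    note W = window_exit_thresholds(2)[OF A i dist[OF i] N]
    show "AE \<omega> in M. (\<lambda>n. ((\<Sum>k<n. of_bool (J k \<omega> = Suc i \<and> J (Suc k) \<omega> = i))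
        - ?d (Suc i) * (\<Sum>k<n. of_bool (J k \<omega> = Suc i))) / real n) \<longlonglongrightarrow> 0"
      unfolding down_rate_def
    proof (rule exit_frequency[OF ci[OF i] W])
      fix \<omega> assume "\<omega> \<in> space M"
      interpret regime_path l r N i_start "\<lambda>n. X n \<omega>" "\<lambda>n. J n \<omega>" by (rule path) fact
      interpret window_exit "P (Suc i)" N "exit_down l r (Suc i)" "exit_up l r (Suc i)" by (rule W)
      show "regime_path_exit l r N i_start (\<lambda>n. X n \<omega>) (\<lambda>n. J n \<omega>) (P (Suc i)) (exit_down l r (Suc i)) (exit_up l r (Suc i)) (Suc i) i"
      proof
        show "next_regime l r (Suc i) a = i" if "a \<in> exit_down l r (Suc i)" for a
          using that by (auto simp: next_regime_def exit_down_def)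
        show "next_regime l r (Suc i) a \<noteq> Suc i \<and> next_regime l r (Suc i) a \<noteq> i" if "a \<in> exit_up l r (Suc i)" for a
          using that disjoint by (auto simp: next_regime_def exit_up_def exit_down_def)
        show "next_regime l r (Suc i) a = Suc i" if "a \<notin> exit_down l r (Suc i)" "a \<notin> exit_up l r (Suc i)" for a
          using that by (auto simp: next_regime_def exit_up_def exit_down_def)
      qed simp
    qed (use exit[OF i] window_exit.stay_prob_less_1[OF W] in blast)
  qed
  have "AE \<omega> in M. \<omega> \<in> space M" by (rule AE_space)
  with ae_mean ae_up ae_down
  show "AE \<omega> in M. (\<lambda>n. X n \<omega> / real n) \<longlonglongrightarrow> (\<Sum>i\<le>l. weight ?u ?d i * mean (P i)) / (\<Sum>i\<le>l. weight ?u ?d i)"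
  proof eventually_elim
    case (elim \<omega>)
    interpret regime_path l r N i_start "\<lambda>n. X n \<omega>" "\<lambda>n. J n \<omega>" by (rule path) (use elim in simp)
    define T where "T i n = (\<Sum>k<n. of_bool (J k \<omega> = i) :: real)" for i n
    define U where "U i n = (\<Sum>k<n. of_bool (J k \<omega> = i \<and> J (Suc k) \<omega> = Suc i) :: real)" for i n
    define D where "D i n = (\<Sum>k<n. of_bool (J k \<omega> = Suc i \<and> J (Suc k) \<omega> = i) :: real)" for i n
    have one: "(\<Sum>i\<le>l. of_bool (J k \<omega> = i) * f i) = (f (J k \<omega>) :: real)" for k f
    proof -
      have "(\<Sum>i\<le>l. of_bool (J k \<omega> = i) * f i) = (\<Sum>i\<in>{J k \<omega>}. f i)"
        using regime_le[OF start, of k] by (intro sum.mono_neutral_cong_right) auto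
      then show ?thesis by simp
    qed
    have lim: "(\<lambda>n. T i n / real n) \<longlonglongrightarrow> weight ?u ?d i / (\<Sum>k\<le>l. weight ?u ?d k)" if "i \<le> l" for i
    proof (rule occupation_limit[where t="\<lambda>i n. T i n / real n" and u="?u" and d="?d" and l=l and i=i])
      show "\<forall>\<^sub>F n in sequentially. (\<Sum>i\<le>l. T i n / real n) = 1"
        using eventually_gt_at_top[of 0]
      proof eventually_elim
        case (elim n)
        have "(\<Sum>i\<le>l. T i n) = (\<Sum>k<n. \<Sum>i\<le>l. of_bool (J k \<omega> = i))" unfolding T_def by (rule sum.swap)
        also have "\<dots> = (\<Sum>k<n. 1)" using one[of _ "\<lambda>_. 1"] by (intro sum.cong) auto
        finally show ?case using elim by (simp flip: sum_divide_distrib)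
      qed
      fix i assume i: "i < l"
      have a: "(\<lambda>n. (U i n - ?u i * T i n) / real n) \<longlonglongrightarrow> 0" using elim(2) i by (simp add: U_def T_def)
      have b: "(\<lambda>n. (D i n - ?d (Suc i) * T (Suc i) n) / real n) \<longlonglongrightarrow> 0" using elim(3) i by (simp add: D_def T_def)
      have c: "(\<lambda>n. (U i n - D i n) / real n) \<longlonglongrightarrow> 0"
      proof (rule tendsto_0_of_bounded_difference[where a="\<lambda>_. 0" and C=1])
        show "\<bar>0 - (U i n - D i n)\<bar> \<le> 1" for n
          unfolding U_def D_def crossings_balance by simp
      qed simp
      \<comment> \<open>Upward exits follow \<open>?u i * T i n\<close>, downward exits of the next
        regime follow \<open>?d (Suc i) * T (Suc i) n\<close>, and the two counts agree up to 1;
        adding the three errors yields the balance relation.\<close>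
      have "(\<lambda>n. (U i n - D i n) / real n - (U i n - ?u i * T i n) / real n + (D i n - ?d (Suc i) * T (Suc i) n) / real n)
          \<longlonglongrightarrow> 0 - 0 + 0"
        by (intro tendsto_add tendsto_diff a b c)
      then show "(\<lambda>n. ?u i * (T i n / real n) - ?d (Suc i) * (T (Suc i) n / real n)) \<longlonglongrightarrow> 0"
        by (simp add: diff_divide_distrib)
    qed (use up down that in auto)
    have X: "X n \<omega> / real n = (\<Sum>i\<le>l. (\<Sum>k<n. of_bool (J k \<omega> = i) * (X (Suc k) \<omega> - X k \<omega> - mean (P i))) / real n + T i n / real n * mean (P i))" for n
    proof -
      have "X 0 \<omega> = 0" using dp elim(4) by (simp add: delayed_process_def)
      then have "X n \<omega> = (\<Sum>k<n. X (Suc k) \<omega> - X k \<omega>)" using sum_lessThan_telescope[of "\<lambda>k. X k \<omega>" n] by simp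
      also have "\<dots> = (\<Sum>k<n. \<Sum>i\<le>l. of_bool (J k \<omega> = i) * ((X (Suc k) \<omega> - X k \<omega> - mean (P i)) + mean (P i)))"
        unfolding one by simp
      also have "\<dots> = (\<Sum>i\<le>l. \<Sum>k<n. of_bool (J k \<omega> = i) * ((X (Suc k) \<omega> - X k \<omega> - mean (P i)) + mean (P i)))"
        by (rule sum.swap)
      also have "\<dots> = (\<Sum>i\<le>l. (\<Sum>k<n. of_bool (J k \<omega> = i) * (X (Suc k) \<omega> - X k \<omega> - mean (P i))) + T i n * mean (P i))"
        unfolding distrib_left sum.distrib T_def sum_distrib_right ..
      finally show ?thesis by (simp add: sum_divide_distrib add_divide_distrib)
    qed
    have "(\<lambda>n. \<Sum>i\<le>l. (\<Sum>k<n. of_bool (J k \<omega> = i) * (X (Suc k) \<omega> - X k \<omega> - mean (P i))) / real n + T i n / real n * mean (P i))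
        \<longlonglongrightarrow> (\<Sum>i\<le>l. 0 + weight ?u ?d i / (\<Sum>k\<le>l. weight ?u ?d k) * mean (P i))"
      using elim(1) by (intro tendsto_sum tendsto_add tendsto_mult tendsto_const lim) auto
    then show ?case unfolding X by (simp add: sum_divide_distrib)
  qed
qed

text \<open>Reindexing pairs each downward rate with the upward rate across the same edge. All
  exponents then share the shift \<open>Iu 0\<close>, so comparing them is comparing the exponents
  of the weights.\<close>

lemma Lam_eq:
  assumes "\<And>k. k < l \<Longrightarrow> legendre_fenchel (P k) (r (Suc k)) = ereal (Iu k)"
    and "\<And>k. k < l \<Longrightarrow> legendre_fenchel (P (Suc k)) (r (Suc k)) = ereal (Jd (Suc k))"
    and "l \<ge> 1" "i \<le> l"
  shows "Lam l P r i = ereal (Iu 0 + (\<Sum>k<i. Jd (Suc k) - Iu k))"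
proof -
  define S where "S m = (\<Sum>k=1..m. Jd k - Iu k)" for m
  have S: "(\<Sum>k=1..m. legendre_fenchel (P k) (r k) - legendre_fenchel (P k) (r (k + 1))) = ereal (S m)" if "m < l" for m
  proof -
    have "legendre_fenchel (P k) (r k) - legendre_fenchel (P k) (r (k + 1)) = ereal (Jd k - Iu k)" if "k \<in> {1..m}" for k
    proof -
      have "k < l" "k - 1 < l" "Suc (k - 1) = k" using that \<open>m < l\<close> by auto
      then show ?thesis using assms(1)[of k] assms(2)[of "k - 1"] by simp
    qed
    then have "(\<Sum>k=1..m. legendre_fenchel (P k) (r k) - legendre_fenchel (P k) (r (k + 1))) = (\<Sum>k=1..m. ereal (Jd k - Iu k))"
      by (intro sum.cong) auto
    then show ?thesis by (simp add: S_def)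
  qed
  have shift: "(\<Sum>k<m. Jd (Suc k) - Iu k) = S m + Iu m - Iu 0" for m
    by (induction m) (auto simp: S_def)
  consider "i = 0" | "0 < i" "i < l" | "i = l" "0 < i" using assms(3,4) by linarith
  then show ?thesis
  proof cases
    case 1
    then show ?thesis using assms(1)[of 0] assms(3) by (simp add: Lam_def)
  next
    case 2
    then show ?thesis using assms(1)[of i] S[of i] shift[of i] by (simp add: Lam_def)
  next
    case 3
    \<comment> \<open>The top regime has no upward exit; its last term is the downward rate
      \<open>Jd l\<close>, which explains the separate form of the last exponent.\<close>
    have "(\<Sum>k<i. Jd (Suc k) - Iu k) = S (l - 1) - Iu 0 + Jd l"
      using 3 shift[of "l - 1"] by (cases l) auto
    then show ?thesis using 3 assms(2)[of "l - 1"] S[of "l - 1"] by (simp add: Lam_def)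
  qed
qed

theorem theorem1:
  fixes l i_start i0 :: nat
    and P :: "nat \<Rightarrow> real measure"
    and r :: "nat \<Rightarrow> real"
    and M :: "nat \<Rightarrow> 'a measure"
    and X :: "nat \<Rightarrow> nat \<Rightarrow> 'a \<Rightarrow> real"
    and J :: "nat \<Rightarrow> nat \<Rightarrow> 'a \<Rightarrow> nat"
  assumes "l \<ge> 1"
    and "\<And>i. i \<le> l \<Longrightarrow> real_distribution (P i)"
    and "\<And>i. i \<le> l \<Longrightarrow> integrable (P i) (\<lambda>x. x)"
    and "assumption_A l P r"
    and "assumption_B l P r"
    and "assumption_C l P"
    and "i_start \<le> l"
    and "\<And>N. N \<ge> l \<Longrightarrow> delayed_process l P r N i_start (M N) (X N) (J N)"
    and "{i. i \<le> l \<and> Lam l P r i = Max (Lam l P r ` {..l})} = {i0}"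
  shows "(\<lambda>N. speed (M N) (X N)) \<longlonglongrightarrow> mean (P i0)"
proof -
  note dist = assms(2) and int = assms(3) and A = assms(4) and B = assms(5)
  have A': "mean (P 0) < r 1" "r l < mean (P l)"
    "\<And>k. k \<in> {1..l - 1} \<Longrightarrow> r k < mean (P k) \<and> mean (P k) < r (k + 1)"
    using A unfolding assumption_A_def by blast+
  have B': "measure (P 0) {r 1..} > 0" "measure (P l) {..<r l} > 0"
    "\<And>k. k \<in> {1..l - 1} \<Longrightarrow> measure (P k) {..<r k} > 0 \<and> measure (P k) {r (k + 1)..} > 0"
    using B unfolding assumption_B_def by blast+
  have "\<forall>k\<in>{..<l}. \<exists>I. legendre_fenchel (P k) (r (Suc k)) = ereal I \<and> decays (\<lambda>N. window_prob (P k) N {r (Suc k)..}) I"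
  proof (rule ballI, rule window_prob_decays_ge)
    fix k assume k: "k \<in> {..<l}"
    \<comment> \<open>Assumptions A and B state the two outermost regimes apart from the inner
      ones.\<close>
    then have "k = 0 \<or> k \<in> {1..l - 1}" by auto
    then show "mean (P k) < r (Suc k)" "measure (P k) {r (Suc k)..} > 0"
      using A'(1) A'(3)[of k] B'(1) B'(3)[of k] by (elim disjE; simp)+
    show "real_distribution (P k)" "integrable (P k) (\<lambda>x. x)" using k by (intro dist int; simp)+
  qed
  from bchoice[OF this] obtain Iu where Iu:
    "\<forall>k\<in>{..<l}. legendre_fenchel (P k) (r (Suc k)) = ereal (Iu k) \<and> decays (\<lambda>N. window_prob (P k) N {r (Suc k)..}) (Iu k)" ..
  have "\<forall>k\<in>{..<l}. \<exists>I. legendre_fenchel (P (Suc k)) (r (Suc k)) = ereal I \<and> decays (\<lambda>N. window_prob (P (Suc k)) N {..<r (Suc k)}) I"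
  proof (rule ballI, rule window_prob_decays_less)
    fix k assume k: "k \<in> {..<l}"
    then have "Suc k = l \<or> Suc k \<in> {1..l - 1}" by auto
    then show "r (Suc k) < mean (P (Suc k))" "measure (P (Suc k)) {..<r (Suc k)} > 0"
      using A'(2) A'(3)[of "Suc k"] B'(2) B'(3)[of "Suc k"] by (elim disjE; simp)+
    show "real_distribution (P (Suc k))" "integrable (P (Suc k)) (\<lambda>x. x)" using k by (intro dist int; simp)+
  qed
  from bchoice[OF this] obtain Jd' where Jd': "\<forall>k\<in>{..<l}. legendre_fenchel (P (Suc k)) (r (Suc k)) = ereal (Jd' k)
    \<and> decays (\<lambda>N. window_prob (P (Suc k)) N {..<r (Suc k)}) (Jd' k)" ..
  \<comment> \<open>The choice function is indexed by the edge; downward rates are indexed by the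
    regime above it.\<close>
  define Jd where "Jd k = Jd' (k - 1)" for k
  have up_prob: "decays (\<lambda>N. window_prob (P k) N (exit_up l r k)) (Iu k)" if "k < l" for k
    using that Iu by (simp add: exit_up_eq)
  have down_prob: "decays (\<lambda>N. window_prob (P (Suc k)) N (exit_down l r (Suc k))) (Jd (Suc k))" if "k < l" for k
    using that Jd' by (simp add: exit_down_eq Jd_def)
  have up: "decays (\<lambda>N. up_rate l P r N k) (Iu k)" if k: "k < l" for k
    unfolding up_rate_def
    by (rule exit_rate_decays[where up=True, OF window_exit_thresholds(1)[OF A] _ _ up_prob[OF k]])
       (use k dist exit_sets_monotone in auto)
  have down: "decays (\<lambda>N. down_rate l P r N (Suc k)) (Jd (Suc k))" if k: "k < l" for k
    unfolding down_rate_def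
    by (rule exit_rate_decays[where up=False, OF window_exit_thresholds(2)[OF A] _ _ down_prob[OF k]])
       (use k dist exit_sets_monotone in auto)
  have Lam: "Lam l P r i = ereal (Iu 0 + (\<Sum>k<i. Jd (Suc k) - Iu k))" if "i \<le> l" for i
    by (rule Lam_eq) (use Iu Jd' assms(1) that in \<open>simp_all add: Jd_def\<close>)
  have i0: "i0 \<le> l" "Lam l P r i0 = Max (Lam l P r ` {..l})" using assms(9) by auto
  have max: "(\<Sum>k<i. Jd (Suc k) - Iu k) < (\<Sum>k<i0. Jd (Suc k) - Iu k)" if "i \<le> l" "i \<noteq> i0" for i
  proof -
    have "Lam l P r i \<le> Lam l P r i0" unfolding i0(2) using that by (intro Max_ge) auto
    moreover have "Lam l P r i \<noteq> Lam l P r i0" using assms(9) that i0(2) by auto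
    ultimately show ?thesis using Lam[OF that(1)] Lam[OF i0(1)] by simp
  qed
  have lim: "(\<lambda>N. (\<Sum>i\<le>l. weight (up_rate l P r N) (down_rate l P r N) i * mean (P i))
      / (\<Sum>i\<le>l. weight (up_rate l P r N) (down_rate l P r N) i)) \<longlonglongrightarrow> mean (P i0)"
    by (rule weighted_mean_limit[where Ju=Iu and Jd=Jd]) (use up down i0 max in auto)
  have "\<forall>\<^sub>F N in sequentially. \<forall>k\<in>{..<l}. up_rate l P r N k > 0 \<and> down_rate l P r N (Suc k) > 0
      \<and> window_prob (P k) N (exit_up l r k) > 0 \<and> window_prob (P (Suc k)) N (exit_down l r (Suc k)) > 0"
    using up down up_prob down_prob unfolding decays_def
    by (intro eventually_ball_finite ballI eventually_conj) auto
  then have "\<forall>\<^sub>F N in sequentially. (\<Sum>i\<le>l. weight (up_rate l P r N) (down_rate l P r N) i * mean (P i))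
      / (\<Sum>i\<le>l. weight (up_rate l P r N) (down_rate l P r N) i) = speed (M N) (X N)"
    using eventually_ge_at_top[of l]
  proof eventually_elim
    case (elim N)
    \<comment> \<open>Every regime has a usable exit: upwards below \<open>l\<close>, and downwards
      at \<open>l\<close>, which is the edge \<open>l - 1\<close> because \<open>l\<close> is at
      least 1.\<close>
    have "window_prob (P i) N (exit_up l r i) > 0 \<or> window_prob (P i) N (exit_down l r i) > 0" if "i \<le> l" for i
      using elim(1) that assms(1) by (cases "i < l") (auto dest!: bspec[of _ _ "l - 1"])
    then show ?case
      using elim assms(1)
      by (intro delayed_speed[OF dist int A assms(6,7) _ assms(8), symmetric]) auto
  qed
  with lim show ?thesis by (rule Lim_transform_eventually)
qed

end
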